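(* (Decidability of type checking.) All typing judgments of CoLF are algorithmically decidable: given the inputs, it is decidable whether $\Sigma\ \mathsf{sig}$, $\vdash_\Sigma\Xi\ \mathsf{sig}$, $\vdash_{\Xi;\Sigma}\Gamma\ \mathsf{ctx}$, $\Gamma\vdash_{\Xi;\Sigma}K\Leftarrow\mathsf{kind}$, $\Gamma\vdash_{\Xi;\Sigma}A\Leftarrow\mathsf{type}/\mathsf{cotype}$, $\Gamma\vdash_{\Xi;\Sigma}M\Leftarrow A$, $\Gamma\vdash_\Sigma A_1=A_2$ and $\Gamma\vdash_\Sigma P_1=P_2$ hold, and the synthesis judgments $\Gamma\vdash_{\Xi;\Sigma}P\Rightarrow K$, $\Gamma\vdash_{\Xi;\Sigma}S\rhd K\Rightarrow K'$, $\Gamma\vdash_{\Xi;\Sigma}R\Rightarrow P$, $\Gamma\vdash_{\Xi;\Sigma}S\rhd A\Rightarrow P$ can be decided (computing the output or failing).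
   Context: CoLF syntax: signatures $\Sigma$ with declarations $a:K$, $c:A$, $r:A=M$ (recursion constants; bodies may refer to recursion constants declared later, all other references are to earlier declarations); contexts $\Gamma::=\cdot\mid\Gamma,x{:}A\mid\Gamma,x\,\hat{:}\,A$; kinds $K::=\mathsf{type}\mid\mathsf{cotype}\mid\Pi x{:}A.K\mid\Pi x\,\hat{:}\,A.K$; types $A::=P\mid\Pi x{:}A_2.A_1\mid\Pi x\,\hat{:}\,A_2.A_1$, $P::=a\cdot S$; terms $M::=R\mid\lambda x.M$, $R::=H\cdot S$, $H::=x\mid c\mid r$; spines $S::=()\mid M;S\mid[y];S$. Hereditary substitution $[N/x]^\tau$ on simple types $\tau::=*\mid\tau_1\to\tau_2$ (erasure $(\Pi x{:}A_2.A_1)^o=A_2^o\to A_1^o$, $(\Pi x\,\hat{:}\,A_2.A_1)^o=*\to A_1^o$, $P^o=*$) and renaming $\{y/x\}$ are as usual for canonical LF, with $([y];S)\rhd^{*\to\tau}(\lambda x.M)=S\rhd^\tau\{y/x\}M$ and substitution for a prepattern argument undefined. Rules. $\Sigma\ \mathsf{sig}$ iff $\vdash_\Sigma\Sigma\ \mathsf{sig}$. $\vdash_\Sigma\Xi\ \mathsf{sig}$: empty is fine; $\Xi,a{:}K$ if $\Xi$ ok and $\vdash_{\Xi;\Sigma}K\Leftarrow\mathsf{kind}$; $\Xi,c{:}A$ if $\Xi$ ok and $A\Leftarrow\mathsf{type}/\mathsf{cotype}$; $\Xi,r{:}A=M$ if $\Xi$ ok, $\vdash_{\Xi;\Sigma}A\Leftarrow\mathsf{type}/\mathsf{cotype}$,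 $A$ consists only of prepattern $\Pi$'s over an atomic type, $M$ is contractive (its head is not a recursion constant), $r$ is guarded in $M$ (every path from the root of $M$, unfolding other recursion constants of $\Sigma$, to an occurrence of $r$ passes through a coinductive constructor whose priority is highest among the constructors on that path; priorities: later-declared type families have higher priority, constructors inherit the priority of their target family, a constructor is coinductive if its target family's kind ends in $\mathsf{cotype}$), and — deferred until all declarations of $\Sigma$ have been checked — $\vdash_{\Xi;\Sigma}M\Leftarrow A$. Contexts: each added $x{:}A$ or $x\,\hat{:}\,A$ needs $A\Leftarrow\mathsf{type}/\mathsf{cotype}$. Kinds: $\mathsf{type},\mathsf{cotype}\Leftarrow\mathsf{kind}$; $\Pi x{:}A.K$ / $\Pi x\,\hat{:}\,A.K$ if $A\Leftarrow\mathsf{type}/\mathsf{cotype}$ and $K\Leftarrow\mathsf{kind}$ in the extended context. Types: $\Pi$'s similarly; $P\Leftarrow\mathsf{type}/\mathsf{cotype}$ if $P\Rightarrow\mathsf{type}$ or $\mathsf{cotype}$; $a\cdot S\Rightarrow K'$ if $a{:}K\in\Xi$ and $S\rhd K\Rightarrow K'$; kind spines: $()\rhd K\Rightarrow K$, $M;S\rhd\Pi x{:}A_2.K$ if $M\Leftarrow A_2$ and $S\rhd[M/x]^{A_2^o}K$, $[y];S\rhd\Pi x\,\hat{:}\,A_2.K$ if $y\,\hat{:}\,A_2'\in\Gamma$, $A_2'=A_2$ and $S\rhd\{y/x\}K$. Terms: $\lambda x.M\Leftarrow\Pi x{:}A_2.A_1$ / $\Pi x\,\hat{:}\,A_2.A_1$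 if $M\Leftarrow A_1$ in $\Gamma,x{:}A_2$ / $\Gamma,x\,\hat{:}\,A_2$; $R\Leftarrow P$ if $R\Rightarrow P'$ and $\Gamma\vdash_\Sigma P'=P$; $x\cdot S\Rightarrow P$ if $x{:}A$ or $x\,\hat{:}\,A$ in $\Gamma$ and $S\rhd A\Rightarrow P$; $c\cdot S\Rightarrow P$ if $c{:}A\in\Xi$ and $S\rhd A\Rightarrow P$; $r\cdot S\Rightarrow P$ if $r{:}A=M\in\Xi$ (or $\in\Sigma$ while checking deferred bodies) and $S\rhd A\Rightarrow P$; type spines analogous to kind spines, ending with $()\rhd P\Rightarrow P$. Type equality: structural on $\Pi$'s, and $a\cdot S=a\cdot S'$ iff $\cdot;|\Gamma|\vdash_\Sigma S=S'$ in the CoLF term equality algorithm, which decides equality of the infinite Böhm-tree unfoldings of rational terms (unfolding $r\cdot S$ with $S$ a prepattern spine to $S\rhd^{A^o}M$, memoising encountered equations and closing a goal when it is a variable renaming of a memoised equation). *)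

theory Defs
  imports Main "HOL-Library.Nat_Bijection" "HOL-Library.Monad_Syntax"
begin

section \<open>Computability\<close>

text \<open>Kleene's \<open>\<mu>\<close>-recursive functions.  A primitive recursion takes its recursion argument
  first, and its step function receives the predecessor, the previous value and the parameters;
  minimisation is over the first argument.\<close>

datatype recf =
    RZero
  | RSucc
  | RProj nat
  | RComp recf "recf list"
  | RPrim recf recf
  | RMu recf

inductive rec_eval :: "recf \<Rightarrow> nat list \<Rightarrow> nat \<Rightarrow> bool" where
  "rec_eval RZero xs 0"
| "rec_eval RSucc [x] (Suc x)"
| "i < length xs \<Longrightarrow> rec_eval (RProj i) xs (xs ! i)"
| "\<lbrakk>list_all2 (\<lambda>g y. rec_eval g xs y) gs ys; rec_eval f ys z\<rbrakk> \<Longrightarrow> rec_eval (RComp f gs) xs z"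
| "rec_eval f xs y \<Longrightarrow> rec_eval (RPrim f g) (0 # xs) y"
| "\<lbrakk>rec_eval (RPrim f g) (n # xs) y; rec_eval g (n # y # xs) z\<rbrakk>
    \<Longrightarrow> rec_eval (RPrim f g) (Suc n # xs) z"
| "\<lbrakk>rec_eval f (n # xs) 0; \<forall>m<n. \<exists>y. rec_eval f (m # xs) (Suc y)\<rbrakk> \<Longrightarrow> rec_eval (RMu f) xs n"

inductive_cases rec_eval_RZeroE: "rec_eval RZero xs y"
inductive_cases rec_eval_RSuccE: "rec_eval RSucc xs y"
inductive_cases rec_eval_RProjE: "rec_eval (RProj i) xs y"
inductive_cases rec_eval_RCompE: "rec_eval (RComp f gs) xs y"
inductive_cases rec_eval_RPrim0E: "rec_eval (RPrim f g) (0 # xs) y"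
inductive_cases rec_eval_RPrimSucE: "rec_eval (RPrim f g) (Suc n # xs) y"
inductive_cases rec_eval_RMuE: "rec_eval (RMu f) xs y"

lemma rec_eval_deterministic: "rec_eval f xs y \<Longrightarrow> rec_eval f xs z \<Longrightarrow> y = z"
proof (induction arbitrary: z rule: rec_eval.induct)
  case (1 xs)
  then show ?case by (rule rec_eval_RZeroE) simp
next
  case (2 x)
  then show ?case by (rule rec_eval_RSuccE) simp
next
  case (3 i xs)
  from "3.prems" show ?case by (rule rec_eval_RProjE) simp
next
  case (4 xs gs ys f w)
  from "4.prems" obtain ys' where ys': "list_all2 (\<lambda>g y. rec_eval g xs y) gs ys'" "rec_eval f ys' z"
    by (rule rec_eval_RCompE)
  have "ys = ys'"
  proof (rule nth_equalityI)
    show "length ys = length ys'"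
      using list_all2_lengthD[OF "4.IH"(1)] list_all2_lengthD[OF ys'(1)] by simp
    fix i
    assume "i < length ys"
    then have i: "i < length gs" using list_all2_lengthD[OF "4.IH"(1)] by simp
    show "ys ! i = ys' ! i"
      using list_all2_nthD[OF "4.IH"(1) i] list_all2_nthD[OF ys'(1) i] by blast
  qed
  with ys'(2) have "rec_eval f ys z" by simp
  then show ?case by (rule "4.IH"(2))
next
  case (5 f xs y g)
  from "5.prems" have "rec_eval f xs z" by (rule rec_eval_RPrim0E)
  then show ?case by (rule "5.IH")
next
  case (6 f g n xs y w)
  from "6.prems" obtain y' where y': "rec_eval (RPrim f g) (n # xs) y'" "rec_eval g (n # y' # xs) z"
    by (rule rec_eval_RPrimSucE)
  have "y = y'" using y'(1) by (rule "6.IH"(1))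
  with y'(2) have "rec_eval g (n # y # xs) z" by simp
  then show ?case by (rule "6.IH"(2))
next
  case (7 f n xs)
  from "7.prems" have z: "rec_eval f (z # xs) 0" "\<forall>m<z. \<exists>y. rec_eval f (m # xs) (Suc y)"
    by (blast elim: rec_eval_RMuE)+
  have "\<not> n < z"
  proof
    assume "n < z"
    with z(2) obtain y where "rec_eval f (n # xs) (Suc y)" by blast
    then have "0 = Suc y" by (rule "7.IH"(1))
    then show False by simp
  qed
  moreover have "\<not> z < n"
  proof
    assume "z < n"
    with "7.IH"(2) obtain y where "\<forall>w. rec_eval f (z # xs) w \<longrightarrow> Suc y = w" by blast
    with z(1) have "Suc y = 0" by blast
    then show False by simp
  qed
  ultimately show ?case by simp
qed

class godel =
  fixes gcode :: "'a \<Rightarrow> nat"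
  assumes gcode_inject: "gcode x = gcode y \<Longrightarrow> x = y"

lemma gcode_eq_iff [simp]: "gcode x = gcode y \<longleftrightarrow> x = (y :: 'a::godel)"
  using gcode_inject by blast

definition computable :: "('a::godel \<Rightarrow> 'b::godel) \<Rightarrow> bool" where
  "computable g \<longleftrightarrow> (\<exists>f. \<forall>x. rec_eval f [gcode x] (gcode (g x)))"

definition decidable :: "('a::godel \<Rightarrow> bool) \<Rightarrow> bool" where
  "decidable P \<longleftrightarrow> (\<exists>f. \<forall>x. rec_eval f [gcode x] (if P x then 1 else 0))"

instantiation nat :: godel
begin
definition gcode_nat :: "nat \<Rightarrow> nat" where "gcode_nat n = n"
instance by standard (simp add: gcode_nat_def)
end

instantiation bool :: godel
begin
definition gcode_bool :: "bool \<Rightarrow> nat" where "gcode_bool b = (if b then 1 else 0)"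
instance by standard (simp add: gcode_bool_def split: if_splits)
end

instantiation prod :: (godel, godel) godel
begin
definition gcode_prod :: "'a \<times> 'b \<Rightarrow> nat" where
  "gcode_prod p = prod_encode (gcode (fst p), gcode (snd p))"
instance by standard (simp add: gcode_prod_def prod_eq_iff)
end

instantiation option :: (godel) godel
begin
definition gcode_option :: "'a option \<Rightarrow> nat" where
  "gcode_option z = (case z of None \<Rightarrow> 0 | Some x \<Rightarrow> Suc (gcode x))"
instance by standard (auto simp: gcode_option_def split: option.splits)
end

instantiation list :: (godel) godel
begin
definition gcode_list :: "'a list \<Rightarrow> nat" where
  "gcode_list xs = list_encode (map gcode xs)"
instance by standard (simp add: gcode_list_def list_encode_eq inj_map_eq_map inj_def)
end

text \<open>For a judgment \<open>J\<close> with input \<open>x\<close> and output \<open>y\<close>: a total algorithm that returns the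
  output if there is one and reports failure (\<open>None\<close>) otherwise; in particular the output is
  determined by the input.\<close>

definition decidable_synth :: "('a::godel \<Rightarrow> 'b::godel \<Rightarrow> bool) \<Rightarrow> bool" where
  "decidable_synth J \<longleftrightarrow> (\<exists>g. computable g \<and> (\<forall>x y. J x y \<longleftrightarrow> g x = Some y))"


section \<open>Syntax\<close>

text \<open>Variables are de Bruijn indices.  Type families, constructors and recursion constants are
  named by natural numbers, in three separate name spaces.  In signatures and contexts the most
  recent declaration is the head of the list, so that \<open>d # \<Xi>\<close> is the signature \<open>\<Xi>, d\<close>.\<close>

datatype head = Var nat | Con nat | Rec nat

datatype tm = Neu neu | Lam tm
  and neu = App head spine
  and spine = SNil | SArg tm spine | SPre nat spine

datatype aty = Fam nat spine

datatype ty = Atom aty | Pi ty ty | PrePi ty ty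

datatype kind = Type | Cotype | KPi ty kind | KPrePi ty kind

datatype decl = FamDecl nat kind | ConDecl nat ty | RecDecl nat ty tm

type_synonym sig = "decl list"

datatype binding = Ord ty | Pre ty

type_synonym ctx = "binding list"

datatype stp = Base | Arr stp stp

primrec erase :: "ty \<Rightarrow> stp" where
  "erase (Atom P) = Base"
| "erase (Pi A2 A1) = Arr (erase A2) (erase A1)"
| "erase (PrePi A2 A1) = Arr Base (erase A1)"

primrec fam_kind :: "sig \<Rightarrow> nat \<Rightarrow> kind option" where
  "fam_kind [] a = None"
| "fam_kind (d # \<Xi>) a =
    (case d of FamDecl b K \<Rightarrow> if b = a then Some K else fam_kind \<Xi> a | _ \<Rightarrow> fam_kind \<Xi> a)"

primrec con_type :: "sig \<Rightarrow> nat \<Rightarrow> ty option" where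
  "con_type [] c = None"
| "con_type (d # \<Xi>) c =
    (case d of ConDecl b A \<Rightarrow> if b = c then Some A else con_type \<Xi> c | _ \<Rightarrow> con_type \<Xi> c)"

primrec rec_def :: "sig \<Rightarrow> nat \<Rightarrow> (ty \<times> tm) option" where
  "rec_def [] r = None"
| "rec_def (d # \<Xi>) r =
    (case d of RecDecl b A M \<Rightarrow> if b = r then Some (A, M) else rec_def \<Xi> r | _ \<Rightarrow> rec_def \<Xi> r)"


section \<open>Goedel numbers of the syntax\<close>

primrec code_head :: "head \<Rightarrow> nat" where
  "code_head (Var x) = prod_encode (0, x)"
| "code_head (Con c) = prod_encode (1, c)"
| "code_head (Rec r) = prod_encode (2, r)"

primrec code_tm :: "tm \<Rightarrow> nat" and code_neu :: "neu \<Rightarrow> nat" and code_spine :: "spine \<Rightarrow> nat" where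
  "code_tm (Neu R) = prod_encode (0, code_neu R)"
| "code_tm (Lam M) = prod_encode (1, code_tm M)"
| "code_neu (App H S) = prod_encode (code_head H, code_spine S)"
| "code_spine SNil = prod_encode (0, 0)"
| "code_spine (SArg M S) = prod_encode (1, prod_encode (code_tm M, code_spine S))"
| "code_spine (SPre y S) = prod_encode (2, prod_encode (y, code_spine S))"

primrec code_aty :: "aty \<Rightarrow> nat" where
  "code_aty (Fam a S) = prod_encode (a, code_spine S)"

primrec code_ty :: "ty \<Rightarrow> nat" where
  "code_ty (Atom P) = prod_encode (0, code_aty P)"
| "code_ty (Pi A2 A1) = prod_encode (1, prod_encode (code_ty A2, code_ty A1))"
| "code_ty (PrePi A2 A1) = prod_encode (2, prod_encode (code_ty A2, code_ty A1))"

primrec code_kind :: "kind \<Rightarrow> nat" where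
  "code_kind Type = prod_encode (0, 0)"
| "code_kind Cotype = prod_encode (1, 0)"
| "code_kind (KPi A K) = prod_encode (2, prod_encode (code_ty A, code_kind K))"
| "code_kind (KPrePi A K) = prod_encode (3, prod_encode (code_ty A, code_kind K))"

primrec code_decl :: "decl \<Rightarrow> nat" where
  "code_decl (FamDecl a K) = prod_encode (0, prod_encode (a, code_kind K))"
| "code_decl (ConDecl c A) = prod_encode (1, prod_encode (c, code_ty A))"
| "code_decl (RecDecl r A M) = prod_encode (2, prod_encode (r, prod_encode (code_ty A, code_tm M)))"

primrec code_binding :: "binding \<Rightarrow> nat" where
  "code_binding (Ord A) = prod_encode (0, code_ty A)"
| "code_binding (Pre A) = prod_encode (1, code_ty A)"

lemma code_head_inject: "code_head H = code_head H' \<Longrightarrow> H = H'"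
  by (cases H; cases H') auto

lemma
  shows code_tm_inject: "code_tm M = code_tm M' \<Longrightarrow> M = M'"
    and code_neu_inject: "code_neu R = code_neu R' \<Longrightarrow> R = R'"
    and code_spine_inject: "code_spine S = code_spine S' \<Longrightarrow> S = S'"
proof (induction M and R and S arbitrary: M' and R' and S')
  case (Neu R) then show ?case by (cases M') auto
next
  case (Lam M) then show ?case by (cases M') auto
next
  case (App H S) then show ?case by (cases R') (auto dest: code_head_inject)
next
  case SNil then show ?case by (cases S') auto
next
  case (SArg M S) then show ?case by (cases S') auto
next
  case (SPre y S) then show ?case by (cases S') auto
qed

lemma code_aty_inject: "code_aty P = code_aty P' \<Longrightarrow> P = P'"
  by (cases P; cases P') (auto dest: code_spine_inject)

lemma code_ty_inject: "code_ty A = code_ty A' \<Longrightarrow> A = A'"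
proof (induction A arbitrary: A')
  case (Atom P) then show ?case by (cases A') (auto dest: code_aty_inject)
next
  case (Pi A2 A1) then show ?case by (cases A') auto
next
  case (PrePi A2 A1) then show ?case by (cases A') auto
qed

lemma code_kind_inject: "code_kind K = code_kind K' \<Longrightarrow> K = K'"
proof (induction K arbitrary: K')
  case Type then show ?case by (cases K') auto
next
  case Cotype then show ?case by (cases K') auto
next
  case (KPi A K) then show ?case by (cases K') (auto dest: code_ty_inject)
next
  case (KPrePi A K) then show ?case by (cases K') (auto dest: code_ty_inject)
qed

lemma code_decl_inject: "code_decl d = code_decl d' \<Longrightarrow> d = d'"
  by (cases d; cases d') (auto dest: code_kind_inject code_ty_inject code_tm_inject)

lemma code_binding_inject: "code_binding b = code_binding b' \<Longrightarrow> b = b'"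
  by (cases b; cases b') (auto dest: code_ty_inject)

instantiation tm :: godel
begin
definition "gcode_tm = code_tm"
instance by standard (simp add: gcode_tm_def code_tm_inject)
end

instantiation neu :: godel
begin
definition "gcode_neu = code_neu"
instance by standard (simp add: gcode_neu_def code_neu_inject)
end

instantiation spine :: godel
begin
definition "gcode_spine = code_spine"
instance by standard (simp add: gcode_spine_def code_spine_inject)
end

instantiation aty :: godel
begin
definition "gcode_aty = code_aty"
instance by standard (simp add: gcode_aty_def code_aty_inject)
end

instantiation ty :: godel
begin
definition "gcode_ty = code_ty"
instance by standard (simp add: gcode_ty_def code_ty_inject)
end

instantiation kind :: godel
begin
definition "gcode_kind = code_kind"
instance by standard (simp add: gcode_kind_def code_kind_inject)
end

instantiation decl :: godel
begin
definition "gcode_decl = code_decl"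
instance by standard (simp add: gcode_decl_def code_decl_inject)
end

instantiation binding :: godel
begin
definition "gcode_binding = code_binding"
instance by standard (simp add: gcode_binding_def code_binding_inject)
end


section \<open>Renaming and hereditary substitution\<close>

definition up :: "(nat \<Rightarrow> nat) \<Rightarrow> nat \<Rightarrow> nat" where
  "up \<rho> = case_nat 0 (\<lambda>i. Suc (\<rho> i))"

primrec ren_head :: "(nat \<Rightarrow> nat) \<Rightarrow> head \<Rightarrow> head" where
  "ren_head \<rho> (Var x) = Var (\<rho> x)"
| "ren_head \<rho> (Con c) = Con c"
| "ren_head \<rho> (Rec r) = Rec r"

primrec ren_tm :: "tm \<Rightarrow> (nat \<Rightarrow> nat) \<Rightarrow> tm"
  and ren_neu :: "neu \<Rightarrow> (nat \<Rightarrow> nat) \<Rightarrow> neu"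
  and ren_spine :: "spine \<Rightarrow> (nat \<Rightarrow> nat) \<Rightarrow> spine" where
  "ren_tm (Neu R) \<rho> = Neu (ren_neu R \<rho>)"
| "ren_tm (Lam M) \<rho> = Lam (ren_tm M (up \<rho>))"
| "ren_neu (App H S) \<rho> = App (ren_head \<rho> H) (ren_spine S \<rho>)"
| "ren_spine SNil \<rho> = SNil"
| "ren_spine (SArg M S) \<rho> = SArg (ren_tm M \<rho>) (ren_spine S \<rho>)"
| "ren_spine (SPre y S) \<rho> = SPre (\<rho> y) (ren_spine S \<rho>)"

primrec ren_aty :: "aty \<Rightarrow> (nat \<Rightarrow> nat) \<Rightarrow> aty" where
  "ren_aty (Fam a S) \<rho> = Fam a (ren_spine S \<rho>)"

primrec ren_ty :: "ty \<Rightarrow> (nat \<Rightarrow> nat) \<Rightarrow> ty" where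
  "ren_ty (Atom P) \<rho> = Atom (ren_aty P \<rho>)"
| "ren_ty (Pi A2 A1) \<rho> = Pi (ren_ty A2 \<rho>) (ren_ty A1 (up \<rho>))"
| "ren_ty (PrePi A2 A1) \<rho> = PrePi (ren_ty A2 \<rho>) (ren_ty A1 (up \<rho>))"

primrec ren_kind :: "kind \<Rightarrow> (nat \<Rightarrow> nat) \<Rightarrow> kind" where
  "ren_kind Type \<rho> = Type"
| "ren_kind Cotype \<rho> = Cotype"
| "ren_kind (KPi A K) \<rho> = KPi (ren_ty A \<rho>) (ren_kind K (up \<rho>))"
| "ren_kind (KPrePi A K) \<rho> = KPrePi (ren_ty A \<rho>) (ren_kind K (up \<rho>))"

text \<open>The renaming \<open>{y/x}\<close> for the outermost bound variable \<open>x\<close> (index 0) of a binder body.\<close>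

definition inst :: "nat \<Rightarrow> nat \<Rightarrow> nat" where
  "inst y = case_nat y (\<lambda>i. i)"

text \<open>\<open>hsub_tm \<tau> x N M\<close> is \<open>[N/x]\<^sup>\<tau> M\<close>, where the index \<open>x\<close> is removed from the context and
  \<open>N\<close> lives in the context without \<open>x\<close>; \<open>happ \<tau> S M\<close> is \<open>S \<rhd>\<^sup>\<tau> M\<close>.
  Both are partial functions.\<close>

definition drop_var :: "nat \<Rightarrow> nat \<Rightarrow> nat" where
  "drop_var x y = (if x < y then y - 1 else y)"

function (sequential)
      hsub_tm :: "stp \<Rightarrow> nat \<Rightarrow> tm \<Rightarrow> tm \<Rightarrow> tm option"
  and hsub_neu :: "stp \<Rightarrow> nat \<Rightarrow> tm \<Rightarrow> neu \<Rightarrow> neu option"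
  and hsub_spine :: "stp \<Rightarrow> nat \<Rightarrow> tm \<Rightarrow> spine \<Rightarrow> spine option"
  and happ :: "stp \<Rightarrow> spine \<Rightarrow> tm \<Rightarrow> neu option" where
  "hsub_tm \<tau> x N (Neu R) = do { R' \<leftarrow> hsub_neu \<tau> x N R; Some (Neu R') }"
| "hsub_tm \<tau> x N (Lam M) = do { M' \<leftarrow> hsub_tm \<tau> (Suc x) (ren_tm N Suc) M; Some (Lam M') }"
| "hsub_neu \<tau> x N (App H S) = do {
     S' \<leftarrow> hsub_spine \<tau> x N S;
     (if H = Var x then happ \<tau> S' N else Some (App (ren_head (drop_var x) H) S')) }"
| "hsub_spine \<tau> x N SNil = Some SNil"
| "hsub_spine \<tau> x N (SArg M S) = do {
     M' \<leftarrow> hsub_tm \<tau> x N M; S' \<leftarrow> hsub_spine \<tau> x N S; Some (SArg M' S') }"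
| "hsub_spine \<tau> x N (SPre y S) =
     (if y = x then None else do { S' \<leftarrow> hsub_spine \<tau> x N S; Some (SPre (drop_var x y) S') })"
| "happ Base SNil (Neu R) = Some R"
| "happ (Arr \<tau>2 \<tau>1) (SArg N S) (Lam M) = do { M' \<leftarrow> hsub_tm \<tau>2 0 N M; happ \<tau>1 S M' }"
| "happ (Arr Base \<tau>1) (SPre y S) (Lam M) = happ \<tau>1 S (ren_tm M (inst y))"
| "happ _ _ _ = None"
  by pat_completeness auto
termination
  by (relation "inv_image (less_than <*lex*> less_than <*lex*> less_than)
    (case_sum
      (case_sum (\<lambda>(\<tau>, x, N, M). (size \<tau>, Suc 0, size M)) (\<lambda>(\<tau>, x, N, R). (size \<tau>, Suc 0, size R)))
      (case_sum (\<lambda>(\<tau>, x, N, S). (size \<tau>, Suc 0, size S)) (\<lambda>(\<tau>, S, M). (size \<tau>, 0, 0))))") auto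

primrec hsub_aty :: "stp \<Rightarrow> nat \<Rightarrow> tm \<Rightarrow> aty \<Rightarrow> aty option" where
  "hsub_aty \<tau> x N (Fam a S) = do { S' \<leftarrow> hsub_spine \<tau> x N S; Some (Fam a S') }"

fun hsub_ty :: "stp \<Rightarrow> nat \<Rightarrow> tm \<Rightarrow> ty \<Rightarrow> ty option" where
  "hsub_ty \<tau> x N (Atom P) = do { P' \<leftarrow> hsub_aty \<tau> x N P; Some (Atom P') }"
| "hsub_ty \<tau> x N (Pi A2 A1) = do {
     A2' \<leftarrow> hsub_ty \<tau> x N A2; A1' \<leftarrow> hsub_ty \<tau> (Suc x) (ren_tm N Suc) A1; Some (Pi A2' A1') }"
| "hsub_ty \<tau> x N (PrePi A2 A1) = do {
     A2' \<leftarrow> hsub_ty \<tau> x N A2; A1' \<leftarrow> hsub_ty \<tau> (Suc x) (ren_tm N Suc) A1; Some (PrePi A2' A1') }"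

fun hsub_kind :: "stp \<Rightarrow> nat \<Rightarrow> tm \<Rightarrow> kind \<Rightarrow> kind option" where
  "hsub_kind \<tau> x N Type = Some Type"
| "hsub_kind \<tau> x N Cotype = Some Cotype"
| "hsub_kind \<tau> x N (KPi A K) = do {
     A' \<leftarrow> hsub_ty \<tau> x N A; K' \<leftarrow> hsub_kind \<tau> (Suc x) (ren_tm N Suc) K; Some (KPi A' K') }"
| "hsub_kind \<tau> x N (KPrePi A K) = do {
     A' \<leftarrow> hsub_ty \<tau> x N A; K' \<leftarrow> hsub_kind \<tau> (Suc x) (ren_tm N Suc) K; Some (KPrePi A' K') }"


section \<open>Equality\<close>

primrec prepattern_spine :: "spine \<Rightarrow> bool" where
  "prepattern_spine SNil = True"
| "prepattern_spine (SArg M S) = False"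
| "prepattern_spine (SPre y S) = prepattern_spine S"

primrec rec_headed :: "neu \<Rightarrow> bool" where
  "rec_headed (App H S) = (\<exists>r. H = Rec r)"

text \<open>An equation \<open>\<Theta> \<turnstile> R = R'\<close>.  The variable context \<open>\<Theta>\<close> is given by its length.\<close>

type_synonym eqn = "nat \<times> neu \<times> neu"

definition is_renaming_of :: "eqn \<Rightarrow> eqn \<Rightarrow> bool" where
  "is_renaming_of = (\<lambda>(n, R, R') (k, Q, Q').
     \<exists>\<rho>. inj_on \<rho> {..<k} \<and> \<rho> ` {..<k} \<subseteq> {..<n} \<and> R = ren_neu Q \<rho> \<and> R' = ren_neu Q' \<rho>)"

text \<open>The rules of the algorithm \<open>\<Delta>; \<Theta> \<turnstile>\<^sub>\<Sigma> M = M'\<close>, where \<open>\<Delta>\<close> lists the memoised equations.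
  An equation is memoised when one of its sides is unfolded; if both sides are headed by a
  recursion constant, the left one is unfolded first.\<close>

inductive tm_eq :: "sig \<Rightarrow> eqn list \<Rightarrow> nat \<Rightarrow> tm \<Rightarrow> tm \<Rightarrow> bool"
  and neu_eq :: "sig \<Rightarrow> eqn list \<Rightarrow> nat \<Rightarrow> neu \<Rightarrow> neu \<Rightarrow> bool"
  and spine_eq :: "sig \<Rightarrow> eqn list \<Rightarrow> nat \<Rightarrow> spine \<Rightarrow> spine \<Rightarrow> bool"
  for \<Sigma> :: sig where
  eq_lam: "tm_eq \<Sigma> \<Delta> (Suc n) M M' \<Longrightarrow> tm_eq \<Sigma> \<Delta> n (Lam M) (Lam M')"
| eq_neu: "neu_eq \<Sigma> \<Delta> n R R' \<Longrightarrow> tm_eq \<Sigma> \<Delta> n (Neu R) (Neu R')"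
| eq_var: "\<lbrakk>x < n; spine_eq \<Sigma> \<Delta> n S S'\<rbrakk> \<Longrightarrow> neu_eq \<Sigma> \<Delta> n (App (Var x) S) (App (Var x) S')"
| eq_con: "spine_eq \<Sigma> \<Delta> n S S' \<Longrightarrow> neu_eq \<Sigma> \<Delta> n (App (Con c) S) (App (Con c) S')"
| eq_memo: "\<lbrakk>e \<in> set \<Delta>; is_renaming_of (n, R, R') e\<rbrakk> \<Longrightarrow> neu_eq \<Sigma> \<Delta> n R R'"
| eq_unfold_left:
    "\<lbrakk>rec_def \<Sigma> r = Some (A, M); prepattern_spine S; happ (erase A) S M = Some R;
      neu_eq \<Sigma> ((n, App (Rec r) S, R') # \<Delta>) n R R'\<rbrakk>
     \<Longrightarrow> neu_eq \<Sigma> \<Delta> n (App (Rec r) S) R'"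
| eq_unfold_right:
    "\<lbrakk>\<not> rec_headed R; rec_def \<Sigma> r = Some (A, M); prepattern_spine S; happ (erase A) S M = Some R';
      neu_eq \<Sigma> ((n, R, App (Rec r) S) # \<Delta>) n R R'\<rbrakk>
     \<Longrightarrow> neu_eq \<Sigma> \<Delta> n R (App (Rec r) S)"
| eq_nil: "spine_eq \<Sigma> \<Delta> n SNil SNil"
| eq_arg: "\<lbrakk>tm_eq \<Sigma> \<Delta> n M M'; spine_eq \<Sigma> \<Delta> n S S'\<rbrakk> \<Longrightarrow> spine_eq \<Sigma> \<Delta> n (SArg M S) (SArg M' S')"
| eq_pre: "\<lbrakk>y < n; spine_eq \<Sigma> \<Delta> n S S'\<rbrakk> \<Longrightarrow> spine_eq \<Sigma> \<Delta> n (SPre y S) (SPre y S')"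

inductive aty_eq :: "sig \<Rightarrow> ctx \<Rightarrow> aty \<Rightarrow> aty \<Rightarrow> bool" for \<Sigma> :: sig where
  "spine_eq \<Sigma> [] (length \<Gamma>) S S' \<Longrightarrow> aty_eq \<Sigma> \<Gamma> (Fam a S) (Fam a S')"

inductive ty_eq :: "sig \<Rightarrow> ctx \<Rightarrow> ty \<Rightarrow> ty \<Rightarrow> bool" for \<Sigma> :: sig where
  "aty_eq \<Sigma> \<Gamma> P P' \<Longrightarrow> ty_eq \<Sigma> \<Gamma> (Atom P) (Atom P')"
| "\<lbrakk>ty_eq \<Sigma> \<Gamma> A2 A2'; ty_eq \<Sigma> (Ord A2 # \<Gamma>) A1 A1'\<rbrakk> \<Longrightarrow> ty_eq \<Sigma> \<Gamma> (Pi A2 A1) (Pi A2' A1')"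
| "\<lbrakk>ty_eq \<Sigma> \<Gamma> A2 A2'; ty_eq \<Sigma> (Pre A2 # \<Gamma>) A1 A1'\<rbrakk> \<Longrightarrow> ty_eq \<Sigma> \<Gamma> (PrePi A2 A1) (PrePi A2' A1')"


section \<open>Typing\<close>

primrec binding_ty :: "binding \<Rightarrow> ty" where
  "binding_ty (Ord A) = A"
| "binding_ty (Pre A) = A"

text \<open>The type of variable \<open>x\<close>, weakened to the whole context.\<close>

definition var_ty :: "ctx \<Rightarrow> nat \<Rightarrow> ty" where
  "var_ty \<Gamma> x = ren_ty (binding_ty (\<Gamma> ! x)) (\<lambda>i. i + Suc x)"

text \<open>The flag \<open>\<delta>\<close> marks the deferred checks of bodies of recursion constants: recursion constants
  are then looked up in the full signature \<open>\<Sigma>\<close> instead of \<open>\<Xi>\<close>.\<close>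

definition rec_scope :: "sig \<Rightarrow> sig \<Rightarrow> bool \<Rightarrow> sig" where
  "rec_scope \<Xi> \<Sigma> \<delta> = (if \<delta> then \<Sigma> else \<Xi>)"

inductive check_tm :: "sig \<Rightarrow> sig \<Rightarrow> bool \<Rightarrow> ctx \<Rightarrow> tm \<Rightarrow> ty \<Rightarrow> bool"
  and synth_neu :: "sig \<Rightarrow> sig \<Rightarrow> bool \<Rightarrow> ctx \<Rightarrow> neu \<Rightarrow> aty \<Rightarrow> bool"
  and ty_spine :: "sig \<Rightarrow> sig \<Rightarrow> bool \<Rightarrow> ctx \<Rightarrow> spine \<Rightarrow> ty \<Rightarrow> aty \<Rightarrow> bool"
  for \<Xi> \<Sigma> :: sig and \<delta> :: bool where
  "check_tm \<Xi> \<Sigma> \<delta> (Ord A2 # \<Gamma>) M A1 \<Longrightarrow> check_tm \<Xi> \<Sigma> \<delta> \<Gamma> (Lam M) (Pi A2 A1)"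
| "check_tm \<Xi> \<Sigma> \<delta> (Pre A2 # \<Gamma>) M A1 \<Longrightarrow> check_tm \<Xi> \<Sigma> \<delta> \<Gamma> (Lam M) (PrePi A2 A1)"
| "\<lbrakk>synth_neu \<Xi> \<Sigma> \<delta> \<Gamma> R P'; aty_eq \<Sigma> \<Gamma> P' P\<rbrakk> \<Longrightarrow> check_tm \<Xi> \<Sigma> \<delta> \<Gamma> (Neu R) (Atom P)"
| "\<lbrakk>x < length \<Gamma>; ty_spine \<Xi> \<Sigma> \<delta> \<Gamma> S (var_ty \<Gamma> x) P\<rbrakk> \<Longrightarrow> synth_neu \<Xi> \<Sigma> \<delta> \<Gamma> (App (Var x) S) P"
| "\<lbrakk>con_type \<Xi> c = Some A; ty_spine \<Xi> \<Sigma> \<delta> \<Gamma> S A P\<rbrakk> \<Longrightarrow> synth_neu \<Xi> \<Sigma> \<delta> \<Gamma> (App (Con c) S) P"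
| "\<lbrakk>rec_def (rec_scope \<Xi> \<Sigma> \<delta>) r = Some (A, M); ty_spine \<Xi> \<Sigma> \<delta> \<Gamma> S A P\<rbrakk>
    \<Longrightarrow> synth_neu \<Xi> \<Sigma> \<delta> \<Gamma> (App (Rec r) S) P"
| "ty_spine \<Xi> \<Sigma> \<delta> \<Gamma> SNil (Atom P) P"
| "\<lbrakk>check_tm \<Xi> \<Sigma> \<delta> \<Gamma> M A2; hsub_ty (erase A2) 0 M A1 = Some A1'; ty_spine \<Xi> \<Sigma> \<delta> \<Gamma> S A1' P\<rbrakk>
    \<Longrightarrow> ty_spine \<Xi> \<Sigma> \<delta> \<Gamma> (SArg M S) (Pi A2 A1) P"
| "\<lbrakk>y < length \<Gamma>; \<Gamma> ! y = Pre B; ty_eq \<Sigma> \<Gamma> (var_ty \<Gamma> y) A2;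
     ty_spine \<Xi> \<Sigma> \<delta> \<Gamma> S (ren_ty A1 (inst y)) P\<rbrakk>
    \<Longrightarrow> ty_spine \<Xi> \<Sigma> \<delta> \<Gamma> (SPre y S) (PrePi A2 A1) P"

inductive kind_spine :: "sig \<Rightarrow> sig \<Rightarrow> bool \<Rightarrow> ctx \<Rightarrow> spine \<Rightarrow> kind \<Rightarrow> kind \<Rightarrow> bool"
  for \<Xi> \<Sigma> :: sig and \<delta> :: bool where
  "kind_spine \<Xi> \<Sigma> \<delta> \<Gamma> SNil K K"
| "\<lbrakk>check_tm \<Xi> \<Sigma> \<delta> \<Gamma> M A2; hsub_kind (erase A2) 0 M K = Some K1; kind_spine \<Xi> \<Sigma> \<delta> \<Gamma> S K1 K'\<rbrakk>
    \<Longrightarrow> kind_spine \<Xi> \<Sigma> \<delta> \<Gamma> (SArg M S) (KPi A2 K) K'"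
| "\<lbrakk>y < length \<Gamma>; \<Gamma> ! y = Pre B; ty_eq \<Sigma> \<Gamma> (var_ty \<Gamma> y) A2;
     kind_spine \<Xi> \<Sigma> \<delta> \<Gamma> S (ren_kind K (inst y)) K'\<rbrakk>
    \<Longrightarrow> kind_spine \<Xi> \<Sigma> \<delta> \<Gamma> (SPre y S) (KPrePi A2 K) K'"

inductive synth_aty :: "sig \<Rightarrow> sig \<Rightarrow> bool \<Rightarrow> ctx \<Rightarrow> aty \<Rightarrow> kind \<Rightarrow> bool"
  for \<Xi> \<Sigma> :: sig and \<delta> :: bool where
  "\<lbrakk>fam_kind \<Xi> a = Some K; kind_spine \<Xi> \<Sigma> \<delta> \<Gamma> S K K'\<rbrakk> \<Longrightarrow> synth_aty \<Xi> \<Sigma> \<delta> \<Gamma> (Fam a S) K'"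

inductive check_ty :: "sig \<Rightarrow> sig \<Rightarrow> bool \<Rightarrow> ctx \<Rightarrow> ty \<Rightarrow> bool"
  for \<Xi> \<Sigma> :: sig and \<delta> :: bool where
  "\<lbrakk>synth_aty \<Xi> \<Sigma> \<delta> \<Gamma> P K; K = Type \<or> K = Cotype\<rbrakk> \<Longrightarrow> check_ty \<Xi> \<Sigma> \<delta> \<Gamma> (Atom P)"
| "\<lbrakk>check_ty \<Xi> \<Sigma> \<delta> \<Gamma> A2; check_ty \<Xi> \<Sigma> \<delta> (Ord A2 # \<Gamma>) A1\<rbrakk> \<Longrightarrow> check_ty \<Xi> \<Sigma> \<delta> \<Gamma> (Pi A2 A1)"
| "\<lbrakk>check_ty \<Xi> \<Sigma> \<delta> \<Gamma> A2; check_ty \<Xi> \<Sigma> \<delta> (Pre A2 # \<Gamma>) A1\<rbrakk> \<Longrightarrow> check_ty \<Xi> \<Sigma> \<delta> \<Gamma> (PrePi A2 A1)"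

inductive check_kind :: "sig \<Rightarrow> sig \<Rightarrow> bool \<Rightarrow> ctx \<Rightarrow> kind \<Rightarrow> bool"
  for \<Xi> \<Sigma> :: sig and \<delta> :: bool where
  "check_kind \<Xi> \<Sigma> \<delta> \<Gamma> Type"
| "check_kind \<Xi> \<Sigma> \<delta> \<Gamma> Cotype"
| "\<lbrakk>check_ty \<Xi> \<Sigma> \<delta> \<Gamma> A; check_kind \<Xi> \<Sigma> \<delta> (Ord A # \<Gamma>) K\<rbrakk> \<Longrightarrow> check_kind \<Xi> \<Sigma> \<delta> \<Gamma> (KPi A K)"
| "\<lbrakk>check_ty \<Xi> \<Sigma> \<delta> \<Gamma> A; check_kind \<Xi> \<Sigma> \<delta> (Pre A # \<Gamma>) K\<rbrakk> \<Longrightarrow> check_kind \<Xi> \<Sigma> \<delta> \<Gamma> (KPrePi A K)"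

inductive ctx_ok :: "sig \<Rightarrow> sig \<Rightarrow> bool \<Rightarrow> ctx \<Rightarrow> bool"
  for \<Xi> \<Sigma> :: sig and \<delta> :: bool where
  "ctx_ok \<Xi> \<Sigma> \<delta> []"
| "\<lbrakk>ctx_ok \<Xi> \<Sigma> \<delta> \<Gamma>; check_ty \<Xi> \<Sigma> \<delta> \<Gamma> A\<rbrakk> \<Longrightarrow> ctx_ok \<Xi> \<Sigma> \<delta> (Ord A # \<Gamma>)"
| "\<lbrakk>ctx_ok \<Xi> \<Sigma> \<delta> \<Gamma>; check_ty \<Xi> \<Sigma> \<delta> \<Gamma> A\<rbrakk> \<Longrightarrow> ctx_ok \<Xi> \<Sigma> \<delta> (Pre A # \<Gamma>)"


section \<open>Validity of recursive definitions\<close>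

primrec prepattern_ty :: "ty \<Rightarrow> bool" where
  "prepattern_ty (Atom P) = True"
| "prepattern_ty (Pi A2 A1) = False"
| "prepattern_ty (PrePi A2 A1) = prepattern_ty A1"

primrec contractive :: "tm \<Rightarrow> bool" where
  "contractive (Neu R) = (\<not> rec_headed R)"
| "contractive (Lam M) = contractive M"

primrec target :: "ty \<Rightarrow> nat" where
  "target (Atom P) = (case P of Fam a S \<Rightarrow> a)"
| "target (Pi A2 A1) = target A1"
| "target (PrePi A2 A1) = target A1"

primrec cotype_kind :: "kind \<Rightarrow> bool" where
  "cotype_kind Type = False"
| "cotype_kind Cotype = True"
| "cotype_kind (KPi A K) = cotype_kind K"
| "cotype_kind (KPrePi A K) = cotype_kind K"

primrec fam_prio :: "sig \<Rightarrow> nat \<Rightarrow> nat option" where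
  "fam_prio [] a = None"
| "fam_prio (d # \<Sigma>) a =
    (case d of FamDecl b K \<Rightarrow> if b = a then Some (length \<Sigma>) else fam_prio \<Sigma> a | _ \<Rightarrow> fam_prio \<Sigma> a)"

definition con_prio :: "sig \<Rightarrow> nat \<Rightarrow> nat option" where
  "con_prio \<Sigma> c = do { A \<leftarrow> con_type \<Sigma> c; fam_prio \<Sigma> (target A) }"

definition coinductive_con :: "sig \<Rightarrow> nat \<Rightarrow> bool" where
  "coinductive_con \<Sigma> c \<longleftrightarrow>
     (\<exists>A K. con_type \<Sigma> c = Some A \<and> fam_kind \<Sigma> (target A) = Some K \<and> cotype_kind K)"

text \<open>\<open>path_tm \<Sigma> r M cs\<close>: some path from the root of \<open>M\<close> to an occurrence of \<open>r\<close>, unfolding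
  recursion constants other than \<open>r\<close>, passes through exactly the constructors \<open>cs\<close>.\<close>

inductive path_tm :: "sig \<Rightarrow> nat \<Rightarrow> tm \<Rightarrow> nat list \<Rightarrow> bool"
  and path_neu :: "sig \<Rightarrow> nat \<Rightarrow> neu \<Rightarrow> nat list \<Rightarrow> bool"
  and path_spine :: "sig \<Rightarrow> nat \<Rightarrow> spine \<Rightarrow> nat list \<Rightarrow> bool"
  for \<Sigma> :: sig and r :: nat where
  "path_tm \<Sigma> r M cs \<Longrightarrow> path_tm \<Sigma> r (Lam M) cs"
| "path_neu \<Sigma> r R cs \<Longrightarrow> path_tm \<Sigma> r (Neu R) cs"
| "path_neu \<Sigma> r (App (Rec r) S) []"
| "\<lbrakk>r' \<noteq> r; rec_def \<Sigma> r' = Some (A, M); path_tm \<Sigma> r M cs\<rbrakk> \<Longrightarrow> path_neu \<Sigma> r (App (Rec r') S) cs"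
| "path_spine \<Sigma> r S cs \<Longrightarrow> path_neu \<Sigma> r (App (Con c) S) (c # cs)"
| "path_spine \<Sigma> r S cs \<Longrightarrow> path_neu \<Sigma> r (App (Var x) S) cs"
| "path_spine \<Sigma> r S cs \<Longrightarrow> path_neu \<Sigma> r (App (Rec r') S) cs"
| "path_tm \<Sigma> r M cs \<Longrightarrow> path_spine \<Sigma> r (SArg M S) cs"
| "path_spine \<Sigma> r S cs \<Longrightarrow> path_spine \<Sigma> r (SArg M S) cs"
| "path_spine \<Sigma> r S cs \<Longrightarrow> path_spine \<Sigma> r (SPre y S) cs"

definition guarded :: "sig \<Rightarrow> nat \<Rightarrow> tm \<Rightarrow> bool" where
  "guarded \<Sigma> r M \<longleftrightarrow>
     (\<forall>cs. path_tm \<Sigma> r M cs \<longrightarrow>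
        (\<exists>c\<in>set cs. coinductive_con \<Sigma> c \<and>
           (\<exists>p. con_prio \<Sigma> c = Some p \<and>
              (\<forall>c'\<in>set cs. \<exists>p'. con_prio \<Sigma> c' = Some p' \<and> p' \<le> p))))"


section \<open>Signatures\<close>

text \<open>\<open>sig_ok \<Sigma> \<Xi>\<close> is \<open>\<turnstile>\<^sub>\<Sigma> \<Xi> sig\<close>.  The first premise of each extension rule makes explicit the
  convention that declared names are distinct.\<close>

inductive sig_ok :: "sig \<Rightarrow> sig \<Rightarrow> bool" for \<Sigma> :: sig where
  "sig_ok \<Sigma> []"
| "\<lbrakk>fam_kind \<Xi> a = None; sig_ok \<Sigma> \<Xi>; check_kind \<Xi> \<Sigma> False [] K\<rbrakk> \<Longrightarrow> sig_ok \<Sigma> (FamDecl a K # \<Xi>)"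
| "\<lbrakk>con_type \<Xi> c = None; sig_ok \<Sigma> \<Xi>; check_ty \<Xi> \<Sigma> False [] A\<rbrakk> \<Longrightarrow> sig_ok \<Sigma> (ConDecl c A # \<Xi>)"
| "\<lbrakk>rec_def \<Xi> r = None; sig_ok \<Sigma> \<Xi>; check_ty \<Xi> \<Sigma> False [] A; prepattern_ty A; contractive M;
     guarded \<Sigma> r M; check_tm \<Xi> \<Sigma> True [] M A\<rbrakk> \<Longrightarrow> sig_ok \<Sigma> (RecDecl r A M # \<Xi>)"

definition sig_valid :: "sig \<Rightarrow> bool" where
  "sig_valid \<Sigma> \<longleftrightarrow> sig_ok \<Sigma> \<Sigma>"

end

theory Submission
  imports Defs
begin

text \<open>
  Call a function effective if its graph, read through Goedel numbers, is recursively enumerable;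
  a total effective function is computable by unbounded search.  Recursively enumerable relations
  are closed under reflexive-transitive closure, hence under finite derivations, so the least fixed
  point of a finitary operator with recursively enumerable graph is effective.  A recursive
  algorithm on syntax is therefore computable as soon as every solution of its recursion equation
  is total and has the intended values.

  Totality is a structural induction except in two places.  For equality, unfolding a recursion
  constant at a prepattern spine only renames its body, so all neutral terms met are renamings of
  finitely many skeletons; an equation is determined up to renaming by its skeletons, the
  coincidences among its free variable occurrences, and which of them are in scope, so that only
  finitely many equations can be memoised before one of them is a renaming of an earlier one.  For
  guardedness, only the set of constructors on a path matters, and the search space of subterms
  paired with such sets is finite.
\<close>


section \<open>Recursive functions on natural numbers\<close>

definition recursive :: "nat \<Rightarrow> (nat list \<Rightarrow> nat) \<Rightarrow> bool" where
  "recursive k f \<longleftrightarrow> (\<exists>r. \<forall>xs. length xs = k \<longrightarrow> rec_eval r xs (f xs))"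

abbreviation unary_recursive :: "(nat \<Rightarrow> nat) \<Rightarrow> bool" where
  "unary_recursive f \<equiv> recursive 1 (\<lambda>xs. f (xs ! 0))"

abbreviation binary_recursive :: "(nat \<Rightarrow> nat \<Rightarrow> nat) \<Rightarrow> bool" where
  "binary_recursive f \<equiv> recursive 2 (\<lambda>xs. f (xs ! 0) (xs ! 1))"

lemma unary_recursive_iff: "unary_recursive f \<longleftrightarrow> (\<exists>r. \<forall>x. rec_eval r [x] (f x))"
proof -
  have "(\<forall>xs. length xs = 1 \<longrightarrow> P xs) \<longleftrightarrow> (\<forall>x. P [x])" for P :: "nat list \<Rightarrow> bool"
    by (auto simp: length_Suc_conv)
  then show ?thesis by (simp add: recursive_def)
qed

lemma binary_recursive_iff: "binary_recursive f \<longleftrightarrow> (\<exists>r. \<forall>x y. rec_eval r [x, y] (f x y))"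
proof -
  have "(\<forall>xs. length xs = 2 \<longrightarrow> P xs) \<longleftrightarrow> (\<forall>x y. P [x, y])" for P :: "nat list \<Rightarrow> bool"
    by (auto simp: numeral_2_eq_2 length_Suc_conv)
  then show ?thesis by (simp add: recursive_def)
qed

named_theorems recursive_intros

lemma recursive_nth [recursive_intros]: "i < k \<Longrightarrow> recursive k (\<lambda>xs. xs ! i)"
  unfolding recursive_def by (rule exI[of _ "RProj i"]) (auto intro: rec_eval.intros)

lemma recursive_compose:
  assumes "unary_recursive F" "recursive k a"
  shows "recursive k (\<lambda>xs. F (a xs))"
proof -
  from assms(1) obtain f where f: "\<And>x. rec_eval f [x] (F x)" unfolding unary_recursive_iff by blast
  from assms(2) obtain r where r: "\<And>xs. length xs = k \<Longrightarrow> rec_eval r xs (a xs)"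
    unfolding recursive_def by blast
  have "rec_eval (RComp f [r]) xs (F (a xs))" if "length xs = k" for xs
    by (rule rec_eval.intros(4)[of _ _ "[a xs]"]) (simp_all add: f r that)
  then show ?thesis unfolding recursive_def by blast
qed

lemma recursive_compose2:
  assumes "binary_recursive F" "recursive k a" "recursive k b"
  shows "recursive k (\<lambda>xs. F (a xs) (b xs))"
proof -
  from assms(1) obtain f where f: "\<And>x y. rec_eval f [x, y] (F x y)"
    unfolding binary_recursive_iff by blast
  from assms(2) obtain r where r: "\<And>xs. length xs = k \<Longrightarrow> rec_eval r xs (a xs)"
    unfolding recursive_def by blast
  from assms(3) obtain s where s: "\<And>xs. length xs = k \<Longrightarrow> rec_eval s xs (b xs)"
    unfolding recursive_def by blast
  have "rec_eval (RComp f [r, s]) xs (F (a xs) (b xs))" if "length xs = k" for xs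
    by (rule rec_eval.intros(4)[of _ _ "[a xs, b xs]"]) (simp_all add: f r s that)
  then show ?thesis unfolding recursive_def by blast
qed

lemma recursive_prim_rec:
  assumes g: "unary_recursive g" and s: "recursive 3 (\<lambda>ys. s (ys ! 0) (ys ! 1) (ys ! 2))"
    and f_0: "\<And>x. f 0 x = g x" and f_Suc: "\<And>n x. f (Suc n) x = s n (f n x) x"
  shows "binary_recursive f"
proof -
  from g obtain rg where rg: "\<And>x. rec_eval rg [x] (g x)" unfolding unary_recursive_iff by blast
  from s obtain rs where rs: "\<And>ys. length ys = 3 \<Longrightarrow> rec_eval rs ys (s (ys ! 0) (ys ! 1) (ys ! 2))"
    unfolding recursive_def by blast
  have "rec_eval (RPrim rg rs) [n, x] (f n x)" for n x
  proof (induction n)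
    case 0
    show ?case unfolding f_0 by (intro rec_eval.intros rg)
  next
    case (Suc n)
    from rec_eval.intros(6)[OF Suc, of "s n (f n x) x"] rs[of "[n, f n x, x]"]
    show ?case by (simp add: f_Suc)
  qed
  then show ?thesis unfolding binary_recursive_iff by blast
qed

lemma rec_eval_RMu_Least:
  assumes r: "\<And>m. rec_eval r [m, x] (f m)" and ex: "\<exists>m. f m = 0"
  shows "rec_eval (RMu r) [x] (LEAST m. f m = 0)"
proof (rule rec_eval.intros(7))
  show "rec_eval r [LEAST m. f m = 0, x] 0"
    using r[of "LEAST m. f m = 0"] LeastI_ex[OF ex] by simp
  show "\<forall>m<LEAST m. f m = 0. \<exists>y. rec_eval r [m, x] (Suc y)"
  proof (intro allI impI)
    fix m assume "m < (LEAST m. f m = 0)"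
    then have "f m \<noteq> 0" by (rule not_less_Least)
    then show "\<exists>y. rec_eval r [m, x] (Suc y)" using r[of m] by (cases "f m") auto
  qed
qed

lemma recursive_Least:
  assumes f: "binary_recursive f" and ex: "\<And>x. \<exists>m. f m x = 0"
  shows "unary_recursive (\<lambda>x. LEAST m. f m x = 0)"
proof -
  from f obtain r where "\<And>m x. rec_eval r [m, x] (f m x)" unfolding binary_recursive_iff by blast
  from rec_eval_RMu_Least[OF this ex]
  have "\<exists>r. \<forall>x. rec_eval r [x] (LEAST m. f m x = 0)" by blast
  then show ?thesis by (simp only: unary_recursive_iff[where f = "\<lambda>x. LEAST m. f m x = 0"])
qed

lemma recursive_Suc [recursive_intros]: "recursive k a \<Longrightarrow> recursive k (\<lambda>xs. Suc (a xs))"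
proof (rule recursive_compose[where F = Suc])
  show "unary_recursive Suc" unfolding unary_recursive_iff by (blast intro: rec_eval.intros)
qed

lemma recursive_const [recursive_intros]: "recursive k (\<lambda>xs. c)"
proof (induction c)
  case 0
  show ?case unfolding recursive_def by (blast intro: rec_eval.intros)
qed (rule recursive_Suc)

lemma recursive_add [recursive_intros]:
  assumes "recursive k a" "recursive k b"
  shows "recursive k (\<lambda>xs. a xs + b xs)"
proof (rule recursive_compose2[where F = "(+)", OF _ assms])
  show "binary_recursive (+)"
    by (rule recursive_prim_rec[of "\<lambda>x. x" "\<lambda>n y x. Suc y"]) (simp_all add: recursive_intros)
qed

lemma recursive_pred: "recursive k a \<Longrightarrow> recursive k (\<lambda>xs. a xs - 1)"
proof (rule recursive_compose[where F = "\<lambda>x. x - 1"])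
  have "binary_recursive (\<lambda>n x. n - 1)"
    by (rule recursive_prim_rec[of "\<lambda>x. 0" "\<lambda>n y x. n"]) (simp_all add: recursive_intros)
  then show "unary_recursive (\<lambda>x. x - 1)"
    by (rule recursive_compose2[where b = "\<lambda>xs. xs ! 0"]) (simp_all add: recursive_intros)
qed

lemma recursive_diff [recursive_intros]:
  assumes "recursive k a" "recursive k b"
  shows "recursive k (\<lambda>xs. a xs - b xs)"
proof (rule recursive_compose2[where F = "\<lambda>n x. x - n", OF _ assms(2,1)])
  show "binary_recursive (\<lambda>n x. x - n)"
    by (rule recursive_prim_rec[of "\<lambda>x. x" "\<lambda>n y x. y - 1"])
      (simp_all add: recursive_intros recursive_pred[unfolded One_nat_def])
qed

lemma recursive_triangle [recursive_intros]: "recursive k a \<Longrightarrow> recursive k (\<lambda>xs. triangle (a xs))"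
proof (rule recursive_compose[where F = triangle])
  have "binary_recursive (\<lambda>n x. triangle n)"
    by (rule recursive_prim_rec[of "\<lambda>x. 0" "\<lambda>n y x. y + Suc n"])
      (simp_all add: recursive_intros)
  then show "unary_recursive triangle"
    by (rule recursive_compose2[where b = "\<lambda>xs. xs ! 0"]) (simp_all add: recursive_intros)
qed

lemma recursive_prod_encode [recursive_intros]:
  "recursive k a \<Longrightarrow> recursive k b \<Longrightarrow> recursive k (\<lambda>xs. prod_encode (a xs, b xs))"
  unfolding prod_encode_def by (simp add: recursive_intros)


subsection \<open>Decoding of pairs\<close>

abbreviation pfst :: "nat \<Rightarrow> nat" where "pfst n \<equiv> fst (prod_decode n)"
abbreviation psnd :: "nat \<Rightarrow> nat" where "psnd n \<equiv> snd (prod_decode n)"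

lemma ex_prod_encode: "(\<exists>n. P n) \<longleftrightarrow> (\<exists>a b. P (prod_encode (a, b)))"
  by (metis prod_decode_inverse surj_pair)

text \<open>The sum of the two components, found as the index of the diagonal that contains the pair.\<close>

definition pair_sum :: "nat \<Rightarrow> nat" where
  "pair_sum n = (LEAST s. Suc n - triangle (Suc s) = 0)"

lemma triangle_mono: "m \<le> n \<Longrightarrow> triangle m \<le> triangle n"
  unfolding triangle_def by (intro div_le_mono mult_le_mono) simp_all

lemma pair_sum_prod_encode: "pair_sum (prod_encode (a, b)) = a + b"
  unfolding pair_sum_def
proof (rule Least_equality)
  show "Suc (prod_encode (a, b)) - triangle (Suc (a + b)) = 0"
    by (simp add: prod_encode_def)
  fix s assume s: "Suc (prod_encode (a, b)) - triangle (Suc s) = 0"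
  show "a + b \<le> s"
  proof (rule ccontr)
    assume "\<not> a + b \<le> s"
    then have "triangle (Suc s) \<le> triangle (a + b)" by (intro triangle_mono) simp
    with s show False by (simp add: prod_encode_def)
  qed
qed

lemma recursive_pair_sum: "recursive k a \<Longrightarrow> recursive k (\<lambda>xs. pair_sum (a xs))"
proof (rule recursive_compose[where F = pair_sum], unfold pair_sum_def, rule recursive_Least)
  show "binary_recursive (\<lambda>s n. Suc n - triangle (Suc s))"
    by (intro recursive_intros) simp_all
  fix n
  have "Suc n \<le> triangle (Suc n)" by (induction n) simp_all
  then show "\<exists>s. Suc n - triangle (Suc s) = 0" by (metis diff_is_0_eq)
qed

lemma pfst_eq: "pfst n = n - triangle (pair_sum n)"
  and psnd_eq: "psnd n = pair_sum n - pfst n"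
proof -
  obtain a b where n: "n = prod_encode (a, b)" by (metis prod_decode_inverse surj_pair)
  have "prod_encode (a, b) - triangle (a + b) = a" by (simp add: prod_encode_def)
  then show "pfst n = n - triangle (pair_sum n)" "psnd n = pair_sum n - pfst n"
    by (simp_all add: n pair_sum_prod_encode)
qed

lemma recursive_pfst [recursive_intros]: "recursive k a \<Longrightarrow> recursive k (\<lambda>xs. pfst (a xs))"
  unfolding pfst_eq by (intro recursive_intros recursive_pair_sum)

lemma recursive_psnd [recursive_intros]: "recursive k a \<Longrightarrow> recursive k (\<lambda>xs. psnd (a xs))"
  unfolding psnd_eq by (intro recursive_intros recursive_pair_sum)

lemma recursive_if_0 [recursive_intros]:
  assumes "recursive k c" "recursive k a" "recursive k b"
  shows "recursive k (\<lambda>xs. if c xs = 0 then a xs else b xs)"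
proof -
  have "binary_recursive (\<lambda>n x. if n = 0 then pfst x else psnd x)"
    by (rule recursive_prim_rec[of pfst "\<lambda>n y x. psnd x"]) (simp_all add: recursive_intros)
  from recursive_compose2[OF this assms(1) recursive_prod_encode[OF assms(2,3)]]
  show ?thesis by (simp cong: if_cong)
qed

lemma recursive_funpow:
  assumes "unary_recursive s" "recursive k a" "recursive k b"
  shows "recursive k (\<lambda>xs. (s ^^ a xs) (b xs))"
proof (rule recursive_compose2[where F = "\<lambda>n x. (s ^^ n) x", OF _ assms(2,3)])
  show "binary_recursive (\<lambda>n x. (s ^^ n) x)"
    by (rule recursive_prim_rec[of "\<lambda>x. x" "\<lambda>n y x. s y"])
      (simp_all add: recursive_intros recursive_compose[OF assms(1)])
qed


section \<open>Semidecidable predicates on coded types\<close>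

declare gcode_nat_def [simp]

lemma gcode_Pair [simp]: "gcode (x, y) = prod_encode (gcode x, gcode y)"
  by (simp add: gcode_prod_def)

definition semidecidable :: "('a::godel \<Rightarrow> bool) \<Rightarrow> bool" where
  "semidecidable P \<longleftrightarrow>
    (\<exists>T. unary_recursive T \<and> (\<forall>x. P x \<longleftrightarrow> (\<exists>w. T (prod_encode (w, gcode x)) = 0)))"

definition tracked :: "('a::godel \<Rightarrow> 'b::godel) \<Rightarrow> bool" where
  "tracked f \<longleftrightarrow> (\<exists>F. unary_recursive F \<and> (\<forall>x. gcode (f x) = F (gcode x)))"

named_theorems effective_intros

lemma semidecidableI:
  assumes "unary_recursive T" and "\<And>x. P x \<longleftrightarrow> (\<exists>w. T (prod_encode (w, gcode x)) = 0)"
  shows "semidecidable P"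
  using assms unfolding semidecidable_def by blast

lemma semidecidable_ex_eqI:
  assumes "unary_recursive F" "unary_recursive G"
    and "\<And>x. P x \<longleftrightarrow> (\<exists>w. F (prod_encode (w, gcode x)) = G (prod_encode (w, gcode x)))"
  shows "semidecidable P"
proof (rule semidecidableI)
  show "unary_recursive (\<lambda>z. (F z - G z) + (G z - F z))"
    by (intro recursive_intros assms(1,2))
  have "F z = G z \<longleftrightarrow> (F z - G z) + (G z - F z) = 0" for z by auto
  then show "P x \<longleftrightarrow> (\<exists>w. (F (prod_encode (w, gcode x)) - G (prod_encode (w, gcode x))) +
      (G (prod_encode (w, gcode x)) - F (prod_encode (w, gcode x))) = 0)" for x
    unfolding assms(3) by (simp only:)
qed

lemma semidecidable_tracked:
  assumes "semidecidable P" "tracked f"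
  shows "semidecidable (\<lambda>x. P (f x))"
proof -
  from assms(1) obtain T where
    T: "unary_recursive T" "\<And>x. P x \<longleftrightarrow> (\<exists>w. T (prod_encode (w, gcode x)) = 0)"
    unfolding semidecidable_def by blast
  from assms(2) obtain F where F: "unary_recursive F" "\<And>x. gcode (f x) = F (gcode x)"
    unfolding tracked_def by blast
  show ?thesis
  proof (rule semidecidableI)
    show "unary_recursive (\<lambda>z. T (prod_encode (pfst z, F (psnd z))))"
      by (intro recursive_compose[OF T(1)] recursive_compose[OF F(1)] recursive_intros) simp_all
  qed (simp add: T(2) F(2))
qed

lemma semidecidable_conj [effective_intros]:
  assumes "semidecidable P" "semidecidable Q"
  shows "semidecidable (\<lambda>x. P x \<and> Q x)"
proof -
  from assms obtain T U where
    T: "unary_recursive T" "\<And>x. P x \<longleftrightarrow> (\<exists>w. T (prod_encode (w, gcode x)) = 0)" and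
    U: "unary_recursive U" "\<And>x. Q x \<longleftrightarrow> (\<exists>w. U (prod_encode (w, gcode x)) = 0)"
    unfolding semidecidable_def by blast
  show ?thesis
  proof (rule semidecidableI)
    show "unary_recursive (\<lambda>z. T (prod_encode (pfst (pfst z), psnd z)) +
        U (prod_encode (psnd (pfst z), psnd z)))"
      by (intro recursive_compose[OF T(1)] recursive_compose[OF U(1)] recursive_intros) simp_all
  qed (subst ex_prod_encode, simp add: T(2) U(2))
qed

lemma semidecidable_disj [effective_intros]:
  assumes "semidecidable P" "semidecidable Q"
  shows "semidecidable (\<lambda>x. P x \<or> Q x)"
proof -
  from assms obtain T U where
    T: "unary_recursive T" "\<And>x. P x \<longleftrightarrow> (\<exists>w. T (prod_encode (w, gcode x)) = 0)" and
    U: "unary_recursive U" "\<And>x. Q x \<longleftrightarrow> (\<exists>w. U (prod_encode (w, gcode x)) = 0)"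
    unfolding semidecidable_def by blast
  show ?thesis
  proof (rule semidecidableI)
    show "unary_recursive (\<lambda>z. if T z = 0 then 0 else U z)"
      by (intro recursive_compose[OF T(1)] recursive_compose[OF U(1)] recursive_intros) simp_all
    have "(if T z = 0 then 0 else U z) = 0 \<longleftrightarrow> T z = 0 \<or> U z = 0" for z by simp
    then show "P x \<or> Q x \<longleftrightarrow> (\<exists>w. (if T (prod_encode (w, gcode x)) = 0 then 0
        else U (prod_encode (w, gcode x))) = 0)" for x
      by (simp only: T(2) U(2) ex_disj_distrib)
  qed
qed

lemma semidecidable_eq_tracked:
  assumes "tracked f" "tracked g"
  shows "semidecidable (\<lambda>x. f x = g x)"
proof -
  from assms obtain F G where F: "unary_recursive F" "\<And>x. gcode (f x) = F (gcode x)"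
    and G: "unary_recursive G" "\<And>x. gcode (g x) = G (gcode x)"
    unfolding tracked_def by blast
  show ?thesis
  proof (rule semidecidable_ex_eqI)
    show "unary_recursive (\<lambda>z. F (psnd z))" "unary_recursive (\<lambda>z. G (psnd z))"
      by (intro recursive_compose[OF F(1)] recursive_compose[OF G(1)] recursive_intros, simp)+
    show "f x = g x \<longleftrightarrow> (\<exists>w. F (psnd (prod_encode (w :: nat, gcode x))) =
        G (psnd (prod_encode (w, gcode x))))" for x
      using gcode_eq_iff[of "f x" "g x"] by (simp add: F(2) G(2))
  qed
qed

lemma semidecidable_less_nat: "semidecidable (\<lambda>p. fst p < (snd p :: nat))"
proof (rule semidecidableI)
  show "unary_recursive (\<lambda>z. Suc (pfst (psnd z)) - psnd (psnd z))"
    by (intro recursive_intros) simp_all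
qed auto

lemma tracked_id: "tracked (\<lambda>x. x)"
  unfolding tracked_def by (rule exI[of _ "\<lambda>n. n"]) (simp add: recursive_intros)

lemma tracked_const: "tracked (\<lambda>x. c)"
  unfolding tracked_def by (rule exI[of _ "\<lambda>n. gcode c"]) (simp add: recursive_intros)

lemma tracked_compose:
  assumes "unary_recursive F" "\<And>x. gcode (C x) = F (gcode x)" "tracked f"
  shows "tracked (\<lambda>x. C (f x))"
proof -
  from assms(3) obtain G where "unary_recursive G" "\<And>x. gcode (f x) = G (gcode x)"
    unfolding tracked_def by blast
  then show ?thesis unfolding tracked_def
    by (intro exI[of _ "\<lambda>n. F (G n)"]) (simp add: assms(2) recursive_compose[OF assms(1)])
qed

lemma tracked_fst: "tracked f \<Longrightarrow> tracked (\<lambda>x. fst (f x))"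
  by (rule tracked_compose[where F = pfst]) (auto simp: gcode_prod_def intro!: recursive_intros)

lemma tracked_snd: "tracked f \<Longrightarrow> tracked (\<lambda>x. snd (f x))"
  by (rule tracked_compose[where F = psnd]) (auto simp: gcode_prod_def intro!: recursive_intros)

lemma tracked_gcode: "tracked f \<Longrightarrow> tracked (\<lambda>x. gcode (f x))"
  by (rule tracked_compose[where F = "\<lambda>n. n"]) (auto intro!: recursive_intros)

lemma tracked_Pair:
  assumes "tracked f" "tracked g"
  shows "tracked (\<lambda>x. (f x, g x))"
proof -
  from assms obtain F G where "unary_recursive F" "\<And>x. gcode (f x) = F (gcode x)"
    "unary_recursive G" "\<And>x. gcode (g x) = G (gcode x)"
    unfolding tracked_def by blast
  then show ?thesis unfolding tracked_def
    by (intro exI[of _ "\<lambda>n. prod_encode (F n, G n)"]) (simp add: recursive_intros)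
qed

lemmas tracked_intros = tracked_id tracked_const tracked_fst tracked_snd tracked_gcode tracked_Pair

lemma semidecidable_const [effective_intros]: "semidecidable (\<lambda>x. c)"
proof (cases c)
  case True
  then show ?thesis using semidecidable_eq_tracked[OF tracked_id tracked_id] by simp
next
  case False
  have "tracked (\<lambda>x. (0, 0 :: nat))" by (intro tracked_intros)
  from False semidecidable_tracked[OF semidecidable_less_nat this] show ?thesis by simp
qed


subsection \<open>Types with a recursively enumerable set of codes\<close>

class godel_enum = godel +
  assumes semidecidable_range_gcode: "semidecidable (\<lambda>n. n \<in> range gcode)"

instance nat :: godel_enum
  by standard (simp add: semidecidable_const)

lemma semidecidable_ex [effective_intros]:
  fixes Q :: "'a::godel \<Rightarrow> 'b::godel_enum \<Rightarrow> bool"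
  assumes "semidecidable (\<lambda>p. Q (fst p) (snd p))"
  shows "semidecidable (\<lambda>x. \<exists>y. Q x y)"
proof -
  from assms obtain T where
    T: "unary_recursive T" "\<And>p. Q (fst p) (snd p) \<longleftrightarrow> (\<exists>w. T (prod_encode (w, gcode p)) = 0)"
    unfolding semidecidable_def by blast
  from semidecidable_range_gcode[where 'a = 'b] obtain U where
    U: "unary_recursive U" "\<And>n. n \<in> range (gcode :: 'b \<Rightarrow> nat) \<longleftrightarrow> (\<exists>w. U (prod_encode (w, n)) = 0)"
    unfolding semidecidable_def by auto
  show ?thesis
  proof (rule semidecidableI)
    show "unary_recursive (\<lambda>z.
        T (prod_encode (pfst (pfst z), prod_encode (psnd z, pfst (psnd (pfst z))))) +
        U (prod_encode (psnd (psnd (pfst z)), pfst (psnd (pfst z)))))"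
      by (intro recursive_compose[OF T(1)] recursive_compose[OF U(1)] recursive_intros) simp_all
    have "(\<exists>y. Q x y) \<longleftrightarrow> (\<exists>n \<in> range (gcode :: 'b \<Rightarrow> nat).
        \<exists>w. T (prod_encode (w, prod_encode (gcode x, n))) = 0)" for x
      using T(2)[of "(x, _)"] by auto
    then have "(\<exists>y. Q x y) \<longleftrightarrow> (\<exists>w n v. T (prod_encode (w, prod_encode (gcode x, n))) = 0 \<and>
        U (prod_encode (v, n)) = 0)" for x
      unfolding Bex_def U(2) by blast
    then show "(\<exists>y. Q x y) \<longleftrightarrow> (\<exists>w. T (prod_encode (pfst (pfst (prod_encode (w, gcode x))),
          prod_encode (psnd (prod_encode (w, gcode x)),
            pfst (psnd (pfst (prod_encode (w, gcode x))))))) +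
        U (prod_encode (psnd (psnd (pfst (prod_encode (w, gcode x)))),
          pfst (psnd (pfst (prod_encode (w, gcode x)))))) = 0)" for x
      by (subst ex_prod_encode, subst (2) ex_prod_encode) simp
  qed
qed

lemma semidecidable_choice:
  fixes R :: "'a::godel \<Rightarrow> nat \<Rightarrow> bool"
  assumes R: "semidecidable (\<lambda>p. R (fst p) (snd p))" and ex: "\<And>x. \<exists>n. R x n"
  shows "\<exists>r. \<forall>x. \<exists>n. rec_eval r [gcode x] n \<and> R x n"
proof -
  from R obtain T where
    T: "unary_recursive T" "\<And>p. R (fst p) (snd p) \<longleftrightarrow> (\<exists>w. T (prod_encode (w, gcode p)) = 0)"
    unfolding semidecidable_def by blast
  define t where "t m n = T (prod_encode (pfst m, prod_encode (n, psnd m)))" for m n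
  have "binary_recursive t"
    unfolding t_def by (intro recursive_compose[OF T(1)] recursive_intros) simp_all
  then obtain r where r: "\<And>m n. rec_eval r [m, n] (t m n)" unfolding binary_recursive_iff by blast
  have "unary_recursive psnd" by (intro recursive_intros) simp
  then obtain s where s: "\<And>m. rec_eval s [m] (psnd m)"
    unfolding unary_recursive_iff[of psnd] by blast
  have R_iff: "R x n \<longleftrightarrow> (\<exists>w. t (prod_encode (w, n)) (gcode x) = 0)" for x n
    using T(2)[of "(x, n)"] by (simp add: t_def)
  have "\<exists>n. rec_eval (RComp s [RMu r]) [gcode x] n \<and> R x n" for x
  proof -
    from ex have t_0: "\<exists>m. t m (gcode x) = 0" unfolding R_iff by blast
    define m where "m = (LEAST m. t m (gcode x) = 0)"
    have "rec_eval (RMu r) [gcode x] m"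
      unfolding m_def using r t_0 by (rule rec_eval_RMu_Least)
    then have "rec_eval (RComp s [RMu r]) [gcode x] (psnd m)"
      by (intro rec_eval.intros(4)[of _ _ "[m]"]) (simp_all add: s)
    moreover have "t m (gcode x) = 0" unfolding m_def using t_0 by (rule LeastI_ex)
    then have "R x (psnd m)" unfolding R_iff by (intro exI[of _ "pfst m"]) simp
    ultimately show ?thesis by blast
  qed
  then show ?thesis by blast
qed


subsection \<open>Reflexive-transitive closure\<close>

text \<open>A path \<open>x, z\<^sub>1, z\<^sub>2, \<dots>\<close> is certified by the list of the \<open>z\<^sub>i\<close>, each with a witness for the
  step that leads to it.  One step consumes one entry of the list, and moves only if the
  witness is correct.\<close>

definition certified_step :: "(nat \<Rightarrow> nat) \<Rightarrow> nat \<Rightarrow> nat" where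
  "certified_step T q = (if pfst q = 0 then q else
    let wz = pfst (pfst q - 1); x = psnd q in
    prod_encode (psnd (pfst q - 1),
      if T (prod_encode (pfst wz, prod_encode (x, psnd wz))) = 0 then psnd wz else x))"

lemma recursive_certified_step:
  assumes "unary_recursive T"
  shows "unary_recursive (certified_step T)"
  unfolding certified_step_def Let_def
  by (intro recursive_compose[OF assms] recursive_intros) simp_all

context
  fixes R :: "nat \<Rightarrow> nat \<Rightarrow> bool" and T :: "nat \<Rightarrow> nat"
  assumes T: "\<And>x z. R x z \<longleftrightarrow> (\<exists>w. T (prod_encode (w, prod_encode (x, z))) = 0)"
begin

lemma certified_step_sound: "R\<^sup>*\<^sup>* (psnd q) (psnd ((certified_step T ^^ k) q))"
proof (induction k)
  case (Suc k)
  have "R\<^sup>*\<^sup>* (psnd q') (psnd (certified_step T q'))" for q'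
    unfolding certified_step_def Let_def by (auto simp: T intro!: r_into_rtranclp)
  from rtranclp_trans[OF Suc this] show ?case by (simp only: funpow.simps comp_apply)
qed simp

lemma certified_step_complete:
  assumes "R\<^sup>*\<^sup>* x y"
  shows "\<exists>k l. psnd ((certified_step T ^^ k) (prod_encode (l, x))) = y"
  using assms
proof (induction rule: converse_rtranclp_induct)
  case base
  show ?case by (rule exI[of _ 0]) simp
next
  case (step x z)
  from step(1) obtain w where "T (prod_encode (w, prod_encode (x, z))) = 0" unfolding T by blast
  then have first_step:
    "certified_step T (prod_encode (Suc (prod_encode (prod_encode (w, z), l)), x)) = prod_encode (l, z)"
    for l
    by (simp add: certified_step_def)
  from step(3) obtain k l where "psnd ((certified_step T ^^ k) (prod_encode (l, z))) = y" by blast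
  then have "psnd ((certified_step T ^^ Suc k)
      (prod_encode (Suc (prod_encode (prod_encode (w, z), l)), x))) = y"
    by (simp add: funpow_swap1 first_step)
  then show ?case by blast
qed

lemma rtranclp_iff_certified:
  "R\<^sup>*\<^sup>* x y \<longleftrightarrow> (\<exists>w. psnd ((certified_step T ^^ pfst w) (prod_encode (psnd w, x))) = y)"
proof
  assume "R\<^sup>*\<^sup>* x y"
  then obtain k l where "psnd ((certified_step T ^^ k) (prod_encode (l, x))) = y"
    using certified_step_complete by blast
  then show "\<exists>w. psnd ((certified_step T ^^ pfst w) (prod_encode (psnd w, x))) = y"
    by (intro exI[of _ "prod_encode (k, l)"]) simp
next
  assume "\<exists>w. psnd ((certified_step T ^^ pfst w) (prod_encode (psnd w, x))) = y"
  then obtain w where "psnd ((certified_step T ^^ pfst w) (prod_encode (psnd w, x))) = y" ..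
  with certified_step_sound[of "prod_encode (psnd w, x)" "pfst w"] show "R\<^sup>*\<^sup>* x y" by simp
qed

end

lemma semidecidable_rtranclp_nat:
  assumes "semidecidable (\<lambda>p :: nat \<times> nat. R (fst p) (snd p))"
  shows "semidecidable (\<lambda>p :: nat \<times> nat. R\<^sup>*\<^sup>* (fst p) (snd p))"
proof -
  from assms obtain T where
    T: "unary_recursive T" "\<And>p. R (fst p) (snd p) \<longleftrightarrow> (\<exists>w. T (prod_encode (w, gcode p)) = 0)"
    unfolding semidecidable_def by blast
  have R_iff: "R x z \<longleftrightarrow> (\<exists>w. T (prod_encode (w, prod_encode (x, z))) = 0)" for x z
    using T(2)[of "(x, z)"] by simp
  show ?thesis
  proof (rule semidecidable_ex_eqI)
    show "unary_recursive (\<lambda>z. psnd ((certified_step T ^^ pfst (pfst z))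
        (prod_encode (psnd (pfst z), pfst (psnd z)))))"
      "unary_recursive (\<lambda>z. psnd (psnd z))"
      by (intro recursive_intros recursive_funpow recursive_certified_step T(1), simp_all)+
  qed (simp add: rtranclp_iff_certified[OF R_iff] gcode_prod_def)
qed

lemma rtranclp_gcode_iff:
  fixes R :: "'a::godel \<Rightarrow> 'a \<Rightarrow> bool"
  shows "R\<^sup>*\<^sup>* x y \<longleftrightarrow> (\<lambda>m n. \<exists>x y. m = gcode x \<and> n = gcode y \<and> R x y)\<^sup>*\<^sup>* (gcode x) (gcode y)"
    (is "_ \<longleftrightarrow> ?S\<^sup>*\<^sup>* _ _")
proof
  assume "R\<^sup>*\<^sup>* x y"
  then show "?S\<^sup>*\<^sup>* (gcode x) (gcode y)"
  proof induction
    case (step y z)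
    then have "?S (gcode y) (gcode z)" by blast
    with step(3) show ?case by (rule rtranclp.rtrancl_into_rtrancl)
  qed simp
next
  assume "?S\<^sup>*\<^sup>* (gcode x) (gcode y)"
  then have "\<exists>y'. gcode y = gcode y' \<and> R\<^sup>*\<^sup>* x y'"
  proof induction
    case (step m n)
    then obtain y z where "n = gcode z" "R\<^sup>*\<^sup>* x y" "R y z" by auto
    then show ?case by (blast intro: rtranclp.rtrancl_into_rtrancl)
  qed blast
  then show "R\<^sup>*\<^sup>* x y" by simp
qed


section \<open>Effective functions\<close>

definition effective :: "('a::godel \<Rightarrow> 'b::godel) \<Rightarrow> bool" where
  "effective f \<longleftrightarrow> semidecidable (\<lambda>p. f (fst p) = snd p)"

lemma semidecidable_graph:
  assumes "effective f" "tracked a" "tracked b"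
  shows "semidecidable (\<lambda>x. f (a x) = b x)"
  using semidecidable_tracked[OF assms(1)[unfolded effective_def] tracked_Pair[OF assms(2,3)]]
  by simp

lemma semidecidable_tracked2:
  assumes "semidecidable (\<lambda>p. R (fst p) (snd p))" "tracked a" "tracked b"
  shows "semidecidable (\<lambda>x. R (a x) (b x))"
  using semidecidable_tracked[OF assms(1) tracked_Pair[OF assms(2,3)]] by simp

lemma tracked_imp_effective:
  assumes "tracked f"
  shows "effective f"
proof -
  from assms obtain F where "unary_recursive F" "\<And>x. gcode (f x) = F (gcode x)"
    unfolding tracked_def by blast
  then have "tracked (\<lambda>p. f (fst p))"
    by (intro tracked_compose[where C = f and F = F] tracked_intros)
  then show ?thesis unfolding effective_def by (intro semidecidable_eq_tracked tracked_intros)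
qed

lemma semidecidable_compose:
  fixes f :: "'a::godel \<Rightarrow> 'b::godel_enum"
  assumes "semidecidable P" "effective f"
  shows "semidecidable (\<lambda>x. P (f x))"
proof -
  have "semidecidable (\<lambda>x. \<exists>y. f x = y \<and> P y)"
    by (intro effective_intros semidecidable_graph[OF assms(2)] semidecidable_tracked[OF assms(1)]
        tracked_intros)
  then show ?thesis by simp
qed

lemma effective_compose:
  fixes f :: "'a::godel \<Rightarrow> 'b::godel_enum"
  assumes "effective g" "effective f"
  shows "effective (\<lambda>x. g (f x))"
proof -
  have "semidecidable (\<lambda>p. \<exists>y. f (fst p) = y \<and> g y = snd p)"
    by (intro effective_intros semidecidable_graph[OF assms(1)] semidecidable_graph[OF assms(2)]
        tracked_intros)
  then show ?thesis unfolding effective_def by simp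
qed

lemma effective_id [effective_intros]: "effective (\<lambda>x. x)"
  by (intro tracked_imp_effective tracked_intros)

lemma effective_const [effective_intros]: "effective (\<lambda>x. c)"
  by (intro tracked_imp_effective tracked_intros)

lemma effective_Pair [effective_intros]:
  assumes "effective f" "effective g"
  shows "effective (\<lambda>x. (f x, g x))"
proof -
  have "semidecidable (\<lambda>p. f (fst p) = fst (snd p) \<and> g (fst p) = snd (snd p))"
    by (intro effective_intros semidecidable_graph[OF assms(1)] semidecidable_graph[OF assms(2)]
        tracked_intros)
  then show ?thesis unfolding effective_def by (simp add: prod_eq_iff)
qed

instance prod :: (godel_enum, godel_enum) godel_enum
proof
  have "n \<in> range (gcode :: 'a \<times> 'b \<Rightarrow> nat) \<longleftrightarrow> (\<exists>x :: 'a. \<exists>y :: 'b. n = gcode (x, y))" for n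
    by (auto simp: image_iff)
  then show "semidecidable (\<lambda>n. n \<in> range (gcode :: 'a \<times> 'b \<Rightarrow> nat))"
    by (simp only:) (intro effective_intros semidecidable_eq_tracked tracked_intros)
qed

lemma effective_fst [effective_intros]:
  fixes f :: "'a::godel \<Rightarrow> 'b::godel_enum \<times> 'c::godel_enum"
  shows "effective f \<Longrightarrow> effective (\<lambda>x. fst (f x))"
  by (rule effective_compose[of fst]) (intro tracked_imp_effective tracked_intros)

lemma effective_snd [effective_intros]:
  fixes f :: "'a::godel \<Rightarrow> 'b::godel_enum \<times> 'c::godel_enum"
  shows "effective f \<Longrightarrow> effective (\<lambda>x. snd (f x))"
  by (rule effective_compose[of snd]) (intro tracked_imp_effective tracked_intros)

lemma effective_gcode [effective_intros]:
  fixes f :: "'a::godel \<Rightarrow> 'b::godel_enum"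
  shows "effective f \<Longrightarrow> effective (\<lambda>x. gcode (f x))"
  by (rule effective_compose[of gcode]) (intro tracked_imp_effective tracked_intros)

lemma semidecidable_eq [effective_intros]:
  fixes f g :: "'a::godel \<Rightarrow> 'b::godel_enum"
  assumes "effective f" "effective g"
  shows "semidecidable (\<lambda>x. f x = g x)"
proof -
  have "semidecidable (\<lambda>p :: 'b \<times> 'b. fst p = snd p)"
    by (intro semidecidable_eq_tracked tracked_intros)
  from semidecidable_compose[OF this effective_Pair[OF assms]] show ?thesis by simp
qed

lemma semidecidable_less [effective_intros]:
  fixes f g :: "'a::godel \<Rightarrow> nat"
  assumes "effective f" "effective g"
  shows "semidecidable (\<lambda>x. f x < g x)"
  using semidecidable_compose[OF semidecidable_less_nat effective_Pair[OF assms]] by simp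

lemma semidecidable_neq [effective_intros]:
  fixes f g :: "'a::godel \<Rightarrow> 'b::godel_enum"
  assumes "effective f" "effective g"
  shows "semidecidable (\<lambda>x. f x \<noteq> g x)"
proof -
  have "semidecidable (\<lambda>x. gcode (f x) < gcode (g x) \<or> gcode (g x) < gcode (f x))"
    by (intro effective_intros assms)
  then show ?thesis unfolding neq_iff[symmetric] gcode_eq_iff .
qed

lemma effective_if_inj:
  fixes f :: "'a::godel_enum \<Rightarrow> 'b::godel_enum" and c :: "'b \<Rightarrow> 'c::godel_enum"
  assumes "effective (\<lambda>x. c (f x))" "effective c" "inj c"
  shows "effective f"
proof -
  have "semidecidable (\<lambda>p. c (f (fst p)) = c (snd p))"
    by (intro semidecidable_eq effective_compose[OF assms(1)] effective_compose[OF assms(2)]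
      effective_intros)
  then show ?thesis unfolding effective_def by (simp add: inj_eq[OF assms(3)])
qed

lemma effective_imp_computable:
  fixes f :: "'a::godel \<Rightarrow> 'b::godel_enum"
  assumes "effective f"
  shows "computable f"
proof -
  have "semidecidable (\<lambda>p. \<exists>y. f (fst p) = y \<and> snd p = gcode y)"
    by (intro effective_intros semidecidable_graph[OF assms] semidecidable_eq_tracked
      tracked_intros)
  then have "semidecidable (\<lambda>p. snd p = gcode (f (fst p)))" by simp
  from semidecidable_choice[OF this] show ?thesis unfolding computable_def by auto
qed

lemma semidecidable_rtranclp:
  fixes R :: "'a::godel_enum \<Rightarrow> 'a \<Rightarrow> bool"
  assumes R: "semidecidable (\<lambda>p. R (fst p) (snd p))" and f: "effective f" and g: "effective g"
  shows "semidecidable (\<lambda>x. R\<^sup>*\<^sup>* (f x) (g x))"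
proof -
  have "semidecidable (\<lambda>p :: nat \<times> nat. \<exists>x y. fst p = gcode x \<and> snd p = gcode y \<and> R x y)"
    by (intro effective_intros semidecidable_tracked2[OF R] tracked_intros)
  from semidecidable_tracked[OF semidecidable_rtranclp_nat[OF this],
    of "\<lambda>p. (gcode (fst p), gcode (snd p))"]
  have "semidecidable (\<lambda>p. R\<^sup>*\<^sup>* (fst p) (snd p))"
    unfolding rtranclp_gcode_iff[of R] by (simp add: tracked_intros)
  from semidecidable_compose[OF this effective_Pair[OF f g]] show ?thesis by simp
qed


subsection \<open>Constructors\<close>

lemma effective_constructor:
  fixes f :: "'x::godel \<Rightarrow> 'a::godel_enum"
  assumes "unary_recursive F" "\<And>x. gcode (C x) = F (gcode x)" "effective f"
  shows "effective (\<lambda>x. C (f x))"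
proof (rule effective_compose[OF tracked_imp_effective assms(3)])
  show "tracked C" using tracked_compose[OF assms(1,2) tracked_id] .
qed

lemma effective_constructor2:
  fixes f :: "'x::godel \<Rightarrow> 'a::godel_enum" and g :: "'x \<Rightarrow> 'b::godel_enum"
  assumes "unary_recursive F" "\<And>x y. gcode (C x y) = F (prod_encode (gcode x, gcode y))"
    "effective f" "effective g"
  shows "effective (\<lambda>x. C (f x) (g x))"
  using effective_constructor[of F "\<lambda>p. C (fst p) (snd p)",
      OF assms(1) _ effective_Pair[OF assms(3,4)]]
  by (simp add: assms(2) gcode_prod_def)

lemma effective_Suc [effective_intros]: "effective f \<Longrightarrow> effective (\<lambda>x. Suc (f x))"
  by (rule effective_constructor[where F = Suc]) (auto intro!: recursive_intros)

lemma effective_add [effective_intros]: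
  "effective f \<Longrightarrow> effective g \<Longrightarrow> effective (\<lambda>x. f x + g x :: nat)"
  by (rule effective_constructor2[where F = "\<lambda>n. pfst n + psnd n"]) (auto intro!: recursive_intros)

lemma effective_diff [effective_intros]:
  "effective f \<Longrightarrow> effective g \<Longrightarrow> effective (\<lambda>x. f x - g x :: nat)"
  by (rule effective_constructor2[where F = "\<lambda>n. pfst n - psnd n"]) (auto intro!: recursive_intros)

lemma effective_prod_encode [effective_intros]:
  "effective f \<Longrightarrow> effective g \<Longrightarrow> effective (\<lambda>x. prod_encode (f x, g x))"
  by (rule effective_constructor2[where F = "\<lambda>n. n"]) (auto intro!: recursive_intros)

instance bool :: godel_enum
proof
  have "n \<in> range (gcode :: bool \<Rightarrow> nat) \<longleftrightarrow> n < 2" for n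
    by (auto simp: gcode_bool_def image_iff)
  then show "semidecidable (\<lambda>n. n \<in> range (gcode :: bool \<Rightarrow> nat))"
    by (simp only:) (intro effective_intros)
qed

instance option :: (godel_enum) godel_enum
proof
  have "n \<in> range (gcode :: 'a option \<Rightarrow> nat) \<longleftrightarrow> n = 0 \<or> (\<exists>x :: 'a. n = Suc (gcode x))" for n
    by (simp add: image_iff split_option_ex gcode_option_def)
  then show "semidecidable (\<lambda>n. n \<in> range (gcode :: 'a option \<Rightarrow> nat))"
    by (simp only:) (intro effective_intros)
qed

lemma effective_Some [effective_intros]:
  fixes f :: "'x::godel \<Rightarrow> 'a::godel_enum"
  shows "effective f \<Longrightarrow> effective (\<lambda>x. Some (f x))"
  by (rule effective_constructor[where F = Suc])
    (auto simp: gcode_option_def intro!: recursive_intros)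

instantiation sum :: (godel, godel) godel
begin
definition gcode_sum :: "'a + 'b \<Rightarrow> nat" where
  "gcode_sum z = (case z of Inl x \<Rightarrow> prod_encode (0, gcode x) | Inr y \<Rightarrow> prod_encode (1, gcode y))"
instance by standard (auto simp: gcode_sum_def split: sum.splits)
end

instance sum :: (godel_enum, godel_enum) godel_enum
proof
  have "n \<in> range (gcode :: 'a + 'b \<Rightarrow> nat) \<longleftrightarrow>
      (\<exists>x :: 'a. n = prod_encode (0, gcode x)) \<or> (\<exists>y :: 'b. n = prod_encode (1, gcode y))" for n
    by (simp add: image_iff split_sum_ex gcode_sum_def)
  then show "semidecidable (\<lambda>n. n \<in> range (gcode :: 'a + 'b \<Rightarrow> nat))"
    by (simp only:) (intro effective_intros)
qed

lemma effective_Inl [effective_intros]: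
  fixes f :: "'x::godel \<Rightarrow> 'a::godel_enum"
  shows "effective f \<Longrightarrow> effective (\<lambda>x. Inl (f x) :: 'a + 'b::godel_enum)"
  by (rule effective_constructor[where F = "\<lambda>n. prod_encode (0, n)"])
    (auto simp: gcode_sum_def intro!: recursive_intros)

lemma effective_Inr [effective_intros]:
  fixes f :: "'x::godel \<Rightarrow> 'b::godel_enum"
  shows "effective f \<Longrightarrow> effective (\<lambda>x. Inr (f x) :: 'a::godel_enum + 'b)"
  by (rule effective_constructor[where F = "\<lambda>n. prod_encode (1, n)"])
    (auto simp: gcode_sum_def intro!: recursive_intros)

lemma gcode_Nil: "gcode [] = 0"
  and gcode_Cons: "gcode (x # xs) = Suc (prod_encode (gcode x, gcode xs))"
  by (simp_all add: gcode_list_def)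

instance list :: (godel_enum) godel_enum
proof
  let ?R = "\<lambda>m n. \<exists>x :: 'a. n = Suc (prod_encode (gcode x, m))"
  have reaches_code: "?R\<^sup>*\<^sup>* 0 (gcode xs)" for xs :: "'a list"
  proof (induction xs)
    case (Cons x xs)
    then show ?case by (rule rtranclp.rtrancl_into_rtrancl) (auto simp: gcode_Cons)
  qed (simp add: gcode_Nil)
  have "n \<in> range (gcode :: 'a list \<Rightarrow> nat)" if "?R\<^sup>*\<^sup>* 0 n" for n
    using that
  proof induction
    case base
    show ?case by (rule range_eqI[of _ _ "[]"]) (simp add: gcode_Nil)
  next
    case (step m n)
    from step(2,3) obtain xs :: "'a list" and x :: 'a where "m = gcode xs"
      "n = Suc (prod_encode (gcode x, m))"
      by auto
    then show ?case by (intro range_eqI[of _ _ "x # xs"]) (simp add: gcode_Cons)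
  qed
  with reaches_code have "n \<in> range (gcode :: 'a list \<Rightarrow> nat) \<longleftrightarrow> ?R\<^sup>*\<^sup>* 0 n" for n by blast
  then show "semidecidable (\<lambda>n. n \<in> range (gcode :: 'a list \<Rightarrow> nat))"
    by (simp only:) (intro semidecidable_rtranclp effective_intros)
qed

lemma effective_Cons [effective_intros]:
  fixes f :: "'x::godel \<Rightarrow> 'a::godel_enum"
  shows "effective f \<Longrightarrow> effective g \<Longrightarrow> effective (\<lambda>x. f x # g x)"
  by (rule effective_constructor2[where F = Suc]) (auto simp: gcode_Cons intro!: recursive_intros)


subsection \<open>Finite derivations\<close>

lemma list_all_iff_rtranclp:
  "(\<forall>x\<in>set xs. P e x) \<longleftrightarrow>
    (\<lambda>p q. \<exists>x. fst q = fst p \<and> snd p = x # snd q \<and> P (fst p) x)\<^sup>*\<^sup>* (e, xs) (e, [])"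
  (is "_ \<longleftrightarrow> ?R\<^sup>*\<^sup>* _ _")
proof
  show "\<forall>x\<in>set xs. P e x \<Longrightarrow> ?R\<^sup>*\<^sup>* (e, xs) (e, [])"
  proof (induction xs)
    case (Cons x xs)
    then have "?R (e, x # xs) (e, xs)" "?R\<^sup>*\<^sup>* (e, xs) (e, [])" by simp_all
    then show ?case by (rule converse_rtranclp_into_rtranclp)
  qed simp
  have "(\<forall>x\<in>set (snd q). P (fst q) x) \<longrightarrow> (\<forall>x\<in>set (snd p). P (fst p) x)" if "?R\<^sup>*\<^sup>* p q" for p q
    using that by induction auto
  from this[of "(e, xs)" "(e, [])"] show "?R\<^sup>*\<^sup>* (e, xs) (e, []) \<Longrightarrow> \<forall>x\<in>set xs. P e x" by simp
qed

lemma semidecidable_list_all: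
  fixes P :: "'e::godel_enum \<Rightarrow> 'a::godel_enum \<Rightarrow> bool"
  assumes P: "semidecidable (\<lambda>p. P (fst p) (snd p))" and f: "effective f"
  shows "semidecidable (\<lambda>e. \<forall>x\<in>set (f e). P e x)"
  unfolding list_all_iff_rtranclp
  by (intro semidecidable_rtranclp effective_intros f semidecidable_tracked2[OF P] tracked_intros)

lemma semidecidable_in_set [effective_intros]:
  fixes f :: "'x::godel_enum \<Rightarrow> 'a::godel_enum"
  assumes "effective f" "effective g"
  shows "semidecidable (\<lambda>x. f x \<in> set (g x))"
proof -
  let ?tail = "\<lambda>l l' :: 'a list. \<exists>a. l = a # l'"
  have "x \<in> set l \<longleftrightarrow> (\<exists>l'. ?tail\<^sup>*\<^sup>* l (x # l'))" for x l
  proof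
    show "x \<in> set l \<Longrightarrow> \<exists>l'. ?tail\<^sup>*\<^sup>* l (x # l')"
    proof (induction l)
      case (Cons a l)
      have "?tail (a # l) l" by simp
      with Cons show ?case by (auto intro: converse_rtranclp_into_rtranclp)
    qed simp
    have "set m \<subseteq> set l" if "?tail\<^sup>*\<^sup>* l m" for m using that by induction auto
    then show "\<exists>l'. ?tail\<^sup>*\<^sup>* l (x # l') \<Longrightarrow> x \<in> set l" by fastforce
  qed
  then show ?thesis
    by (simp only:) (intro effective_intros semidecidable_rtranclp effective_compose[OF assms(1)]
        effective_compose[OF assms(2)])
qed

inductive derivable :: "('a list \<Rightarrow> 'a \<Rightarrow> bool) \<Rightarrow> 'a \<Rightarrow> bool" for rule where
  derivableI: "\<lbrakk>rule ps c; \<forall>p\<in>set ps. derivable rule p\<rbrakk> \<Longrightarrow> derivable rule c"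

definition derivation_step :: "('a list \<Rightarrow> 'a \<Rightarrow> bool) \<Rightarrow> 'a list \<Rightarrow> 'a list \<Rightarrow> bool" where
  "derivation_step rule l l' \<longleftrightarrow> (\<exists>c ps. l' = c # l \<and> rule ps c \<and> (\<forall>p\<in>set ps. p \<in> set l))"

lemma derivation_sound:
  assumes "(derivation_step rule)\<^sup>*\<^sup>* [] l" "c \<in> set l"
  shows "derivable rule c"
  using assms
proof (induction arbitrary: c)
  case (step l l')
  from step(2) obtain d ps where "l' = d # l" "rule ps d" "\<forall>p\<in>set ps. p \<in> set l"
    by (auto simp: derivation_step_def)
  with step show ?case by (auto intro: derivableI)
qed simp

lemma derivation_append:
  assumes "(derivation_step rule)\<^sup>*\<^sup>* [] l" "(derivation_step rule)\<^sup>*\<^sup>* [] l'"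
  shows "(derivation_step rule)\<^sup>*\<^sup>* [] (l @ l')"
  using assms(1)
proof induction
  case base
  show ?case using assms(2) by simp
next
  case (step l1 l2)
  from step(2) have "derivation_step rule (l1 @ l') (l2 @ l')" by (auto simp: derivation_step_def)
  with step(3) show ?case by (rule rtranclp.rtrancl_into_rtrancl)
qed

lemma derivation_complete:
  assumes "derivable rule c"
  shows "\<exists>l. (derivation_step rule)\<^sup>*\<^sup>* [] l \<and> c \<in> set l"
  using assms
proof induction
  case (derivableI ps c)
  have "\<exists>l. (derivation_step rule)\<^sup>*\<^sup>* [] l \<and> set qs \<subseteq> set l" if "set qs \<subseteq> set ps" for qs
    using that
  proof (induction qs)
    case (Cons q qs)
    then obtain l l' where "(derivation_step rule)\<^sup>*\<^sup>* [] l" "q \<in> set l"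
      "(derivation_step rule)\<^sup>*\<^sup>* [] l'" "set qs \<subseteq> set l'"
      using derivableI(2) by auto
    then show ?case by (intro exI[of _ "l @ l'"]) (auto intro: derivation_append)
  qed auto
  then obtain l where l: "(derivation_step rule)\<^sup>*\<^sup>* [] l" "set ps \<subseteq> set l" by blast
  with derivableI(1) have "derivation_step rule l (c # l)" by (auto simp: derivation_step_def)
  with l(1) have "(derivation_step rule)\<^sup>*\<^sup>* [] (c # l)" by (rule rtranclp.rtrancl_into_rtrancl)
  then show ?case by (intro exI[of _ "c # l"]) simp
qed

lemma semidecidable_derivable:
  fixes rule :: "'a::godel_enum list \<Rightarrow> 'a \<Rightarrow> bool" and f :: "'x::godel \<Rightarrow> 'a"
  assumes rule: "semidecidable (\<lambda>z. rule (fst z) (snd z))" and f: "effective f"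
  shows "semidecidable (\<lambda>x. derivable rule (f x))"
proof -
  have "semidecidable (\<lambda>p. derivation_step rule (fst p) (snd p))"
    unfolding derivation_step_def
    by (intro effective_intros semidecidable_list_all semidecidable_tracked2[OF rule]
      tracked_intros)
  then have "semidecidable (\<lambda>c. \<exists>l. (derivation_step rule)\<^sup>*\<^sup>* [] l \<and> c \<in> set l)"
    by (intro effective_intros semidecidable_rtranclp)
  moreover have "derivable rule = (\<lambda>c. \<exists>l. (derivation_step rule)\<^sup>*\<^sup>* [] l \<and> c \<in> set l)"
    by (intro ext) (use derivation_sound derivation_complete in fast)
  ultimately have "semidecidable (derivable rule)" by simp
  from semidecidable_compose[OF this f] show ?thesis .
qed


section \<open>Codes of the syntax\<close>

lemma semidecidable_range_derivable:
  fixes code :: "'a \<Rightarrow> nat"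
  assumes rule: "semidecidable (\<lambda>z. rule (fst z) (snd z))"
    and closed: "\<And>ps c. rule ps c \<Longrightarrow> set ps \<subseteq> range code \<Longrightarrow> c \<in> range code"
    and derivable: "\<And>x. derivable rule (code x)"
  shows "semidecidable (\<lambda>n. n \<in> range code)"
proof -
  have "n \<in> range code" if "derivable rule n" for n
    using that by induction (auto intro: closed)
  with derivable have "n \<in> range code \<longleftrightarrow> derivable rule n" for n by blast
  then show ?thesis by (simp only:) (intro semidecidable_derivable rule effective_id)
qed

instantiation head :: godel
begin
definition "gcode_head = code_head"
instance by standard (simp add: gcode_head_def code_head_inject)
end

instance head :: godel_enum
proof
  have "(\<exists>H. P H) \<longleftrightarrow> (\<exists>x. P (Var x)) \<or> (\<exists>c. P (Con c)) \<or> (\<exists>r. P (Rec r))" for P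
    by (metis head.exhaust)
  then have "n \<in> range (gcode :: head \<Rightarrow> nat) \<longleftrightarrow> (\<exists>x. n = prod_encode (0, x)) \<or>
      (\<exists>c. n = prod_encode (1, c)) \<or> (\<exists>r. n = prod_encode (2, r))" for n
    by (simp add: image_iff gcode_head_def)
  then show "semidecidable (\<lambda>n. n \<in> range (gcode :: head \<Rightarrow> nat))"
    by (simp only:) (intro effective_intros)
qed

primrec code_stp :: "stp \<Rightarrow> nat" where
  "code_stp Base = prod_encode (0, 0)"
| "code_stp (Arr \<tau>2 \<tau>1) = prod_encode (1, prod_encode (code_stp \<tau>2, code_stp \<tau>1))"

lemma code_stp_inject: "code_stp \<tau> = code_stp \<sigma> \<Longrightarrow> \<tau> = \<sigma>"
proof (induction \<tau> arbitrary: \<sigma>)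
  case Base then show ?case by (cases \<sigma>) auto
next
  case (Arr \<tau>2 \<tau>1) then show ?case by (cases \<sigma>) auto
qed

instantiation stp :: godel
begin
definition "gcode_stp = code_stp"
instance by standard (simp add: gcode_stp_def code_stp_inject)
end

inductive stp_rule :: "nat list \<Rightarrow> nat \<Rightarrow> bool" where
  "stp_rule [] (prod_encode (0, 0))"
| "stp_rule [a, b] (prod_encode (1, prod_encode (a, b)))"

instance stp :: godel_enum
proof (standard, unfold gcode_stp_def, rule semidecidable_range_derivable)
  show "semidecidable (\<lambda>z. stp_rule (fst z) (snd z))"
    unfolding stp_rule.simps by (intro effective_intros)
  show "c \<in> range code_stp" if "stp_rule ps c" "set ps \<subseteq> range code_stp" for ps c
    using that by cases (auto simp flip: code_stp.simps simp del: One_nat_def)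
  show "derivable stp_rule (code_stp \<tau>)" for \<tau>
  proof (induction \<tau>)
    case Base
    show ?case using derivableI[where rule = stp_rule, OF stp_rule.intros(1)] by simp
  next
    case (Arr \<tau>2 \<tau>1)
    then show ?case using derivableI[where rule = stp_rule, OF stp_rule.intros(2)] by simp
  qed
qed

type_synonym syn = "tm + neu + spine"

inductive syn_rule :: "nat list \<Rightarrow> nat \<Rightarrow> bool" where
  Neu: "syn_rule [prod_encode (1, prod_encode (0, n))] (prod_encode (0, prod_encode (0, n)))"
| Lam: "syn_rule [prod_encode (0, n)] (prod_encode (0, prod_encode (1, n)))"
| App: "syn_rule [prod_encode (1, prod_encode (1, n))]
    (prod_encode (1, prod_encode (0, prod_encode (gcode (H :: head), n))))"
| SNil: "syn_rule [] (prod_encode (1, prod_encode (1, prod_encode (0, 0))))"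
| SArg: "syn_rule [prod_encode (0, m), prod_encode (1, prod_encode (1, n))]
    (prod_encode (1, prod_encode (1, prod_encode (1, prod_encode (m, n)))))"
| SPre: "syn_rule [prod_encode (1, prod_encode (1, n))]
    (prod_encode (1, prod_encode (1, prod_encode (2, prod_encode (y, n)))))"

lemma gcode_syn:
  "gcode (Inl M :: syn) = prod_encode (0, code_tm M)"
  "gcode (Inr (Inl R) :: syn) = prod_encode (1, prod_encode (0, code_neu R))"
  "gcode (Inr (Inr S) :: syn) = prod_encode (1, prod_encode (1, code_spine S))"
  by (simp_all add: gcode_sum_def gcode_tm_def gcode_neu_def gcode_spine_def)

lemma range_gcode_syn:
  "prod_encode (0, n) \<in> range (gcode :: syn \<Rightarrow> nat) \<longleftrightarrow> n \<in> range code_tm"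
  "prod_encode (1, prod_encode (0, n)) \<in> range (gcode :: syn \<Rightarrow> nat) \<longleftrightarrow> n \<in> range code_neu"
  "prod_encode (1, prod_encode (1, n)) \<in> range (gcode :: syn \<Rightarrow> nat) \<longleftrightarrow> n \<in> range code_spine"
  by (simp_all add: image_iff split_sum_ex gcode_syn)

lemma syn_rule_closed:
  assumes "syn_rule ps c" "set ps \<subseteq> range (gcode :: syn \<Rightarrow> nat)"
  shows "c \<in> range (gcode :: syn \<Rightarrow> nat)"
  using assms
  by cases (auto simp: range_gcode_syn gcode_head_def simp del: One_nat_def
      simp flip: code_tm.simps code_neu.simps code_spine.simps)

lemma derivable_syn:
  "derivable syn_rule (gcode (Inl M :: syn))"
  "derivable syn_rule (gcode (Inr (Inl R) :: syn))"
  "derivable syn_rule (gcode (Inr (Inr S) :: syn))"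
proof (induction M and R and S)
  case (Neu R)
  then show ?case using derivableI[where rule = syn_rule, OF syn_rule.Neu] by (simp add: gcode_syn)
next
  case (Lam M)
  then show ?case using derivableI[where rule = syn_rule, OF syn_rule.Lam] by (simp add: gcode_syn)
next
  case (App H S)
  then show ?case using derivableI[where rule = syn_rule, OF syn_rule.App]
    by (simp add: gcode_syn gcode_head_def)
next
  case SNil
  show ?case using derivableI[where rule = syn_rule, OF syn_rule.SNil] by (simp add: gcode_syn)
next
  case (SArg M S)
  then show ?case using derivableI[where rule = syn_rule, OF syn_rule.SArg] by (simp add: gcode_syn)
next
  case (SPre y S)
  then show ?case using derivableI[where rule = syn_rule, OF syn_rule.SPre] by (simp add: gcode_syn)
qed

lemma semidecidable_range_gcode_syn: "semidecidable (\<lambda>n. n \<in> range (gcode :: syn \<Rightarrow> nat))"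
proof (rule semidecidable_range_derivable)
  show "semidecidable (\<lambda>z. syn_rule (fst z) (snd z))"
    unfolding syn_rule.simps by (intro effective_intros)
  show "derivable syn_rule (gcode z)" for z :: syn
    using derivable_syn by (cases z; cases "projr z") (auto simp: sum.case_eq_if)
qed (rule syn_rule_closed)

instance tm :: godel_enum
  by standard (unfold gcode_tm_def range_gcode_syn(1)[symmetric],
    intro semidecidable_compose[OF semidecidable_range_gcode_syn] effective_intros)

instance neu :: godel_enum
  by standard (unfold gcode_neu_def range_gcode_syn(2)[symmetric],
    intro semidecidable_compose[OF semidecidable_range_gcode_syn] effective_intros)

instance spine :: godel_enum
  by standard (unfold gcode_spine_def range_gcode_syn(3)[symmetric],
    intro semidecidable_compose[OF semidecidable_range_gcode_syn] effective_intros)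

instance aty :: godel_enum
proof
  have "(\<exists>P. Q P) \<longleftrightarrow> (\<exists>a S. Q (Fam a S))" for Q by (metis aty.exhaust)
  then have "n \<in> range (gcode :: aty \<Rightarrow> nat) \<longleftrightarrow> (\<exists>a. \<exists>S :: spine. n = prod_encode (a, gcode S))" for n
    by (simp add: image_iff gcode_aty_def gcode_spine_def)
  then show "semidecidable (\<lambda>n. n \<in> range (gcode :: aty \<Rightarrow> nat))"
    by (simp only:) (intro effective_intros)
qed

inductive ty_rule :: "nat list \<Rightarrow> nat \<Rightarrow> bool" where
  "ty_rule [] (prod_encode (0, gcode (P :: aty)))"
| "ty_rule [a, b] (prod_encode (1, prod_encode (a, b)))"
| "ty_rule [a, b] (prod_encode (2, prod_encode (a, b)))"

instance ty :: godel_enum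
proof (standard, unfold gcode_ty_def, rule semidecidable_range_derivable)
  show "semidecidable (\<lambda>z. ty_rule (fst z) (snd z))"
    unfolding ty_rule.simps by (intro effective_intros)
  show "c \<in> range code_ty" if "ty_rule ps c" "set ps \<subseteq> range code_ty" for ps c
    using that by cases (auto simp: gcode_aty_def simp flip: code_ty.simps simp del: One_nat_def)
  show "derivable ty_rule (code_ty A)" for A
  proof (induction A)
    case (Atom P)
    show ?case using derivableI[where rule = ty_rule, OF ty_rule.intros(1)]
      by (simp add: gcode_aty_def)
  next
    case (Pi A2 A1)
    then show ?case using derivableI[where rule = ty_rule, OF ty_rule.intros(2)] by simp
  next
    case (PrePi A2 A1)
    then show ?case using derivableI[where rule = ty_rule, OF ty_rule.intros(3)] by simp
  qed
qed

inductive kind_rule :: "nat list \<Rightarrow> nat \<Rightarrow> bool" where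
  "kind_rule [] (prod_encode (0, 0))"
| "kind_rule [] (prod_encode (1, 0))"
| "kind_rule [n] (prod_encode (2, prod_encode (gcode (A :: ty), n)))"
| "kind_rule [n] (prod_encode (3, prod_encode (gcode (A :: ty), n)))"

instance kind :: godel_enum
proof (standard, unfold gcode_kind_def, rule semidecidable_range_derivable)
  show "semidecidable (\<lambda>z. kind_rule (fst z) (snd z))"
    unfolding kind_rule.simps by (intro effective_intros)
  show "c \<in> range code_kind" if "kind_rule ps c" "set ps \<subseteq> range code_kind" for ps c
    using that by cases (auto simp: gcode_ty_def simp flip: code_kind.simps simp del: One_nat_def)
  show "derivable kind_rule (code_kind K)" for K
  proof (induction K)
    case Type
    show ?case using derivableI[where rule = kind_rule, OF kind_rule.intros(1)] by simp
  next
    case Cotype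
    show ?case using derivableI[where rule = kind_rule, OF kind_rule.intros(2)] by simp
  next
    case (KPi A K)
    then show ?case using derivableI[where rule = kind_rule, OF kind_rule.intros(3)]
      by (simp add: gcode_ty_def)
  next
    case (KPrePi A K)
    then show ?case using derivableI[where rule = kind_rule, OF kind_rule.intros(4)]
      by (simp add: gcode_ty_def)
  qed
qed

instance decl :: godel_enum
proof
  have "(\<exists>d. P d) \<longleftrightarrow> (\<exists>a K. P (FamDecl a K)) \<or> (\<exists>c A. P (ConDecl c A)) \<or>
      (\<exists>r A M. P (RecDecl r A M))" for P
    by (metis decl.exhaust)
  then have "n \<in> range (gcode :: decl \<Rightarrow> nat) \<longleftrightarrow>
      (\<exists>a. \<exists>K :: kind. n = prod_encode (0, prod_encode (a, gcode K))) \<or>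
      (\<exists>c. \<exists>A :: ty. n = prod_encode (1, prod_encode (c, gcode A))) \<or>
      (\<exists>r. \<exists>A :: ty. \<exists>M :: tm.
        n = prod_encode (2, prod_encode (r, prod_encode (gcode A, gcode M))))" for n
    by (simp add: image_iff gcode_decl_def gcode_kind_def gcode_ty_def gcode_tm_def)
  then show "semidecidable (\<lambda>n. n \<in> range (gcode :: decl \<Rightarrow> nat))"
    by (simp only:) (intro effective_intros)
qed

instance binding :: godel_enum
proof
  have "(\<exists>b. P b) \<longleftrightarrow> (\<exists>A. P (Ord A)) \<or> (\<exists>A. P (Pre A))" for P by (metis binding.exhaust)
  then have "n \<in> range (gcode :: binding \<Rightarrow> nat) \<longleftrightarrow>
      (\<exists>A :: ty. n = prod_encode (0, gcode A)) \<or> (\<exists>A :: ty. n = prod_encode (1, gcode A))" for n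
    by (simp add: image_iff gcode_binding_def gcode_ty_def)
  then show "semidecidable (\<lambda>n. n \<in> range (gcode :: binding \<Rightarrow> nat))"
    by (simp only:) (intro effective_intros)
qed

lemmas gcode_syntax_defs =
  gcode_head_def gcode_tm_def gcode_neu_def gcode_spine_def gcode_aty_def gcode_ty_def
  gcode_kind_def gcode_decl_def gcode_binding_def gcode_stp_def

lemma effective_unary_constructors [effective_intros]:
  "effective k \<Longrightarrow> effective (\<lambda>x. Var (k x))"
  "effective k \<Longrightarrow> effective (\<lambda>x. Con (k x))"
  "effective k \<Longrightarrow> effective (\<lambda>x. Rec (k x))"
  "effective R \<Longrightarrow> effective (\<lambda>x. Neu (R x))"
  "effective M \<Longrightarrow> effective (\<lambda>x. Lam (M x))"
  "effective P \<Longrightarrow> effective (\<lambda>x. Atom (P x))"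
  "effective A \<Longrightarrow> effective (\<lambda>x. Ord (A x))"
  "effective A \<Longrightarrow> effective (\<lambda>x. Pre (A x))"
  by (rule effective_constructor[where F = "\<lambda>n. prod_encode (_, n)"],
    auto simp: gcode_syntax_defs intro!: recursive_intros)+

lemma effective_binary_constructors [effective_intros]:
  "effective M \<Longrightarrow> effective S \<Longrightarrow> effective (\<lambda>x. SArg (M x) (S x))"
  "effective k \<Longrightarrow> effective S \<Longrightarrow> effective (\<lambda>x. SPre (k x) (S x))"
  "effective A \<Longrightarrow> effective B \<Longrightarrow> effective (\<lambda>x. Pi (A x) (B x))"
  "effective A \<Longrightarrow> effective B \<Longrightarrow> effective (\<lambda>x. PrePi (A x) (B x))"
  "effective A \<Longrightarrow> effective K \<Longrightarrow> effective (\<lambda>x. KPi (A x) (K x))"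
  "effective A \<Longrightarrow> effective K \<Longrightarrow> effective (\<lambda>x. KPrePi (A x) (K x))"
  "effective k \<Longrightarrow> effective K \<Longrightarrow> effective (\<lambda>x. FamDecl (k x) (K x))"
  "effective k \<Longrightarrow> effective A \<Longrightarrow> effective (\<lambda>x. ConDecl (k x) (A x))"
  "effective s \<Longrightarrow> effective t \<Longrightarrow> effective (\<lambda>x. Arr (s x) (t x))"
  by (rule effective_constructor2[where F = "\<lambda>n. prod_encode (_, n)"],
    auto simp: gcode_syntax_defs intro!: recursive_intros)+

lemma effective_App [effective_intros]:
  "effective H \<Longrightarrow> effective S \<Longrightarrow> effective (\<lambda>x. App (H x) (S x))"
  by (rule effective_constructor2[where F = "\<lambda>n. n"])
    (auto simp: gcode_syntax_defs intro!: recursive_intros)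

lemma effective_Fam [effective_intros]:
  "effective k \<Longrightarrow> effective S \<Longrightarrow> effective (\<lambda>x. Fam (k x) (S x))"
  by (rule effective_constructor2[where F = "\<lambda>n. n"])
    (auto simp: gcode_syntax_defs intro!: recursive_intros)

lemma effective_RecDecl [effective_intros]:
  assumes "effective r" "effective A" "effective M"
  shows "effective (\<lambda>x. RecDecl (r x) (A x) (M x))"
proof -
  have "effective (\<lambda>x. (\<lambda>(r, A, M). RecDecl r A M) (r x, A x, M x))"
    by (rule effective_constructor[where F = "\<lambda>n. prod_encode (2, n)"])
      (auto simp: gcode_syntax_defs intro!: recursive_intros effective_Pair assms)
  then show ?thesis by simp
qed


section \<open>Effective recursion\<close>

subsection \<open>Finitary predicates of partial functions\<close>

definition finitary :: "(('a \<Rightarrow> 'b option) \<Rightarrow> bool) \<Rightarrow> bool" where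
  "finitary \<Phi> \<longleftrightarrow> (\<forall>g. \<Phi> g \<longleftrightarrow> (\<exists>ps. set ps \<subseteq> Map.graph g \<and> \<Phi> (map_of ps)))"

lemma graph_map_of:
  assumes "set ps \<subseteq> Map.graph g"
  shows "Map.graph (map_of ps) = set ps"
proof
  show "Map.graph (map_of ps) \<subseteq> set ps"
    by (auto simp: Map.graph_def dest: map_of_SomeD)
  show "set ps \<subseteq> Map.graph (map_of ps)"
  proof
    fix p assume p: "p \<in> set ps"
    obtain x y where xy: "p = (x, y)" by (cases p)
    with p obtain y' where y': "map_of ps x = Some y'" using weak_map_of_SomeI by fast
    with p xy assms have "g x = Some y" "g x = Some y'"
      by (auto simp: Map.graph_def dest!: map_of_SomeD)
    with y' xy show "p \<in> Map.graph (map_of ps)" by (simp add: Map.graph_def)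
  qed
qed

lemma finitary_mono:
  "finitary \<Phi> \<Longrightarrow> Map.graph g \<subseteq> Map.graph g' \<Longrightarrow> \<Phi> g \<Longrightarrow> \<Phi> g'"
  unfolding finitary_def by (meson order_trans)

lemma finitaryD: "finitary \<Phi> \<Longrightarrow> \<Phi> g \<Longrightarrow> \<exists>ps. set ps \<subseteq> Map.graph g \<and> \<Phi> (map_of ps)"
  unfolding finitary_def by blast

lemma finitaryI:
  assumes "\<And>g. \<Phi> g \<Longrightarrow> \<exists>ps. set ps \<subseteq> Map.graph g \<and> \<Phi> (map_of ps)"
    and "\<And>g g'. Map.graph g \<subseteq> Map.graph g' \<Longrightarrow> \<Phi> g \<Longrightarrow> \<Phi> g'"
  shows "finitary \<Phi>"
  unfolding finitary_def using assms graph_map_of by blast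

lemma finitary_const: "finitary (\<lambda>g. P)"
  by (rule finitaryI) (auto intro: exI[of _ "[]"])

lemma finitary_call: "finitary (\<lambda>g. g x = Some y)"
  by (rule finitaryI) (auto simp: Map.graph_def intro: exI[of _ "[(x, y)]"])

lemma finitary_conj:
  assumes "finitary \<Phi>" "finitary \<Psi>"
  shows "finitary (\<lambda>g. \<Phi> g \<and> \<Psi> g)"
proof (rule finitaryI)
  fix g assume "\<Phi> g \<and> \<Psi> g"
  then obtain ps qs where ps: "set ps \<subseteq> Map.graph g" "\<Phi> (map_of ps)"
    and qs: "set qs \<subseteq> Map.graph g" "\<Psi> (map_of qs)"
    using finitaryD[OF assms(1)] finitaryD[OF assms(2)] by blast
  have "set (ps @ qs) \<subseteq> Map.graph g" using ps(1) qs(1) by simp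
  moreover have "Map.graph (map_of ps) \<subseteq> Map.graph (map_of (ps @ qs))"
    "Map.graph (map_of qs) \<subseteq> Map.graph (map_of (ps @ qs))"
    unfolding graph_map_of[OF calculation] graph_map_of[OF ps(1)] graph_map_of[OF qs(1)] by auto
  ultimately show "\<exists>ps. set ps \<subseteq> Map.graph g \<and> \<Phi> (map_of ps) \<and> \<Psi> (map_of ps)"
    using finitary_mono[OF assms(1) _ ps(2)] finitary_mono[OF assms(2) _ qs(2)] by blast
qed (use finitary_mono[OF assms(1)] finitary_mono[OF assms(2)] in blast)

lemma finitary_disj: "finitary \<Phi> \<Longrightarrow> finitary \<Psi> \<Longrightarrow> finitary (\<lambda>g. \<Phi> g \<or> \<Psi> g)"
  unfolding finitary_def by blast

lemma finitary_ex: "(\<And>y. finitary (\<Phi> y)) \<Longrightarrow> finitary (\<lambda>g. \<exists>y. \<Phi> y g)"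
  unfolding finitary_def by blast

definition semidecidable_op ::
    "(('a::godel_enum \<Rightarrow> 'b::godel_enum option) \<Rightarrow> 'e::godel_enum \<Rightarrow> bool) \<Rightarrow> bool" where
  "semidecidable_op \<Phi> \<longleftrightarrow>
    (\<forall>e. finitary (\<lambda>g. \<Phi> g e)) \<and> semidecidable (\<lambda>z. \<Phi> (map_of (fst z)) (snd z))"

lemma semidecidable_opD:
  assumes "semidecidable_op \<Phi>" "effective a" "effective b"
  shows "semidecidable (\<lambda>x. \<Phi> (map_of (a x)) (b x))"
  using semidecidable_compose[OF _ effective_Pair[OF assms(2,3)],
    of "\<lambda>z. \<Phi> (map_of (fst z)) (snd z)"]
    assms(1) by (simp add: semidecidable_op_def)

lemma semidecidable_op_const:
  assumes "semidecidable P"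
  shows "semidecidable_op (\<lambda>g. P)"
  unfolding semidecidable_op_def
  by (intro conjI allI finitary_const semidecidable_compose[OF assms] effective_intros)

lemma semidecidable_op_conj:
  "semidecidable_op \<Phi> \<Longrightarrow> semidecidable_op \<Psi> \<Longrightarrow> semidecidable_op (\<lambda>g e. \<Phi> g e \<and> \<Psi> g e)"
  by (simp add: semidecidable_op_def finitary_conj semidecidable_conj)

lemma semidecidable_op_disj:
  "semidecidable_op \<Phi> \<Longrightarrow> semidecidable_op \<Psi> \<Longrightarrow> semidecidable_op (\<lambda>g e. \<Phi> g e \<or> \<Psi> g e)"
  by (simp add: semidecidable_op_def finitary_disj semidecidable_disj)

lemma semidecidable_op_ex:
  assumes "semidecidable_op (\<lambda>g z. \<Phi> g (fst z) (snd z))"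
  shows "semidecidable_op (\<lambda>g e. \<exists>y. \<Phi> g e y)"
  unfolding semidecidable_op_def
proof (intro conjI allI finitary_ex semidecidable_ex)
  show "finitary (\<lambda>g. \<Phi> g e y)" for e y
    using assms unfolding semidecidable_op_def by (metis fst_conv snd_conv)
  show "semidecidable (\<lambda>p. \<Phi> (map_of (fst (fst p))) (snd (fst p)) (snd p))"
    using semidecidable_opD[OF assms, of "\<lambda>p. fst (fst p)" "\<lambda>p. (snd (fst p), snd p)"]
    by (simp add: effective_intros)
qed

lemma semidecidable_op_compose:
  assumes "semidecidable_op \<Phi>" "effective t"
  shows "semidecidable_op (\<lambda>g e. \<Phi> g (t e))"
  unfolding semidecidable_op_def
proof (intro conjI allI)
  show "finitary (\<lambda>g. \<Phi> g (t e))" for e using assms(1) by (simp add: semidecidable_op_def)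
  show "semidecidable (\<lambda>z. \<Phi> (map_of (fst z)) (t (snd z)))"
    by (intro semidecidable_opD[OF assms(1)] effective_intros effective_compose[OF assms(2)])
qed

lemma map_of_eq_Some_iff_rtranclp:
  "map_of ps x = Some y \<longleftrightarrow>
    (\<exists>qs. (\<lambda>u v. fst u = fst v \<and> (\<exists>a b. a \<noteq> fst u \<and> snd u = (a, b) # snd v))\<^sup>*\<^sup>*
      (x, ps) (x, (x, y) # qs))"
  (is "_ \<longleftrightarrow> (\<exists>qs. ?R\<^sup>*\<^sup>* _ _)")
proof
  show "map_of ps x = Some y \<Longrightarrow> \<exists>qs. ?R\<^sup>*\<^sup>* (x, ps) (x, (x, y) # qs)"
  proof (induction ps)
    case (Cons p ps)
    show ?case
    proof (cases "fst p = x")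
      case True
      with Cons.prems have "p = (x, y)" by (cases p) auto
      then show ?thesis by blast
    next
      case False
      then have skip: "?R (x, p # ps) (x, ps)" by (cases p) auto
      from False Cons obtain qs where "?R\<^sup>*\<^sup>* (x, ps) (x, (x, y) # qs)" by (cases p) auto
      from converse_rtranclp_into_rtranclp[of ?R, OF skip this] show ?thesis by blast
    qed
  qed simp
  have invariant: "fst u = fst v \<and> map_of (snd u) (fst u) = map_of (snd v) (fst v)"
    if "?R\<^sup>*\<^sup>* u v" for u v
    using that by induction auto
  assume "\<exists>qs. ?R\<^sup>*\<^sup>* (x, ps) (x, (x, y) # qs)"
  then obtain qs where "?R\<^sup>*\<^sup>* (x, ps) (x, (x, y) # qs)" ..
  from invariant[OF this] show "map_of ps x = Some y" by simp
qed

lemma semidecidable_map_of: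
  fixes b :: "'x::godel \<Rightarrow> 'a::godel_enum" and c :: "'x \<Rightarrow> 'b::godel_enum"
  assumes "effective a" "effective b" "effective c"
  shows "semidecidable (\<lambda>x. map_of (a x) (b x) = Some (c x))"
proof -
  have "semidecidable (\<lambda>z :: ('a \<times> 'b) list \<times> 'a \<times> 'b.
      map_of (fst z) (fst (snd z)) = Some (snd (snd z)))"
    unfolding map_of_eq_Some_iff_rtranclp by (intro effective_intros semidecidable_rtranclp)
  from semidecidable_compose[OF this effective_Pair[OF assms(1) effective_Pair[OF assms(2,3)]]]
  show ?thesis by simp
qed


subsection \<open>Effective operators and their fixed points\<close>

definition effective_op ::
    "(('a::godel_enum \<Rightarrow> 'b::godel_enum option) \<Rightarrow>
      'e::godel_enum \<Rightarrow> 'c::godel_enum option) \<Rightarrow> bool" where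
  "effective_op F \<longleftrightarrow> semidecidable_op (\<lambda>g z. F g (fst z) = Some (snd z))"

lemma effective_op_finitary:
  assumes "effective_op F"
  shows "finitary (\<lambda>g. F g e = Some c)"
  using assms unfolding effective_op_def semidecidable_op_def by (metis fst_conv snd_conv)

lemma effective_op_mono:
  assumes "effective_op F" "Map.graph g \<subseteq> Map.graph g'" "F g e = Some c"
  shows "F g' e = Some c"
  using finitary_mono[OF effective_op_finitary[OF assms(1)] assms(2,3)] .

lemma semidecidable_op_graph:
  assumes "effective_op F" "effective a" "effective b"
  shows "semidecidable_op (\<lambda>g x. F g (a x) = Some (b x))"
  using semidecidable_op_compose[OF assms(1)[unfolded effective_op_def]
      effective_Pair[OF assms(2,3)]]
  by simp

lemma option_ord_iff_graph: "fun_ord option_ord g g' \<longleftrightarrow> Map.graph g \<subseteq> Map.graph g'"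
proof
  show "Map.graph g \<subseteq> Map.graph g'" if "fun_ord option_ord g g'"
  proof
    fix p assume "p \<in> Map.graph g"
    then obtain x y where "p = (x, y)" "g x = Some y" by (auto simp: Map.graph_def)
    with that show "p \<in> Map.graph g'"
      by (auto simp: fun_ord_def flat_ord_def Map.graph_def dest: spec[of _ x])
  qed
  show "fun_ord option_ord g g'" if "Map.graph g \<subseteq> Map.graph g'"
    unfolding fun_ord_def flat_ord_def
  proof
    fix x
    show "g x = None \<or> g x = g' x"
      using that by (cases "g x") (auto simp: Map.graph_def)
  qed
qed

lemma effective_op_mono_body:
  assumes "effective_op F"
  shows "option.mono_body (\<lambda>g. F g x)"
proof (rule monotoneI)
  fix g g' :: "'a \<Rightarrow> 'b option" assume "fun_ord option_ord g g'"
  with effective_op_mono[OF assms, of g g' x] show "option_ord (F g x) (F g' x)"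
    unfolding option_ord_iff_graph flat_ord_def by (cases "F g x") auto
qed

inductive fixpoint_rule ::
    "(('a \<Rightarrow> 'b option) \<Rightarrow> 'a \<Rightarrow> 'b option) \<Rightarrow> ('a \<times> 'b) list \<Rightarrow> 'a \<times> 'b \<Rightarrow> bool" for F where
  "F (map_of ps) x = Some y \<Longrightarrow> fixpoint_rule F ps (x, y)"

lemma fixp_fun_iff_derivable:
  assumes F: "effective_op F"
  shows "option.fixp_fun F x = Some y \<longleftrightarrow> derivable (fixpoint_rule F) (x, y)"
proof
  note mono = effective_op_mono_body[OF F]
  show "derivable (fixpoint_rule F) (x, y)" if "option.fixp_fun F x = Some y"
  proof (rule fixp_induct_option[where U = "\<lambda>g. g" and C = "\<lambda>g. g" and F = F,
        OF mono reflexive _ _ that])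
    fix g x y assume g: "\<And>x y. g x = Some y \<Longrightarrow> derivable (fixpoint_rule F) (x, y)"
      and "F g x = Some y"
    then obtain ps where "set ps \<subseteq> Map.graph g" "F (map_of ps) x = Some y"
      using finitaryD[OF effective_op_finitary[OF F]] by blast
    with g show "derivable (fixpoint_rule F) (x, y)"
      by (intro derivableI[of "fixpoint_rule F" ps] fixpoint_rule.intros) (auto simp: Map.graph_def)
  qed simp
  have "option.fixp_fun F (fst c) = Some (snd c)" if "derivable (fixpoint_rule F) c" for c
    using that
  proof induction
    case (derivableI ps c)
    from derivableI(2) have "set ps \<subseteq> Map.graph (option.fixp_fun F)"
      by (auto simp: Map.graph_def)
    moreover from derivableI(1) have "F (map_of ps) (fst c) = Some (snd c)" by cases simp
    ultimately have "F (option.fixp_fun F) (fst c) = Some (snd c)"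
      using effective_op_mono[OF F] graph_map_of by blast
    then show ?case by (subst option.mono_body_fixp[OF mono])
  qed
  then show "option.fixp_fun F x = Some y" if "derivable (fixpoint_rule F) (x, y)"
    using that by fastforce
qed

theorem effective_op_fixpoint:
  assumes F: "effective_op F"
  shows "\<exists>h. (\<forall>x. h x = F h x) \<and> semidecidable (\<lambda>p. h (fst p) = Some (snd p))"
proof (intro exI conjI allI)
  show "option.fixp_fun F x = F (option.fixp_fun F) x" for x
    by (rule fun_cong[OF option.mono_body_fixp[OF effective_op_mono_body[OF F]]])
  have "fixpoint_rule F ps c \<longleftrightarrow> F (map_of ps) (fst c) = Some (snd c)" for ps c
    by (cases c) (simp add: fixpoint_rule.simps)
  then have "semidecidable (\<lambda>z. fixpoint_rule F (fst z) (snd z))"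
    using F by (simp add: effective_op_def semidecidable_op_def)
  then show "semidecidable (\<lambda>p. option.fixp_fun F (fst p) = Some (snd p))"
    unfolding fixp_fun_iff_derivable[OF F] by (intro semidecidable_derivable effective_intros)
qed

theorem effective_rec:
  fixes F :: "('a::godel_enum \<Rightarrow> 'b::godel_enum option) \<Rightarrow> 'a \<Rightarrow> 'b option"
    and t :: "'x::godel_enum \<Rightarrow> 'a"
  assumes operator: "effective_op F" and input: "effective t"
    and fixpoint: "\<And>h x. (\<And>z. h z = F h z) \<Longrightarrow> h (t x) = Some (f x)"
  shows "effective f"
proof -
  from effective_op_fixpoint[OF operator] obtain h where
    h: "\<And>z. h z = F h z" "semidecidable (\<lambda>p. h (fst p) = Some (snd p))" by blast
  have "effective (\<lambda>p :: 'x \<times> 'b. (t (fst p), snd p))"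
    by (intro effective_intros effective_compose[OF input])
  from semidecidable_compose[OF h(2) this] show ?thesis
    unfolding effective_def using fixpoint[of h, OF h(1)] by simp
qed

lemma effective_rec_inj:
  fixes F :: "('a::godel_enum \<Rightarrow> 'b::godel_enum option) \<Rightarrow> 'a \<Rightarrow> 'b option"
    and f :: "'x::godel_enum \<Rightarrow> 'c::godel_enum"
  assumes operator: "effective_op F" and embedding: "effective c" "inj c" and input: "effective t"
    and fixpoint: "\<And>h x. (\<And>z. h z = F h z) \<Longrightarrow> h (t x) = Some (c (f x))"
  shows "effective f"
proof (rule effective_if_inj[OF _ embedding])
  show "effective (\<lambda>x. c (f x))" by (rule effective_rec[OF operator input]) (rule fixpoint)
qed


subsection \<open>Program constructs\<close>

lemma effective_opI:
  "semidecidable_op \<Phi> \<Longrightarrow> (\<And>g e c. F g e = Some c \<longleftrightarrow> \<Phi> g (e, c)) \<Longrightarrow> effective_op F"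
  by (simp add: effective_op_def)

lemma effective_op_None [effective_intros]: "effective_op (\<lambda>g e. None)"
  by (rule effective_opI[OF semidecidable_op_const[OF semidecidable_const[of False]]]) simp

lemma effective_op_Some [effective_intros]:
  assumes "effective t"
  shows "effective_op (\<lambda>g e. Some (t e))"
proof (rule effective_opI[OF semidecidable_op_const])
  show "semidecidable (\<lambda>z. t (fst z) = snd z)"
    using assms unfolding effective_def .
qed simp

lemma effective_op_call [effective_intros]:
  fixes t :: "'e::godel_enum \<Rightarrow> 'a::godel_enum"
  assumes "effective t"
  shows "effective_op (\<lambda>g :: 'a \<Rightarrow> 'b::godel_enum option. \<lambda>e. g (t e))"
  unfolding effective_op_def semidecidable_op_def
  by (intro conjI allI finitary_call semidecidable_map_of effective_intros
    effective_compose[OF assms])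

lemma effective_op_bind [effective_intros]:
  assumes "effective_op F" "effective_op (\<lambda>g p. G g (fst p) (snd p))"
  shows "effective_op (\<lambda>g e. Option.bind (F g e) (\<lambda>c. G g e c))"
proof (rule effective_opI)
  show "semidecidable_op (\<lambda>g z. \<exists>c. F g (fst z) = Some c \<and> G g (fst z) c = Some (snd z))"
    using semidecidable_op_graph[OF assms(2), of "\<lambda>w. (fst (fst w), snd w)" "\<lambda>w. snd (fst w)"]
    by (intro semidecidable_op_ex semidecidable_op_conj semidecidable_op_graph[OF assms(1)])
      (simp_all add: effective_intros)
qed (simp add: bind_eq_Some_conv)

lemma effective_op_if [effective_intros]:
  assumes "effective b" "effective_op F" "effective_op G"
  shows "effective_op (\<lambda>g e. if b e then F g e else G g e)"
proof (rule effective_opI)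
  show "semidecidable_op (\<lambda>g z. b (fst z) = True \<and> F g (fst z) = Some (snd z) \<or>
      b (fst z) = False \<and> G g (fst z) = Some (snd z))"
    by (intro semidecidable_op_disj semidecidable_op_conj semidecidable_op_const
        semidecidable_op_graph[OF assms(2)] semidecidable_op_graph[OF assms(3)]
        effective_intros effective_compose[OF assms(1)])
qed simp

lemma effective_op_case_prod [effective_intros]:
  "effective_op (\<lambda>g e. F g e (fst (t e)) (snd (t e))) \<Longrightarrow>
    effective_op (\<lambda>g e. case t e of (x, y) \<Rightarrow> F g e x y)"
  by (simp add: split_beta)

lemma effective_if_effective_op:
  assumes "effective_op (\<lambda>g :: nat \<Rightarrow> nat option. \<lambda>e. Some (f e))"
  shows "effective f"
  using semidecidable_opD[OF assms[unfolded effective_op_def] effective_const[of "[]"] effective_id]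
  by (simp add: effective_def)


subsection \<open>Case distinctions\<close>

lemma semidecidable_op_constant_case:
  fixes t :: "'e::godel_enum \<Rightarrow> 't::godel_enum"
  assumes "effective t" "effective_op A"
  shows "semidecidable_op (\<lambda>g z. t (fst z) = c \<and> A g (fst z) = Some (snd z))"
  by (intro semidecidable_op_conj semidecidable_op_const semidecidable_op_graph[OF assms(2)]
      effective_intros effective_compose[OF assms(1)])

lemma semidecidable_op_case:
  fixes t :: "'e::godel_enum \<Rightarrow> 't::godel_enum"
  assumes "effective t" "effective C" "effective_op G"
  shows "semidecidable_op (\<lambda>g z. \<exists>y. t (fst z) = C y \<and> G g (fst z, y) = Some (snd z))"
  by (intro semidecidable_op_ex semidecidable_op_conj semidecidable_op_const
      semidecidable_op_graph[OF assms(3)] effective_intros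
      effective_compose[OF assms(1)] effective_compose[OF assms(2)])

lemma effective_op_case_option [effective_intros]:
  assumes "effective t" "effective_op A" "effective_op (\<lambda>g p. B g (fst p) (snd p))"
  shows "effective_op (\<lambda>g e. case t e of None \<Rightarrow> A g e | Some x \<Rightarrow> B g e x)"
  by (rule effective_opI[OF semidecidable_op_disj[OF
        semidecidable_op_constant_case[OF assms(1,2), of None]
        semidecidable_op_case[OF assms(1) _ assms(3), of Some]]];
      (intro effective_intros | force split: option.split))

lemma effective_op_case_nat [effective_intros]:
  assumes "effective t" "effective_op A" "effective_op (\<lambda>g p. B g (fst p) (snd p))"
  shows "effective_op (\<lambda>g e. case t e of 0 \<Rightarrow> A g e | Suc n \<Rightarrow> B g e n)"
  by (rule effective_opI[OF semidecidable_op_disj[OF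
        semidecidable_op_constant_case[OF assms(1,2), of 0]
        semidecidable_op_case[OF assms(1) _ assms(3), of Suc]]];
      (intro effective_intros | force split: nat.split))

lemma effective_op_case_list [effective_intros]:
  assumes "effective t" "effective_op A"
    "effective_op (\<lambda>g p. B g (fst p) (fst (snd p)) (snd (snd p)))"
  shows "effective_op (\<lambda>g e. case t e of [] \<Rightarrow> A g e | x # xs \<Rightarrow> B g e x xs)"
  by (rule effective_opI[OF semidecidable_op_disj[OF
        semidecidable_op_constant_case[OF assms(1,2), of "[]"]
        semidecidable_op_case[OF assms(1) _ assms(3), of "\<lambda>p. fst p # snd p"]]];
      (intro effective_intros | force split: list.split))

lemma effective_op_case_sum [effective_intros]:
  assumes "effective t" "effective_op (\<lambda>g p. A g (fst p) (snd p))"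
    "effective_op (\<lambda>g p. B g (fst p) (snd p))"
  shows "effective_op (\<lambda>g e. case t e of Inl x \<Rightarrow> A g e x | Inr y \<Rightarrow> B g e y)"
  by (rule effective_opI[OF semidecidable_op_disj[OF
        semidecidable_op_case[OF assms(1) _ assms(2), of Inl]
        semidecidable_op_case[OF assms(1) _ assms(3), of Inr]]];
      (intro effective_intros | force split: sum.split))

lemma effective_op_case_head [effective_intros]:
  assumes "effective t" "effective_op (\<lambda>g p. A g (fst p) (snd p))"
    "effective_op (\<lambda>g p. B g (fst p) (snd p))" "effective_op (\<lambda>g p. C g (fst p) (snd p))"
  shows "effective_op (\<lambda>g e. case t e of Var x \<Rightarrow> A g e x | Con c \<Rightarrow> B g e c | Rec r \<Rightarrow> C g e r)"
  by (rule effective_opI[OF semidecidable_op_disj[OF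
        semidecidable_op_case[OF assms(1) _ assms(2), of Var] semidecidable_op_disj[OF
        semidecidable_op_case[OF assms(1) _ assms(3), of Con]
        semidecidable_op_case[OF assms(1) _ assms(4), of Rec]]]];
      (intro effective_intros | force split: head.split))

lemma effective_op_case_tm [effective_intros]:
  assumes "effective t" "effective_op (\<lambda>g p. A g (fst p) (snd p))"
    "effective_op (\<lambda>g p. B g (fst p) (snd p))"
  shows "effective_op (\<lambda>g e. case t e of Neu R \<Rightarrow> A g e R | Lam M \<Rightarrow> B g e M)"
  by (rule effective_opI[OF semidecidable_op_disj[OF
        semidecidable_op_case[OF assms(1) _ assms(2), of Neu]
        semidecidable_op_case[OF assms(1) _ assms(3), of Lam]]];
      (intro effective_intros | force split: tm.split))

lemma effective_op_case_neu [effective_intros]: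
  assumes "effective t" "effective_op (\<lambda>g p. A g (fst p) (fst (snd p)) (snd (snd p)))"
  shows "effective_op (\<lambda>g e. case t e of App H S \<Rightarrow> A g e H S)"
  by (rule effective_opI[OF
        semidecidable_op_case[OF assms(1) _ assms(2), of "\<lambda>p. App (fst p) (snd p)"]];
      (intro effective_intros | force split: neu.split))

lemma effective_op_case_spine [effective_intros]:
  assumes "effective t" "effective_op A"
    "effective_op (\<lambda>g p. B g (fst p) (fst (snd p)) (snd (snd p)))"
    "effective_op (\<lambda>g p. C g (fst p) (fst (snd p)) (snd (snd p)))"
  shows "effective_op (\<lambda>g e. case t e of SNil \<Rightarrow> A g e | SArg M S \<Rightarrow> B g e M S
      | SPre y S \<Rightarrow> C g e y S)"
  by (rule effective_opI[OF semidecidable_op_disj[OF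
        semidecidable_op_constant_case[OF assms(1,2), of SNil] semidecidable_op_disj[OF
        semidecidable_op_case[OF assms(1) _ assms(3), of "\<lambda>p. SArg (fst p) (snd p)"]
        semidecidable_op_case[OF assms(1) _ assms(4), of "\<lambda>p. SPre (fst p) (snd p)"]]]];
      (intro effective_intros | force split: spine.split))

lemma effective_op_case_aty [effective_intros]:
  assumes "effective t" "effective_op (\<lambda>g p. A g (fst p) (fst (snd p)) (snd (snd p)))"
  shows "effective_op (\<lambda>g e. case t e of Fam a S \<Rightarrow> A g e a S)"
  by (rule effective_opI[OF
        semidecidable_op_case[OF assms(1) _ assms(2), of "\<lambda>p. Fam (fst p) (snd p)"]];
      (intro effective_intros | force split: aty.split))

lemma effective_op_case_ty [effective_intros]:
  assumes "effective t" "effective_op (\<lambda>g p. A g (fst p) (snd p))"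
    "effective_op (\<lambda>g p. B g (fst p) (fst (snd p)) (snd (snd p)))"
    "effective_op (\<lambda>g p. C g (fst p) (fst (snd p)) (snd (snd p)))"
  shows "effective_op (\<lambda>g e. case t e of Atom P \<Rightarrow> A g e P | Pi A2 A1 \<Rightarrow> B g e A2 A1
      | PrePi A2 A1 \<Rightarrow> C g e A2 A1)"
  by (rule effective_opI[OF semidecidable_op_disj[OF
        semidecidable_op_case[OF assms(1) _ assms(2), of Atom] semidecidable_op_disj[OF
        semidecidable_op_case[OF assms(1) _ assms(3), of "\<lambda>p. Pi (fst p) (snd p)"]
        semidecidable_op_case[OF assms(1) _ assms(4), of "\<lambda>p. PrePi (fst p) (snd p)"]]]];
      (intro effective_intros | force split: ty.split))

lemma effective_op_case_kind [effective_intros]: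
  assumes "effective t" "effective_op A" "effective_op B"
    "effective_op (\<lambda>g p. C g (fst p) (fst (snd p)) (snd (snd p)))"
    "effective_op (\<lambda>g p. D g (fst p) (fst (snd p)) (snd (snd p)))"
  shows "effective_op (\<lambda>g e. case t e of Type \<Rightarrow> A g e | Cotype \<Rightarrow> B g e | KPi A2 K \<Rightarrow> C g e A2 K
      | KPrePi A2 K \<Rightarrow> D g e A2 K)"
  by (rule effective_opI[OF semidecidable_op_disj[OF
        semidecidable_op_constant_case[OF assms(1,2), of Type] semidecidable_op_disj[OF
        semidecidable_op_constant_case[OF assms(1,3), of Cotype] semidecidable_op_disj[OF
        semidecidable_op_case[OF assms(1) _ assms(4), of "\<lambda>p. KPi (fst p) (snd p)"]
        semidecidable_op_case[OF assms(1) _ assms(5), of "\<lambda>p. KPrePi (fst p) (snd p)"]]]]];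
      (intro effective_intros | force split: kind.split))

lemma effective_op_case_decl [effective_intros]:
  assumes "effective t" "effective_op (\<lambda>g p. A g (fst p) (fst (snd p)) (snd (snd p)))"
    "effective_op (\<lambda>g p. B g (fst p) (fst (snd p)) (snd (snd p)))"
    "effective_op (\<lambda>g p. C g (fst p) (fst (snd p)) (fst (snd (snd p))) (snd (snd (snd p))))"
  shows "effective_op (\<lambda>g e. case t e of FamDecl a K \<Rightarrow> A g e a K | ConDecl c A \<Rightarrow> B g e c A
      | RecDecl r A M \<Rightarrow> C g e r A M)"
  by (rule effective_opI[OF semidecidable_op_disj[OF
        semidecidable_op_case[OF assms(1) _ assms(2), of "\<lambda>p. FamDecl (fst p) (snd p)"]
        semidecidable_op_disj[OF
        semidecidable_op_case[OF assms(1) _ assms(3), of "\<lambda>p. ConDecl (fst p) (snd p)"]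
        semidecidable_op_case[OF assms(1) _ assms(4),
          of "\<lambda>p. RecDecl (fst p) (fst (snd p)) (snd (snd p))"]]]];
      (intro effective_intros | force split: decl.split))

lemma effective_op_case_binding [effective_intros]:
  assumes "effective t" "effective_op (\<lambda>g p. A g (fst p) (snd p))"
    "effective_op (\<lambda>g p. B g (fst p) (snd p))"
  shows "effective_op (\<lambda>g e. case t e of Ord A' \<Rightarrow> A g e A' | Pre A' \<Rightarrow> B g e A')"
  by (rule effective_opI[OF semidecidable_op_disj[OF
        semidecidable_op_case[OF assms(1) _ assms(2), of Ord]
        semidecidable_op_case[OF assms(1) _ assms(3), of Pre]]];
      (intro effective_intros | force split: binding.split))

lemma effective_op_case_stp [effective_intros]:
  assumes "effective t" "effective_op A"
    "effective_op (\<lambda>g p. B g (fst p) (fst (snd p)) (snd (snd p)))"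
  shows "effective_op (\<lambda>g e. case t e of Base \<Rightarrow> A g e | Arr \<tau>2 \<tau>1 \<Rightarrow> B g e \<tau>2 \<tau>1)"
  by (rule effective_opI[OF semidecidable_op_disj[OF
        semidecidable_op_constant_case[OF assms(1,2), of Base]
        semidecidable_op_case[OF assms(1) _ assms(3), of "\<lambda>p. Arr (fst p) (snd p)"]]];
      (intro effective_intros | force split: stp.split))

lemma effective_case_prod [effective_intros]:
  "effective (\<lambda>e. F e (fst (t e)) (snd (t e))) \<Longrightarrow> effective (\<lambda>e. case t e of (x, y) \<Rightarrow> F e x y)"
  by (simp add: split_beta)

lemma effective_case_option [effective_intros]:
  fixes t :: "'e::godel_enum \<Rightarrow> 'x::godel_enum option"
  assumes "effective t" "effective A" "effective (\<lambda>p. B (fst p) (snd p))"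
  shows "effective (\<lambda>e. (case t e of None \<Rightarrow> A e | Some x \<Rightarrow> B e x) :: 'r::godel_enum)"
  using effective_op_case_option[OF assms(1) assms(2,3)[THEN effective_op_Some]]
  by (intro effective_if_effective_op) (simp add: option.case_distrib[of Some])

lemma effective_case_sum [effective_intros]:
  fixes t :: "'e::godel_enum \<Rightarrow> 'x::godel_enum + 'y::godel_enum"
  assumes "effective t" "effective (\<lambda>p. A (fst p) (snd p))" "effective (\<lambda>p. B (fst p) (snd p))"
  shows "effective (\<lambda>e. (case t e of Inl x \<Rightarrow> A e x | Inr y \<Rightarrow> B e y) :: 'r::godel_enum)"
  using effective_op_case_sum[OF assms(1) assms(2,3)[THEN effective_op_Some]]
  by (intro effective_if_effective_op) (simp add: sum.case_distrib[of Some])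

lemma effective_case_head [effective_intros]:
  fixes t :: "'e::godel_enum \<Rightarrow> head"
  assumes "effective t" "effective (\<lambda>p. A (fst p) (snd p))" "effective (\<lambda>p. B (fst p) (snd p))"
    "effective (\<lambda>p. C (fst p) (snd p))"
  shows "effective (\<lambda>e. (case t e of Var x \<Rightarrow> A e x | Con c \<Rightarrow> B e c
      | Rec r \<Rightarrow> C e r) :: 'r::godel_enum)"
  using effective_op_case_head[OF assms(1) assms(2-4)[THEN effective_op_Some]]
  by (intro effective_if_effective_op) (simp add: head.case_distrib[of Some])

lemma effective_case_tm [effective_intros]:
  fixes t :: "'e::godel_enum \<Rightarrow> tm"
  assumes "effective t" "effective (\<lambda>p. A (fst p) (snd p))" "effective (\<lambda>p. B (fst p) (snd p))"
  shows "effective (\<lambda>e. (case t e of Neu R \<Rightarrow> A e R | Lam M \<Rightarrow> B e M) :: 'r::godel_enum)"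
  using effective_op_case_tm[OF assms(1) assms(2,3)[THEN effective_op_Some]]
  by (intro effective_if_effective_op) (simp add: tm.case_distrib[of Some])

lemma effective_case_neu [effective_intros]:
  fixes t :: "'e::godel_enum \<Rightarrow> neu"
  assumes "effective t" "effective (\<lambda>p. A (fst p) (fst (snd p)) (snd (snd p)))"
  shows "effective (\<lambda>e. (case t e of App H S \<Rightarrow> A e H S) :: 'r::godel_enum)"
  using effective_op_case_neu[OF assms(1) assms(2)[THEN effective_op_Some]]
  by (intro effective_if_effective_op) (simp add: neu.case_distrib[of Some])

lemma effective_case_spine [effective_intros]:
  fixes t :: "'e::godel_enum \<Rightarrow> spine"
  assumes "effective t" "effective A" "effective (\<lambda>p. B (fst p) (fst (snd p)) (snd (snd p)))"
    "effective (\<lambda>p. C (fst p) (fst (snd p)) (snd (snd p)))"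
  shows "effective (\<lambda>e. (case t e of SNil \<Rightarrow> A e | SArg M S \<Rightarrow> B e M S
      | SPre y S \<Rightarrow> C e y S) :: 'r::godel_enum)"
  using effective_op_case_spine[OF assms(1) assms(2-4)[THEN effective_op_Some]]
  by (intro effective_if_effective_op) (simp add: spine.case_distrib[of Some])

lemma effective_case_aty [effective_intros]:
  fixes t :: "'e::godel_enum \<Rightarrow> aty"
  assumes "effective t" "effective (\<lambda>p. A (fst p) (fst (snd p)) (snd (snd p)))"
  shows "effective (\<lambda>e. (case t e of Fam a S \<Rightarrow> A e a S) :: 'r::godel_enum)"
  using effective_op_case_aty[OF assms(1) assms(2)[THEN effective_op_Some]]
  by (intro effective_if_effective_op) (simp add: aty.case_distrib[of Some])

lemma effective_case_decl [effective_intros]: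
  fixes t :: "'e::godel_enum \<Rightarrow> decl"
  assumes "effective t" "effective (\<lambda>p. A (fst p) (fst (snd p)) (snd (snd p)))"
    "effective (\<lambda>p. B (fst p) (fst (snd p)) (snd (snd p)))"
    "effective (\<lambda>p. C (fst p) (fst (snd p)) (fst (snd (snd p))) (snd (snd (snd p))))"
  shows "effective (\<lambda>e. (case t e of FamDecl a K \<Rightarrow> A e a K | ConDecl c A' \<Rightarrow> B e c A'
    | RecDecl r A' M \<Rightarrow> C e r A' M) :: 'r::godel_enum)"
  using effective_op_case_decl[OF assms(1) assms(2-4)[THEN effective_op_Some]]
  by (intro effective_if_effective_op) (simp add: decl.case_distrib[of Some])

lemma effective_case_binding [effective_intros]:
  fixes t :: "'e::godel_enum \<Rightarrow> binding"
  assumes "effective t" "effective (\<lambda>p. A (fst p) (snd p))" "effective (\<lambda>p. B (fst p) (snd p))"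
  shows "effective (\<lambda>e. (case t e of Ord A' \<Rightarrow> A e A' | Pre A' \<Rightarrow> B e A') :: 'r::godel_enum)"
  using effective_op_case_binding[OF assms(1) assms(2,3)[THEN effective_op_Some]]
  by (intro effective_if_effective_op) (simp add: binding.case_distrib[of Some])

lemma effective_if [effective_intros]:
  fixes b :: "'e::godel_enum \<Rightarrow> bool" and f g :: "'e \<Rightarrow> 'r::godel_enum"
  assumes "effective b" "effective f" "effective g"
  shows "effective (\<lambda>e. if b e then f e else g e)"
  using effective_op_if[OF assms(1) assms(2,3)[THEN effective_op_Some]]
  by (intro effective_if_effective_op) (simp add: if_distrib[of Some] cong: if_cong)

lemma effective_bind [effective_intros]:
  fixes f :: "'e::godel_enum \<Rightarrow> 'a::godel_enum option" and g :: "'e \<Rightarrow> 'a \<Rightarrow> 'b::godel_enum option"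
  assumes "effective f" "effective (\<lambda>p. g (fst p) (snd p))"
  shows "effective (\<lambda>e. Option.bind (f e) (\<lambda>y. g e y))"
proof -
  have "Option.bind (f e) (g e) = (case f e of None \<Rightarrow> None | Some y \<Rightarrow> g e y)" for e
    by (cases "f e") simp_all
  then show ?thesis by (simp add: effective_intros assms)
qed


subsection \<open>Decidable predicates\<close>

lemma effective_imp_semidecidable: "effective P \<Longrightarrow> semidecidable (\<lambda>x. P x)"
  using semidecidable_eq[of P "\<lambda>x. True"] effective_const[of True] by simp

lemma effective_imp_semidecidable_not: "effective P \<Longrightarrow> semidecidable (\<lambda>x. \<not> P x)"
  using semidecidable_eq[of P "\<lambda>x. False"] effective_const[of False] by simp

lemma effective_if_semidecidable:
  assumes "semidecidable P" "semidecidable (\<lambda>x. \<not> P x)"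
  shows "effective P"
proof -
  have "semidecidable (\<lambda>p. P (fst p) \<and> snd p = True \<or> \<not> P (fst p) \<and> snd p = False)"
    by (intro semidecidable_disj semidecidable_conj semidecidable_eq_tracked tracked_intros
        semidecidable_tracked[OF assms(1)] semidecidable_tracked[OF assms(2)])
  moreover have "P (fst p) \<and> snd p = True \<or> \<not> P (fst p) \<and> snd p = False \<longleftrightarrow> P (fst p) = snd p" for p
    by auto
  ultimately show ?thesis unfolding effective_def by simp
qed

lemma effective_imp_decidable: "effective P \<Longrightarrow> decidable P"
  using effective_imp_computable[of P] by (simp add: computable_def decidable_def gcode_bool_def)

lemma effective_eq [effective_intros]:
  fixes f g :: "'e::godel \<Rightarrow> 'a::godel_enum"
  shows "effective f \<Longrightarrow> effective g \<Longrightarrow> effective (\<lambda>x. f x = g x)"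
  by (intro effective_if_semidecidable semidecidable_eq semidecidable_neq)

lemma effective_not [effective_intros]: "effective P \<Longrightarrow> effective (\<lambda>x. \<not> P x)"
  by (intro effective_if_semidecidable)
    (simp_all add: effective_imp_semidecidable effective_imp_semidecidable_not)

lemma effective_conj [effective_intros]:
  "effective P \<Longrightarrow> effective Q \<Longrightarrow> effective (\<lambda>x. P x \<and> Q x)"
  by (rule effective_if_semidecidable, unfold de_Morgan_conj)
    (intro semidecidable_conj semidecidable_disj effective_imp_semidecidable
      effective_imp_semidecidable_not; assumption)+

lemma effective_disj [effective_intros]:
  "effective P \<Longrightarrow> effective Q \<Longrightarrow> effective (\<lambda>x. P x \<or> Q x)"
  by (rule effective_if_semidecidable, unfold de_Morgan_disj)
    (intro semidecidable_conj semidecidable_disj effective_imp_semidecidable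
      effective_imp_semidecidable_not; assumption)+

lemma effective_imp [effective_intros]:
  "effective P \<Longrightarrow> effective Q \<Longrightarrow> effective (\<lambda>x. P x \<longrightarrow> Q x)"
  unfolding imp_conv_disj by (intro effective_intros)

lemma effective_less [effective_intros]:
  fixes f g :: "'e::godel \<Rightarrow> nat"
  shows "effective f \<Longrightarrow> effective g \<Longrightarrow> effective (\<lambda>x. f x < g x)"
  using semidecidable_less[of f g] semidecidable_less[of g "\<lambda>x. Suc (f x)"]
  by (intro effective_if_semidecidable)
    (simp_all add: not_less less_Suc_eq_le[symmetric] effective_Suc)

lemma effective_le [effective_intros]:
  fixes f g :: "'e::godel \<Rightarrow> nat"
  shows "effective f \<Longrightarrow> effective g \<Longrightarrow> effective (\<lambda>x. f x \<le> g x)"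
  unfolding less_Suc_eq_le[symmetric] by (intro effective_intros)


subsection \<open>Application and recursion with several arguments\<close>

lemma effective_app2:
  fixes f :: "'a::godel_enum \<Rightarrow> 'b::godel_enum \<Rightarrow> 'r::godel"
  assumes "effective (\<lambda>(x, y). f x y)" "effective a" "effective b"
  shows "effective (\<lambda>e. f (a e) (b e))"
  using effective_compose[OF assms(1), of "\<lambda>e. (a e, b e)"] assms by (simp add: effective_Pair)

lemma effective_app3:
  fixes f :: "'a::godel_enum \<Rightarrow> 'b::godel_enum \<Rightarrow> 'c::godel_enum \<Rightarrow> 'r::godel"
  assumes "effective (\<lambda>(x, y, z). f x y z)" "effective a" "effective b" "effective c"
  shows "effective (\<lambda>e. f (a e) (b e) (c e))"
  using effective_compose[OF assms(1), of "\<lambda>e. (a e, b e, c e)"] assms by (simp add: effective_Pair)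

lemma effective_app4:
  fixes f :: "'a::godel_enum \<Rightarrow> 'b::godel_enum \<Rightarrow> 'c::godel_enum \<Rightarrow> 'd::godel_enum \<Rightarrow> 'r::godel"
  assumes "effective (\<lambda>(x, y, z, u). f x y z u)" "effective a" "effective b" "effective c"
    "effective d"
  shows "effective (\<lambda>e. f (a e) (b e) (c e) (d e))"
  using effective_compose[OF assms(1), of "\<lambda>e. (a e, b e, c e, d e)"] assms
  by (simp add: effective_Pair)

lemma effective_app5:
  fixes f :: "'a::godel_enum \<Rightarrow> 'b::godel_enum \<Rightarrow> 'c::godel_enum \<Rightarrow> 'd::godel_enum \<Rightarrow>
    'e::godel_enum \<Rightarrow> 'r::godel"
  assumes "effective (\<lambda>(x, y, z, u, v). f x y z u v)"
    "effective a" "effective b" "effective c" "effective d" "effective k"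
  shows "effective (\<lambda>e. f (a e) (b e) (c e) (d e) (k e))"
  using effective_compose[OF assms(1), of "\<lambda>e. (a e, b e, c e, d e, k e)"] assms
  by (simp add: effective_Pair)

lemma effective_app6:
  fixes f :: "'a::godel_enum \<Rightarrow> 'b::godel_enum \<Rightarrow> 'c::godel_enum \<Rightarrow> 'd::godel_enum \<Rightarrow>
    'e::godel_enum \<Rightarrow> 'f::godel_enum \<Rightarrow> 'r::godel"
  assumes "effective (\<lambda>(x, y, z, u, v, w). f x y z u v w)"
    "effective a" "effective b" "effective c" "effective d" "effective k" "effective l"
  shows "effective (\<lambda>e. f (a e) (b e) (c e) (d e) (k e) (l e))"
  using effective_compose[OF assms(1), of "\<lambda>e. (a e, b e, c e, d e, k e, l e)"] assms
  by (simp add: effective_Pair)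

lemma effective_rec1:
  assumes "effective_op F" "\<And>h x. (\<And>z. h z = F h z) \<Longrightarrow> h x = Some (f x)" "effective a"
  shows "effective (\<lambda>e. f (a e))"
  by (rule effective_compose[OF effective_rec[OF assms(1) effective_id] assms(3)], rule assms(2))

lemma effective_rec2:
  assumes "effective_op F" "\<And>h x y. (\<And>z. h z = F h z) \<Longrightarrow> h (x, y) = Some (f x y)"
    "effective a" "effective b"
  shows "effective (\<lambda>e. f (a e) (b e))"
proof (rule effective_app2[OF effective_rec[OF assms(1) effective_id] assms(3,4)])
  fix h p assume "\<And>z. h z = F h z"
  from assms(2)[OF this] show "h p = Some (case p of (x, y) \<Rightarrow> f x y)" by (cases p) simp
qed

lemma effective_rec3:
  assumes "effective_op F" "\<And>h x y u. (\<And>z. h z = F h z) \<Longrightarrow> h (x, y, u) = Some (f x y u)"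
    "effective a" "effective b" "effective c"
  shows "effective (\<lambda>e. f (a e) (b e) (c e))"
proof (rule effective_app3[OF effective_rec[OF assms(1) effective_id] assms(3-5)])
  fix h p assume "\<And>z. h z = F h z"
  from assms(2)[OF this] show "h p = Some (case p of (x, y, u) \<Rightarrow> f x y u)" by (cases p) simp
qed

lemma effective_rec4:
  assumes "effective_op F" "\<And>h x y u v. (\<And>z. h z = F h z) \<Longrightarrow> h (x, y, u, v) = Some (f x y u v)"
    "effective a" "effective b" "effective c" "effective d"
  shows "effective (\<lambda>e. f (a e) (b e) (c e) (d e))"
proof (rule effective_app4[OF effective_rec[OF assms(1) effective_id] assms(3-6)])
  fix h p assume "\<And>z. h z = F h z"
  from assms(2)[OF this] show "h p = Some (case p of (x, y, u, v) \<Rightarrow> f x y u v)" by (cases p) simp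
qed

lemma effective_rec5:
  assumes "effective_op F"
    "\<And>h x y u v w. (\<And>z. h z = F h z) \<Longrightarrow> h (x, y, u, v, w) = Some (f x y u v w)"
    "effective a" "effective b" "effective c" "effective d" "effective k"
  shows "effective (\<lambda>e. f (a e) (b e) (c e) (d e) (k e))"
proof (rule effective_app5[OF effective_rec[OF assms(1) effective_id] assms(3-7)])
  fix h p assume "\<And>z. h z = F h z"
  from assms(2)[OF this] show "h p = Some (case p of (x, y, u, v, w) \<Rightarrow> f x y u v w)"
    by (cases p) simp
qed

lemma effective_rec6:
  assumes "effective_op F"
    "\<And>h x y u v w s. (\<And>z. h z = F h z) \<Longrightarrow> h (x, y, u, v, w, s) = Some (f x y u v w s)"
    "effective a" "effective b" "effective c" "effective d" "effective k" "effective l"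
  shows "effective (\<lambda>e. f (a e) (b e) (c e) (d e) (k e) (l e))"
proof (rule effective_app6[OF effective_rec[OF assms(1) effective_id] assms(3-8)])
  fix h p assume "\<And>z. h z = F h z"
  from assms(2)[OF this] show "h p = Some (case p of (x, y, u, v, w, s) \<Rightarrow> f x y u v w s)"
    by (cases p) simp
qed


subsection \<open>Lists\<close>

lemma effective_length [effective_intros]:
  fixes f :: "'e::godel \<Rightarrow> 'a::godel_enum list"
  assumes "effective f"
  shows "effective (\<lambda>e. length (f e))"
proof (rule effective_rec1[OF _ _ assms])
  let ?F = "\<lambda>h xs :: 'a list. case xs of [] \<Rightarrow> Some 0 | x # xs \<Rightarrow> do { n \<leftarrow> h xs; Some (Suc n) }"
  show "effective_op ?F" by (intro effective_intros)
  show "h xs = Some (length xs)" if "\<And>xs. h xs = ?F h xs" for h xs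
    by (induction xs) (subst that, simp)+
qed

lemma effective_append [effective_intros]:
  fixes f g :: "'e::godel \<Rightarrow> 'a::godel_enum list"
  assumes "effective f" "effective g"
  shows "effective (\<lambda>e. f e @ g e)"
proof (rule effective_rec2[OF _ _ assms])
  let ?F = "\<lambda>h (xs, ys :: 'a list). case xs of [] \<Rightarrow> Some ys
      | x # xs \<Rightarrow> do { zs \<leftarrow> h (xs, ys); Some (x # zs) }"
  show "effective_op ?F" by (intro effective_intros)
  show "h (xs, ys) = Some (xs @ ys)" if "\<And>z. h z = ?F h z" for h xs ys
    by (induction xs) (subst that, simp)+
qed

lemma effective_zip [effective_intros]:
  fixes f :: "'e::godel \<Rightarrow> 'a::godel_enum list" and g :: "'e \<Rightarrow> 'b::godel_enum list"
  assumes "effective f" "effective g"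
  shows "effective (\<lambda>e. zip (f e) (g e))"
proof (rule effective_rec2[OF _ _ assms])
  let ?F = "\<lambda>h (xs :: 'a list, ys :: 'b list). case xs of [] \<Rightarrow> Some []
      | x # xs \<Rightarrow> (case ys of [] \<Rightarrow> Some []
    | y # ys \<Rightarrow> do { zs \<leftarrow> h (xs, ys); Some ((x, y) # zs) })"
  show "effective_op ?F" by (intro effective_intros)
  show "h (xs, ys) = Some (zip xs ys)" if "\<And>z. h z = ?F h z" for h xs ys
    by (induction xs ys rule: list_induct2') (subst that, simp)+
qed

definition nth_option :: "'a list \<Rightarrow> nat \<Rightarrow> 'a option" where
  "nth_option xs i = (if i < length xs then Some (xs ! i) else None)"

lemma effective_nth_option [effective_intros]:
  fixes f :: "'e::godel \<Rightarrow> 'a::godel_enum list"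
  assumes "effective f" "effective g"
  shows "effective (\<lambda>e. nth_option (f e) (g e))"
proof (rule effective_rec2[OF _ _ assms])
  let ?F = "\<lambda>h (xs :: 'a list, i). case xs of [] \<Rightarrow> Some None
    | x # xs \<Rightarrow> (case i of 0 \<Rightarrow> Some (Some x) | Suc i \<Rightarrow> h (xs, i))"
  show "effective_op ?F" by (intro effective_intros)
  show "h (xs, i) = Some (nth_option xs i)" if "\<And>z. h z = ?F h z" for h xs i
    by (induction xs arbitrary: i) (subst that, simp add: nth_option_def split: nat.split)+
qed

lemma effective_concat_map:
  fixes k :: "'e::godel_enum \<Rightarrow> 'a::godel_enum \<Rightarrow> 'b::godel_enum list"
  assumes k: "effective (\<lambda>p. k (fst p) (snd p))" and f: "effective f"
  shows "effective (\<lambda>e. concat (map (k e) (f e)))"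
proof (rule effective_rec2[OF _ _ effective_id f, of _ "\<lambda>e xs. concat (map (k e) xs)"])
  let ?F = "\<lambda>h (e, xs). case xs of [] \<Rightarrow> Some [] | x # xs \<Rightarrow> do { zs \<leftarrow> h (e, xs); Some (k e x @ zs) }"
  show "effective_op ?F" by (intro effective_intros effective_app2[OF k[folded split_beta]])
  show "h (e, xs) = Some (concat (map (k e) xs))" if "\<And>z. h z = ?F h z" for h e xs
    by (induction xs) (subst that, simp)+
qed

lemma effective_map:
  fixes k :: "'e::godel_enum \<Rightarrow> 'a::godel_enum \<Rightarrow> 'b::godel_enum"
  assumes "effective (\<lambda>p. k (fst p) (snd p))" "effective f"
  shows "effective (\<lambda>e. map (k e) (f e))"
  using effective_concat_map[of "\<lambda>e x. [k e x]", OF _ assms(2)] assms(1)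
  by (simp add: effective_intros)

lemma effective_list_all:
  fixes P :: "'e::godel_enum \<Rightarrow> 'a::godel_enum \<Rightarrow> bool"
  assumes P: "effective (\<lambda>p. P (fst p) (snd p))" and f: "effective f"
  shows "effective (\<lambda>e. \<forall>x\<in>set (f e). P e x)"
proof (rule effective_rec2[OF _ _ effective_id f, of _ "\<lambda>e xs. \<forall>x\<in>set xs. P e x"])
  let ?F = "\<lambda>h (e, xs). case xs of [] \<Rightarrow> Some True
      | x # xs \<Rightarrow> if P e x then h (e, xs) else Some False"
  show "effective_op ?F" by (intro effective_intros effective_app2[OF P[folded split_beta]])
  show "h (e, xs) = Some (\<forall>x\<in>set xs. P e x)" if "\<And>z. h z = ?F h z" for h e xs
    by (induction xs) (subst that, simp)+
qed

lemma effective_list_ex: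
  fixes P :: "'e::godel_enum \<Rightarrow> 'a::godel_enum \<Rightarrow> bool"
  assumes "effective (\<lambda>p. P (fst p) (snd p))" "effective f"
  shows "effective (\<lambda>e. \<exists>x\<in>set (f e). P e x)"
  using effective_not[OF effective_list_all[of "\<lambda>e x. \<not> P e x",
      OF effective_not[OF assms(1)] assms(2)]]
  by simp

lemma effective_in_set [effective_intros]:
  fixes f :: "'e::godel_enum \<Rightarrow> 'a::godel_enum"
  assumes "effective f" "effective g"
  shows "effective (\<lambda>e. f e \<in> set (g e))"
proof -
  have "effective (\<lambda>e. \<exists>x\<in>set (g e). f e = x)"
    by (intro effective_list_ex effective_intros assms(2) effective_compose[OF assms(1)])
  then show ?thesis by simp
qed

lemma effective_insert [effective_intros]:
  fixes f :: "'e::godel_enum \<Rightarrow> 'a::godel_enum"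
  shows "effective f \<Longrightarrow> effective g \<Longrightarrow> effective (\<lambda>e. List.insert (f e) (g e))"
  by (rule effective_app2) (unfold List.insert_def, intro effective_intros)


section \<open>Effectiveness of the syntactic operations\<close>

lemma spine_induct [case_names SNil SArg SPre]:
  assumes "P SNil" "\<And>M S. P S \<Longrightarrow> P (SArg M S)" "\<And>y S. P S \<Longrightarrow> P (SPre y S)"
  shows "P S"
  by (rule spine.induct[of "\<lambda>_. True" "\<lambda>_. True"]) (use assms in auto)

lemma tm_induct [case_names Neu Lam]:
  assumes "\<And>R. P (Neu R)" "\<And>M. P M \<Longrightarrow> P (Lam M)"
  shows "P M"
  by (rule tm.induct[of "\<lambda>_. True" _ "\<lambda>_. True"]) (use assms in auto)

definition syn_tm :: "syn \<Rightarrow> tm option" where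
  "syn_tm z = (case z of Inl M \<Rightarrow> Some M | Inr w \<Rightarrow> None)"

definition syn_neu :: "syn \<Rightarrow> neu option" where
  "syn_neu z = (case z of Inl M \<Rightarrow> None | Inr w \<Rightarrow> (case w of Inl R \<Rightarrow> Some R | Inr S \<Rightarrow> None))"

definition syn_spine :: "syn \<Rightarrow> spine option" where
  "syn_spine z = (case z of Inl M \<Rightarrow> None | Inr w \<Rightarrow> (case w of Inl R \<Rightarrow> None | Inr S \<Rightarrow> Some S))"

lemma syn_simps [simp]:
  "syn_tm (Inl M) = Some M" "syn_neu (Inr (Inl R)) = Some R" "syn_spine (Inr (Inr S)) = Some S"
  by (simp_all add: syn_tm_def syn_neu_def syn_spine_def)

lemma effective_op_syn [effective_intros]:
  assumes "effective t"
  shows "effective_op (\<lambda>g e. syn_tm (t e))" "effective_op (\<lambda>g e. syn_neu (t e))"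
    "effective_op (\<lambda>g e. syn_spine (t e))"
  unfolding syn_tm_def syn_neu_def syn_spine_def by (intro effective_intros assms)+


subsection \<open>Renaming\<close>

definition upn :: "nat \<Rightarrow> (nat \<Rightarrow> nat) \<Rightarrow> nat \<Rightarrow> nat" where
  "upn d \<rho> x = (if x < d then x else d + \<rho> (x - d))"

lemma upn_0 [simp]: "upn 0 \<rho> = \<rho>"
  by (simp add: upn_def fun_eq_iff)

lemma up_upn [simp]: "up (upn d \<rho>) = upn (Suc d) \<rho>"
  by (auto simp: up_def upn_def fun_eq_iff split: nat.split)

lemma effective_upn [effective_intros]:
  fixes \<rho> :: "'e::godel_enum \<Rightarrow> nat \<Rightarrow> nat"
  assumes "effective d" "effective (\<lambda>p. \<rho> (fst p) (snd p))" "effective x"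
  shows "effective (\<lambda>e. upn (d e) (\<rho> e) (x e))"
  unfolding upn_def
  by (intro effective_intros assms effective_app2[OF assms(2)[folded split_beta]])

lemma ren_head_eq_case:
  "ren_head \<rho> H = (case H of Var x \<Rightarrow> Var (\<rho> x) | Con c \<Rightarrow> Con c | Rec r \<Rightarrow> Rec r)"
  by (cases H) simp_all

lemma effective_ren_head [effective_intros]:
  fixes \<rho> :: "'e::godel_enum \<Rightarrow> nat \<Rightarrow> nat"
  assumes "effective (\<lambda>p. \<rho> (fst p) (snd p))" "effective H"
  shows "effective (\<lambda>e. ren_head (\<rho> e) (H e))"
  unfolding ren_head_eq_case by (intro effective_intros assms)

definition ren_op ::
    "('e \<Rightarrow> nat \<Rightarrow> nat) \<Rightarrow> ('e \<times> nat \<times> syn \<Rightarrow> syn option) \<Rightarrow> 'e \<times> nat \<times> syn \<Rightarrow> syn option" where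
  "ren_op \<rho> h = (\<lambda>(e, d, z). case z of
      Inl M \<Rightarrow> (case M of
          Neu R \<Rightarrow> do { r \<leftarrow> h (e, d, Inr (Inl R)); R' \<leftarrow> syn_neu r; Some (Inl (Neu R')) }
        | Lam M \<Rightarrow> do { r \<leftarrow> h (e, Suc d, Inl M); M' \<leftarrow> syn_tm r; Some (Inl (Lam M')) })
    | Inr w \<Rightarrow> (case w of
          Inl R \<Rightarrow> (case R of App H S \<Rightarrow> do {
            r \<leftarrow> h (e, d, Inr (Inr S)); S' \<leftarrow> syn_spine r;
            Some (Inr (Inl (App (ren_head (upn d (\<rho> e)) H) S'))) })
        | Inr S \<Rightarrow> (case S of
              SNil \<Rightarrow> Some (Inr (Inr SNil))
            | SArg M S \<Rightarrow> do {
                r \<leftarrow> h (e, d, Inl M); M' \<leftarrow> syn_tm r; r \<leftarrow> h (e, d, Inr (Inr S)); S' \<leftarrow> syn_spine r;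
                Some (Inr (Inr (SArg M' S'))) }
            | SPre y S \<Rightarrow> do {
                r \<leftarrow> h (e, d, Inr (Inr S)); S' \<leftarrow> syn_spine r;
                Some (Inr (Inr (SPre (upn d (\<rho> e) y) S'))) })))"

lemma ren_op_fixpoint:
  assumes h: "\<And>z. h z = ren_op \<rho> h z"
  shows "h (e, d, Inl M) = Some (Inl (ren_tm M (upn d (\<rho> e))))"
    and "h (e, d, Inr (Inl R)) = Some (Inr (Inl (ren_neu R (upn d (\<rho> e)))))"
    and "h (e, d, Inr (Inr S)) = Some (Inr (Inr (ren_spine S (upn d (\<rho> e)))))"
  by (induction M and R and S arbitrary: d and d and d) (subst h, simp add: ren_op_def)+

context
  fixes \<rho> :: "'e::godel_enum \<Rightarrow> nat \<Rightarrow> nat"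
  assumes \<rho>: "effective (\<lambda>p. \<rho> (fst p) (snd p))"
begin

lemma effective_op_ren: "effective_op (ren_op \<rho>)"
  unfolding ren_op_def by (intro effective_intros effective_app2[OF \<rho>[folded split_beta]])

lemma effective_ren_tm [effective_intros]:
  assumes "effective M"
  shows "effective (\<lambda>e. ren_tm (M e) (\<rho> e))"
proof (rule effective_rec_inj[OF effective_op_ren])
  show "effective (\<lambda>M. Inl M :: syn)" by (intro effective_intros)
  show "effective (\<lambda>e. (e, 0 :: nat, Inl (M e) :: syn))" by (intro effective_intros assms)
qed (simp add: inj_def, rule ren_op_fixpoint(1)[where d = 0, simplified])

lemma effective_ren_neu [effective_intros]:
  assumes "effective R"
  shows "effective (\<lambda>e. ren_neu (R e) (\<rho> e))"
proof (rule effective_rec_inj[OF effective_op_ren])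
  show "effective (\<lambda>R. Inr (Inl R) :: syn)" by (intro effective_intros)
  show "effective (\<lambda>e. (e, 0 :: nat, Inr (Inl (R e)) :: syn))" by (intro effective_intros assms)
qed (simp add: inj_def, rule ren_op_fixpoint(2)[where d = 0, simplified])

lemma effective_ren_spine [effective_intros]:
  assumes "effective S"
  shows "effective (\<lambda>e. ren_spine (S e) (\<rho> e))"
proof (rule effective_rec_inj[OF effective_op_ren])
  show "effective (\<lambda>S. Inr (Inr S) :: syn)" by (intro effective_intros)
  show "effective (\<lambda>e. (e, 0 :: nat, Inr (Inr (S e)) :: syn))" by (intro effective_intros assms)
qed (simp add: inj_def, rule ren_op_fixpoint(3)[where d = 0, simplified])

end

lemma ren_aty_eq_case: "ren_aty P \<rho> = (case P of Fam a S \<Rightarrow> Fam a (ren_spine S \<rho>))"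
  by (cases P) simp

lemma effective_ren_aty [effective_intros]:
  fixes \<rho> :: "'e::godel_enum \<Rightarrow> nat \<Rightarrow> nat"
  assumes \<rho>: "effective (\<lambda>p. \<rho> (fst p) (snd p))" and P: "effective P"
  shows "effective (\<lambda>e. ren_aty (P e) (\<rho> e))"
  unfolding ren_aty_eq_case by (intro effective_intros P effective_app2[OF \<rho>[folded split_beta]])

lemma effective_ren_ty [effective_intros]:
  fixes \<rho> :: "'e::godel_enum \<Rightarrow> nat \<Rightarrow> nat"
  assumes \<rho>: "effective (\<lambda>p. \<rho> (fst p) (snd p))" and A: "effective A"
  shows "effective (\<lambda>e. ren_ty (A e) (\<rho> e))"
proof -
  let ?F = "\<lambda>h (e, d, A). case A of
      Atom P \<Rightarrow> Some (Atom (ren_aty P (upn d (\<rho> e))))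
    | Pi A2 A1 \<Rightarrow> do { A2' \<leftarrow> h (e, d, A2); A1' \<leftarrow> h (e, Suc d, A1); Some (Pi A2' A1') }
    | PrePi A2 A1 \<Rightarrow> do { A2' \<leftarrow> h (e, d, A2); A1' \<leftarrow> h (e, Suc d, A1); Some (PrePi A2' A1') }"
  have "effective (\<lambda>e. ren_ty (A e) (upn 0 (\<rho> e)))"
  proof (rule effective_rec3[OF _ _ effective_id effective_const A,
        of _ "\<lambda>e d A. ren_ty A (upn d (\<rho> e))"])
    show "effective_op ?F" by (intro effective_intros effective_app2[OF \<rho>[folded split_beta]])
    show "h (e, d, A) = Some (ren_ty A (upn d (\<rho> e)))" if "\<And>z. h z = ?F h z" for h e d A
      by (induction A arbitrary: d) (subst that, simp)+
  qed
  then show ?thesis by simp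
qed

lemma effective_ren_kind [effective_intros]:
  fixes \<rho> :: "'e::godel_enum \<Rightarrow> nat \<Rightarrow> nat"
  assumes \<rho>: "effective (\<lambda>p. \<rho> (fst p) (snd p))" and K: "effective K"
  shows "effective (\<lambda>e. ren_kind (K e) (\<rho> e))"
proof -
  let ?F = "\<lambda>h (e, d, K). case K of
      Type \<Rightarrow> Some Type
    | Cotype \<Rightarrow> Some Cotype
    | KPi A K \<Rightarrow> do { K' \<leftarrow> h (e, Suc d, K); Some (KPi (ren_ty A (upn d (\<rho> e))) K') }
    | KPrePi A K \<Rightarrow> do { K' \<leftarrow> h (e, Suc d, K); Some (KPrePi (ren_ty A (upn d (\<rho> e))) K') }"
  have "effective (\<lambda>e. ren_kind (K e) (upn 0 (\<rho> e)))"
  proof (rule effective_rec3[OF _ _ effective_id effective_const K,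
        of _ "\<lambda>e d K. ren_kind K (upn d (\<rho> e))"])
    show "effective_op ?F" by (intro effective_intros effective_app2[OF \<rho>[folded split_beta]])
    show "h (e, d, K) = Some (ren_kind K (upn d (\<rho> e)))" if "\<And>z. h z = ?F h z" for h e d K
      by (induction K arbitrary: d) (subst that, simp)+
  qed
  then show ?thesis by simp
qed

lemma inst_eq_if: "inst y i = (if i = 0 then y else i - 1)"
  by (cases i) (simp_all add: inst_def)

lemma effective_inst [effective_intros]:
  "effective y \<Longrightarrow> effective i \<Longrightarrow> effective (\<lambda>e. inst (y e) (i e))"
  by (rule effective_app2) (unfold inst_eq_if, intro effective_intros)


subsection \<open>Hereditary substitution\<close>

lemma effective_erase [effective_intros]:
  assumes "effective A"
  shows "effective (\<lambda>e. erase (A e))"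
proof (rule effective_rec1[OF _ _ assms])
  let ?F = "\<lambda>h A. case A of
      Atom P \<Rightarrow> Some Base
    | Pi A2 A1 \<Rightarrow> do { \<tau>2 \<leftarrow> h A2; \<tau>1 \<leftarrow> h A1; Some (Arr \<tau>2 \<tau>1) }
    | PrePi A2 A1 \<Rightarrow> do { \<tau>1 \<leftarrow> h A1; Some (Arr Base \<tau>1) }"
  show "effective_op ?F" by (intro effective_intros)
  show "h A = Some (erase A)" if "\<And>A. h A = ?F h A" for h A
    by (induction A) (subst that, simp)+
qed

lemma effective_drop_var [effective_intros]:
  "effective f \<Longrightarrow> effective g \<Longrightarrow> effective (\<lambda>e. drop_var (f e) (g e))"
  by (rule effective_app2) (unfold drop_var_def, intro effective_intros)

text \<open>Operators for partial functions return \<open>None\<close> if the computation diverges and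
  \<open>Some None\<close> if it terminates without a result.\<close>

definition bind_result :: "'a option option \<Rightarrow> ('a \<Rightarrow> 'b option option) \<Rightarrow> 'b option option" where
  "bind_result m k = Option.bind m (\<lambda>r. case r of None \<Rightarrow> Some None | Some v \<Rightarrow> k v)"

lemma bind_result_simps [simp]:
  "bind_result None k = None" "bind_result (Some None) k = Some None"
  "bind_result (Some (Some v)) k = k v"
  by (simp_all add: bind_result_def)

lemma bind_result_Some [simp]: "bind_result (Some m) (\<lambda>x. Some (f x)) = Some (Option.bind m f)"
  by (cases m) simp_all

lemma effective_op_bind_result [effective_intros]:
  fixes F :: "('a::godel_enum \<Rightarrow> 'b::godel_enum option) \<Rightarrow>
      'e::godel_enum \<Rightarrow> 'c::godel_enum option option"
    and G :: "('a \<Rightarrow> 'b option) \<Rightarrow> 'e \<Rightarrow> 'c \<Rightarrow> 'd::godel_enum option option"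
  assumes "effective_op F" "effective_op (\<lambda>g p. G g (fst p) (snd p))"
  shows "effective_op (\<lambda>g e. bind_result (F g e) (\<lambda>c. G g e c))"
  unfolding bind_result_def
proof (intro effective_op_bind effective_op_case_option effective_intros assms)
  let ?t = "\<lambda>p :: ('e \<times> 'c option) \<times> 'c. (fst (fst p), snd p)"
  show "effective_op (\<lambda>g p :: ('e \<times> 'c option) \<times> 'c. G g (fst (fst p)) (snd p))"
    using semidecidable_op_graph[OF assms(2), of "\<lambda>z. ?t (fst z)" snd]
    by (simp add: effective_op_def effective_intros)
qed

type_synonym hsub_input = "(stp \<times> nat \<times> tm \<times> syn) + (stp \<times> spine \<times> tm)"

definition hsub_op :: "(hsub_input \<Rightarrow> syn option option) \<Rightarrow> hsub_input \<Rightarrow> syn option option" where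
  "hsub_op h q = (case q of
      Inl (\<tau>, x, N, z) \<Rightarrow> (case z of
          Inl M \<Rightarrow> (case M of
              Neu R \<Rightarrow> bind_result (h (Inl (\<tau>, x, N, Inr (Inl R)))) (\<lambda>r. do {
                R' \<leftarrow> syn_neu r; Some (Some (Inl (Neu R'))) })
            | Lam M \<Rightarrow> bind_result (h (Inl (\<tau>, Suc x, ren_tm N Suc, Inl M))) (\<lambda>r. do {
                M' \<leftarrow> syn_tm r; Some (Some (Inl (Lam M'))) }))
        | Inr w \<Rightarrow> (case w of
              Inl R \<Rightarrow> (case R of App H S \<Rightarrow> bind_result (h (Inl (\<tau>, x, N, Inr (Inr S)))) (\<lambda>r. do {
                S' \<leftarrow> syn_spine r;
                if H = Var x then h (Inr (\<tau>, S', N))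
                else Some (Some (Inr (Inl (App (ren_head (drop_var x) H) S')))) }))
            | Inr S \<Rightarrow> (case S of
                  SNil \<Rightarrow> Some (Some (Inr (Inr SNil)))
                | SArg M S \<Rightarrow> bind_result (h (Inl (\<tau>, x, N, Inl M))) (\<lambda>r.
                    bind_result (h (Inl (\<tau>, x, N, Inr (Inr S)))) (\<lambda>s. do {
                      M' \<leftarrow> syn_tm r; S' \<leftarrow> syn_spine s; Some (Some (Inr (Inr (SArg M' S')))) }))
                | SPre y S \<Rightarrow> if y = x then Some None
                    else bind_result (h (Inl (\<tau>, x, N, Inr (Inr S)))) (\<lambda>r. do {
                      S' \<leftarrow> syn_spine r; Some (Some (Inr (Inr (SPre (drop_var x y) S')))) }))))
    | Inr (\<tau>, S, M) \<Rightarrow> (case \<tau> of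
          Base \<Rightarrow> (case S of
              SNil \<Rightarrow> (case M of Neu R \<Rightarrow> Some (Some (Inr (Inl R))) | Lam M \<Rightarrow> Some None)
            | SArg N S \<Rightarrow> Some None
            | SPre y S \<Rightarrow> Some None)
        | Arr \<tau>2 \<tau>1 \<Rightarrow> (case M of
              Neu R \<Rightarrow> Some None
            | Lam M \<Rightarrow> (case S of
                  SNil \<Rightarrow> Some None
                | SArg N S \<Rightarrow> bind_result (h (Inl (\<tau>2, 0, N, Inl M))) (\<lambda>r. do {
                    M' \<leftarrow> syn_tm r; h (Inr (\<tau>1, S, M')) })
                | SPre y S \<Rightarrow> if \<tau>2 = Base then h (Inr (\<tau>1, S, ren_tm M (inst y)))
                  else Some None))))"

lemma effective_op_hsub: "effective_op hsub_op"
  unfolding hsub_op_def by (intro effective_intros)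

lemma hsub_op_fixpoint:
  assumes h: "\<And>z. h z = hsub_op h z"
  shows "h (Inl (\<tau>, x, N, Inl M)) = Some (map_option Inl (hsub_tm \<tau> x N M))"
    and "h (Inl (\<tau>', x', N', Inr (Inl R))) =
        Some (map_option (\<lambda>R. Inr (Inl R)) (hsub_neu \<tau>' x' N' R))"
    and "h (Inl (\<tau>2, x2, N2, Inr (Inr S))) =
        Some (map_option (\<lambda>S. Inr (Inr S)) (hsub_spine \<tau>2 x2 N2 S))"
    and "h (Inr (\<tau>1, S1, M1)) = Some (map_option (\<lambda>R. Inr (Inl R)) (happ \<tau>1 S1 M1))"
proof (induction \<tau> x N M and \<tau>' x' N' R and \<tau>2 x2 N2 S and \<tau>1 S1 M1
    rule: hsub_tm_hsub_neu_hsub_spine_happ.induct)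
  case (3 \<tau> x N H S)
  then show ?case by (subst h) (cases "hsub_spine \<tau> x N S"; simp add: hsub_op_def)
next
  case (5 \<tau> x N M S)
  then show ?case
    by (subst h) (cases "hsub_tm \<tau> x N M"; cases "hsub_spine \<tau> x N S"; simp add: hsub_op_def)
next
  case (8 \<tau>2 \<tau>1 N S M)
  then show ?case by (subst h) (cases "hsub_tm \<tau>2 0 N M"; simp add: hsub_op_def)
qed (subst h, simp add: hsub_op_def map_option_case
  split: option.split stp.split tm.split spine.split)+

lemma effective_map_option [effective_intros]:
  fixes f :: "'e::godel_enum \<Rightarrow> 'a::godel_enum option" and k :: "'a \<Rightarrow> 'b::godel_enum"
  assumes "effective k" "effective f"
  shows "effective (\<lambda>e. map_option k (f e))"
  unfolding map_option_case by (intro effective_intros assms(2) effective_compose[OF assms(1)])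

lemma effective_hsub_spine [effective_intros]:
  fixes \<tau> :: "'e::godel_enum \<Rightarrow> stp"
  assumes "effective \<tau>" "effective x" "effective N" "effective S"
  shows "effective (\<lambda>e. hsub_spine (\<tau> e) (x e) (N e) (S e))"
proof (rule effective_rec_inj[OF effective_op_hsub])
  show "effective (map_option (\<lambda>S. Inr (Inr S) :: syn))" by (intro effective_intros)
  show "inj (map_option (\<lambda>S. Inr (Inr S) :: syn))" by (intro option.inj_map) (simp add: inj_def)
  show "effective (\<lambda>e. Inl (\<tau> e, x e, N e, Inr (Inr (S e))) :: hsub_input)"
    by (intro effective_intros assms)
qed (rule hsub_op_fixpoint(3))

lemma effective_happ [effective_intros]:
  fixes \<tau> :: "'e::godel_enum \<Rightarrow> stp"
  assumes "effective \<tau>" "effective S" "effective M"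
  shows "effective (\<lambda>e. happ (\<tau> e) (S e) (M e))"
proof (rule effective_rec_inj[OF effective_op_hsub])
  show "effective (map_option (\<lambda>R. Inr (Inl R) :: syn))" by (intro effective_intros)
  show "inj (map_option (\<lambda>R. Inr (Inl R) :: syn))" by (intro option.inj_map) (simp add: inj_def)
  show "effective (\<lambda>e. Inr (\<tau> e, S e, M e) :: hsub_input)" by (intro effective_intros assms)
qed (rule hsub_op_fixpoint(4))

lemma hsub_aty_eq_case:
  "hsub_aty \<tau> x N P = (case P of Fam a S \<Rightarrow> do { S' \<leftarrow> hsub_spine \<tau> x N S; Some (Fam a S') })"
  by (cases P) simp

lemma effective_hsub_aty [effective_intros]:
  assumes "effective \<tau>" "effective x" "effective N" "effective P"
  shows "effective (\<lambda>e. hsub_aty (\<tau> e) (x e) (N e) (P e))"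
  by (rule effective_app4[OF _ assms]) (unfold hsub_aty_eq_case, intro effective_intros)

lemma effective_hsub_ty [effective_intros]:
  assumes "effective \<tau>" "effective x" "effective N" "effective A"
  shows "effective (\<lambda>e. hsub_ty (\<tau> e) (x e) (N e) (A e))"
proof (rule effective_rec4[OF _ _ assms])
  let ?F = "\<lambda>h (\<tau>, x, N, A). case A of
      Atom P \<Rightarrow> Some (do { P' \<leftarrow> hsub_aty \<tau> x N P; Some (Atom P') })
    | Pi A2 A1 \<Rightarrow> bind_result (h (\<tau>, x, N, A2)) (\<lambda>A2'.
        bind_result (h (\<tau>, Suc x, ren_tm N Suc, A1)) (\<lambda>A1'. Some (Some (Pi A2' A1'))))
    | PrePi A2 A1 \<Rightarrow> bind_result (h (\<tau>, x, N, A2)) (\<lambda>A2'.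
        bind_result (h (\<tau>, Suc x, ren_tm N Suc, A1)) (\<lambda>A1'. Some (Some (PrePi A2' A1'))))"
  show "effective_op ?F" by (intro effective_intros)
  show "h (\<tau>, x, N, A) = Some (hsub_ty \<tau> x N A)" if "\<And>z. h z = ?F h z" for h \<tau> x N A
    by (induction A arbitrary: x N) (subst that, simp)+
qed

lemma effective_hsub_kind [effective_intros]:
  assumes "effective \<tau>" "effective x" "effective N" "effective K"
  shows "effective (\<lambda>e. hsub_kind (\<tau> e) (x e) (N e) (K e))"
proof (rule effective_rec4[OF _ _ assms])
  let ?F = "\<lambda>h (\<tau>, x, N, K). case K of
      Type \<Rightarrow> Some (Some Type)
    | Cotype \<Rightarrow> Some (Some Cotype)
    | KPi A K \<Rightarrow> bind_result (Some (hsub_ty \<tau> x N A)) (\<lambda>A'.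
        bind_result (h (\<tau>, Suc x, ren_tm N Suc, K)) (\<lambda>K'. Some (Some (KPi A' K'))))
    | KPrePi A K \<Rightarrow> bind_result (Some (hsub_ty \<tau> x N A)) (\<lambda>A'.
        bind_result (h (\<tau>, Suc x, ren_tm N Suc, K)) (\<lambda>K'. Some (Some (KPrePi A' K'))))"
  show "effective_op ?F" by (intro effective_intros)
  show "h (\<tau>, x, N, K) = Some (hsub_kind \<tau> x N K)" if "\<And>z. h z = ?F h z" for h \<tau> x N K
    by (induction K arbitrary: x N) (subst that, simp)+
qed


subsection \<open>Signatures and simple syntactic tests\<close>

lemma effective_fam_kind [effective_intros]:
  assumes "effective \<Xi>" "effective a"
  shows "effective (\<lambda>e. fam_kind (\<Xi> e) (a e))"
proof (rule effective_rec2[OF _ _ assms])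
  let ?F = "\<lambda>h (\<Xi>, a). case \<Xi> of [] \<Rightarrow> Some None | d # \<Xi> \<Rightarrow> (case d of
      FamDecl b K \<Rightarrow> if b = a then Some (Some K) else h (\<Xi>, a)
    | ConDecl b A \<Rightarrow> h (\<Xi>, a)
    | RecDecl b A M \<Rightarrow> h (\<Xi>, a))"
  show "effective_op ?F" by (intro effective_intros)
  show "h (\<Xi>, a) = Some (fam_kind \<Xi> a)" if "\<And>z. h z = ?F h z" for h \<Xi> a
    by (induction \<Xi>) (subst that, simp split: decl.split)+
qed

lemma effective_con_type [effective_intros]:
  assumes "effective \<Xi>" "effective c"
  shows "effective (\<lambda>e. con_type (\<Xi> e) (c e))"
proof (rule effective_rec2[OF _ _ assms])
  let ?F = "\<lambda>h (\<Xi>, c). case \<Xi> of [] \<Rightarrow> Some None | d # \<Xi> \<Rightarrow> (case d of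
      FamDecl b K \<Rightarrow> h (\<Xi>, c)
    | ConDecl b A \<Rightarrow> if b = c then Some (Some A) else h (\<Xi>, c)
    | RecDecl b A M \<Rightarrow> h (\<Xi>, c))"
  show "effective_op ?F" by (intro effective_intros)
  show "h (\<Xi>, c) = Some (con_type \<Xi> c)" if "\<And>z. h z = ?F h z" for h \<Xi> c
    by (induction \<Xi>) (subst that, simp split: decl.split)+
qed

lemma effective_rec_def [effective_intros]:
  assumes "effective \<Xi>" "effective r"
  shows "effective (\<lambda>e. rec_def (\<Xi> e) (r e))"
proof (rule effective_rec2[OF _ _ assms])
  let ?F = "\<lambda>h (\<Xi>, r). case \<Xi> of [] \<Rightarrow> Some None | d # \<Xi> \<Rightarrow> (case d of
      FamDecl b K \<Rightarrow> h (\<Xi>, r)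
    | ConDecl b A \<Rightarrow> h (\<Xi>, r)
    | RecDecl b A M \<Rightarrow> if b = r then Some (Some (A, M)) else h (\<Xi>, r))"
  show "effective_op ?F" by (intro effective_intros)
  show "h (\<Xi>, r) = Some (rec_def \<Xi> r)" if "\<And>z. h z = ?F h z" for h \<Xi> r
    by (induction \<Xi>) (subst that, simp split: decl.split)+
qed

lemma effective_fam_prio [effective_intros]:
  assumes "effective \<Xi>" "effective a"
  shows "effective (\<lambda>e. fam_prio (\<Xi> e) (a e))"
proof (rule effective_rec2[OF _ _ assms])
  let ?F = "\<lambda>h (\<Xi>, a). case \<Xi> of [] \<Rightarrow> Some None | d # \<Xi> \<Rightarrow> (case d of
      FamDecl b K \<Rightarrow> if b = a then Some (Some (length \<Xi>)) else h (\<Xi>, a)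
    | ConDecl b A \<Rightarrow> h (\<Xi>, a)
    | RecDecl b A M \<Rightarrow> h (\<Xi>, a))"
  show "effective_op ?F" by (intro effective_intros)
  show "h (\<Xi>, a) = Some (fam_prio \<Xi> a)" if "\<And>z. h z = ?F h z" for h \<Xi> a
    by (induction \<Xi>) (subst that, simp split: decl.split)+
qed

lemma effective_prepattern_spine [effective_intros]:
  assumes "effective S"
  shows "effective (\<lambda>e. prepattern_spine (S e))"
proof (rule effective_rec1[OF _ _ assms])
  let ?F = "\<lambda>h S. case S of SNil \<Rightarrow> Some True | SArg M S \<Rightarrow> Some False | SPre y S \<Rightarrow> h S"
  show "effective_op ?F" by (intro effective_intros)
  show "h S = Some (prepattern_spine S)" if "\<And>S. h S = ?F h S" for h S
    by (induction S rule: spine_induct) (subst that, simp)+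
qed

lemma effective_prepattern_ty [effective_intros]:
  assumes "effective A"
  shows "effective (\<lambda>e. prepattern_ty (A e))"
proof (rule effective_rec1[OF _ _ assms])
  let ?F = "\<lambda>h A. case A of Atom P \<Rightarrow> Some True | Pi A2 A1 \<Rightarrow> Some False | PrePi A2 A1 \<Rightarrow> h A1"
  show "effective_op ?F" by (intro effective_intros)
  show "h A = Some (prepattern_ty A)" if "\<And>A. h A = ?F h A" for h A
    by (induction A) (subst that, simp)+
qed

lemma rec_headed_eq_case:
  "rec_headed R \<longleftrightarrow> (case R of App H S \<Rightarrow> (case H of Var x \<Rightarrow> False | Con c \<Rightarrow> False | Rec r \<Rightarrow> True))"
  by (cases R) (simp split: head.split)

lemma effective_rec_headed [effective_intros]:
  fixes R :: "'e::godel_enum \<Rightarrow> neu"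
  shows "effective R \<Longrightarrow> effective (\<lambda>e. rec_headed (R e))"
  unfolding rec_headed_eq_case by (intro effective_intros)

lemma effective_contractive [effective_intros]:
  assumes "effective M"
  shows "effective (\<lambda>e. contractive (M e))"
proof (rule effective_rec1[OF _ _ assms])
  let ?F = "\<lambda>h M. case M of Neu R \<Rightarrow> Some (\<not> rec_headed R) | Lam M \<Rightarrow> h M"
  show "effective_op ?F" by (intro effective_intros)
  show "h M = Some (contractive M)" if "\<And>M. h M = ?F h M" for h M
    by (induction M rule: tm_induct) (subst that, simp)+
qed

lemma effective_target [effective_intros]:
  assumes "effective A"
  shows "effective (\<lambda>e. target (A e))"
proof (rule effective_rec1[OF _ _ assms])
  let ?F = "\<lambda>h A. case A of
      Atom P \<Rightarrow> Some (case P of Fam a S \<Rightarrow> a) | Pi A2 A1 \<Rightarrow> h A1 | PrePi A2 A1 \<Rightarrow> h A1"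
  show "effective_op ?F" by (intro effective_intros)
  show "h A = Some (target A)" if "\<And>A. h A = ?F h A" for h A
    by (induction A) (subst that, simp)+
qed

lemma effective_cotype_kind [effective_intros]:
  assumes "effective K"
  shows "effective (\<lambda>e. cotype_kind (K e))"
proof (rule effective_rec1[OF _ _ assms])
  let ?F = "\<lambda>h K. case K of
      Type \<Rightarrow> Some False | Cotype \<Rightarrow> Some True | KPi A K \<Rightarrow> h K | KPrePi A K \<Rightarrow> h K"
  show "effective_op ?F" by (intro effective_intros)
  show "h K = Some (cotype_kind K)" if "\<And>K. h K = ?F h K" for h K
    by (induction K) (subst that, simp)+
qed


section \<open>Decidability of equality\<close>

subsection \<open>Free variable occurrences and renamings\<close>

primrec fv_tm :: "tm \<Rightarrow> nat \<Rightarrow> nat list"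
  and fv_neu :: "neu \<Rightarrow> nat \<Rightarrow> nat list"
  and fv_spine :: "spine \<Rightarrow> nat \<Rightarrow> nat list" where
  "fv_tm (Neu R) d = fv_neu R d"
| "fv_tm (Lam M) d = fv_tm M (Suc d)"
| "fv_neu (App H S) d =
    (case H of Var x \<Rightarrow> if x < d then [] else [x - d] | Con c \<Rightarrow> [] | Rec r \<Rightarrow> []) @ fv_spine S d"
| "fv_spine SNil d = []"
| "fv_spine (SArg M S) d = fv_tm M d @ fv_spine S d"
| "fv_spine (SPre y S) d = (if y < d then [] else [y - d]) @ fv_spine S d"

lemma up_comp: "up \<sigma> \<circ> up \<rho> = up (\<sigma> \<circ> \<rho>)"
  by (auto simp: up_def fun_eq_iff split: nat.split)

lemma ren_ren:
  "ren_tm (ren_tm M \<rho>) \<sigma> = ren_tm M (\<sigma> \<circ> \<rho>)"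
  "ren_neu (ren_neu R \<rho>) \<sigma> = ren_neu R (\<sigma> \<circ> \<rho>)"
  "ren_spine (ren_spine S \<rho>) \<sigma> = ren_spine S (\<sigma> \<circ> \<rho>)"
proof (induction M and R and S arbitrary: \<rho> \<sigma> and \<rho> \<sigma> and \<rho> \<sigma>)
  case (App H S) then show ?case by (cases H) auto
qed (auto simp: up_comp)

lemma fv_ren:
  "fv_tm (ren_tm M (upn d \<rho>)) d = map \<rho> (fv_tm M d)"
  "fv_neu (ren_neu R (upn d \<rho>)) d = map \<rho> (fv_neu R d)"
  "fv_spine (ren_spine S (upn d \<rho>)) d = map \<rho> (fv_spine S d)"
proof (induction M and R and S arbitrary: d and d and d)
  case (App H S) then show ?case by (cases H) (auto simp: upn_def)
qed (auto simp: upn_def)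

lemma fv_neu_ren: "fv_neu (ren_neu R \<rho>) 0 = map \<rho> (fv_neu R 0)"
  using fv_ren(2)[of R 0 \<rho>] by simp

abbreviation skeleton :: "neu \<Rightarrow> neu" where
  "skeleton R \<equiv> ren_neu R (\<lambda>_. 0)"

lemma skeleton_ren [simp]: "skeleton (ren_neu R \<rho>) = skeleton R"
  by (simp add: ren_ren comp_def)

lemma length_fv_neu_skeleton:
  "skeleton R = skeleton R' \<Longrightarrow> length (fv_neu R 0) = length (fv_neu R' 0)"
  by (metis fv_neu_ren length_map)

lemma ren_eqI:
  "ren_tm M (upn d (\<lambda>_. 0)) = ren_tm M' (upn d (\<lambda>_. 0)) \<Longrightarrow> fv_tm M' d = map \<rho> (fv_tm M d) \<Longrightarrow>
    M' = ren_tm M (upn d \<rho>)"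
  "ren_neu R (upn d (\<lambda>_. 0)) = ren_neu R' (upn d (\<lambda>_. 0)) \<Longrightarrow> fv_neu R' d = map \<rho> (fv_neu R d) \<Longrightarrow>
    R' = ren_neu R (upn d \<rho>)"
  "ren_spine S (upn d (\<lambda>_. 0)) = ren_spine S' (upn d (\<lambda>_. 0)) \<Longrightarrow>
    fv_spine S' d = map \<rho> (fv_spine S d) \<Longrightarrow>
    S' = ren_spine S (upn d \<rho>)"
proof (induction M and R and S arbitrary: d M' and d R' and d S')
  case (Neu R) then show ?case by (cases M') auto
next
  case (Lam M) then show ?case by (cases M') auto
next
  case (App H S)
  obtain H' S' where R': "R' = App H' S'" by (cases R')
  with App.prems(1) have skeletons: "ren_head (upn d (\<lambda>_. 0)) H = ren_head (upn d (\<lambda>_. 0)) H'"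
    "ren_spine S (upn d (\<lambda>_. 0)) = ren_spine S' (upn d (\<lambda>_. 0))" by auto
  have "H' = ren_head (upn d \<rho>) H \<and> fv_spine S' d = map \<rho> (fv_spine S d)"
    using App.prems(2) skeletons(1) unfolding R'
    by (cases H; cases H') (auto simp: upn_def split: if_splits)
  with App.IH[OF skeletons(2)] R' show ?case by simp
next
  case SNil then show ?case by (cases S') auto
next
  case (SArg M S)
  from SArg.prems(1) obtain M' T' where S': "S' = SArg M' T'" by (cases S') auto
  with SArg.prems(1) have skeletons: "ren_tm M (upn d (\<lambda>_. 0)) = ren_tm M' (upn d (\<lambda>_. 0))"
    "ren_spine S (upn d (\<lambda>_. 0)) = ren_spine T' (upn d (\<lambda>_. 0))" by auto
  have "length (fv_tm M d) = length (fv_tm M' d)"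
    by (metis fv_ren(1) length_map skeletons(1))
  with SArg.prems(2) have "fv_tm M' d = map \<rho> (fv_tm M d)" "fv_spine T' d = map \<rho> (fv_spine S d)"
    by (auto simp: S')
  with SArg.IH(1)[OF skeletons(1)] SArg.IH(2)[OF skeletons(2)] S' show ?case by simp
next
  case (SPre y S)
  from SPre.prems(1) obtain y' T' where S': "S' = SPre y' T'" by (cases S') auto
  with SPre.prems(1) have skeletons: "upn d (\<lambda>_. 0) y = upn d (\<lambda>_. 0) y'"
    "ren_spine S (upn d (\<lambda>_. 0)) = ren_spine T' (upn d (\<lambda>_. 0))" by auto
  have "y' = upn d \<rho> y \<and> fv_spine T' d = map \<rho> (fv_spine S d)"
    using SPre.prems(2) skeletons(1) unfolding S' by (auto simp: upn_def split: if_splits)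
  with SPre.IH[OF skeletons(2)] S' show ?case by simp
qed

lemma eq_ren_neu_iff:
  "R' = ren_neu R \<rho> \<longleftrightarrow> skeleton R' = skeleton R \<and> fv_neu R' 0 = map \<rho> (fv_neu R 0)"
  using ren_eqI(2)[of R 0 R' \<rho>] by (auto simp: fv_neu_ren)


subsection \<open>Renamings of equations\<close>

definition fv_eqn :: "eqn \<Rightarrow> nat list" where
  "fv_eqn e = (case e of (n, R, R') \<Rightarrow> fv_neu R 0 @ fv_neu R' 0)"

definition skeleton_eqn :: "eqn \<Rightarrow> neu \<times> neu" where
  "skeleton_eqn e = (case e of (n, R, R') \<Rightarrow> (skeleton R, skeleton R'))"

lemma length_fv_eqn_skeleton:
  "skeleton_eqn e = skeleton_eqn e' \<Longrightarrow> length (fv_eqn e) = length (fv_eqn e')"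
  by (cases e; cases e') (auto simp: skeleton_eqn_def fv_eqn_def dest!: length_fv_neu_skeleton)

lemma eqn_renamed_iff:
  "R = ren_neu Q \<rho> \<and> R' = ren_neu Q' \<rho> \<longleftrightarrow>
    skeleton_eqn (n, R, R') = skeleton_eqn (k, Q, Q') \<and>
      fv_eqn (n, R, R') = map \<rho> (fv_eqn (k, Q, Q'))"
  using length_fv_neu_skeleton[of R Q] eq_ren_neu_iff[of R Q \<rho>] eq_ren_neu_iff[of R' Q' \<rho>]
  by (auto simp: skeleton_eqn_def fv_eqn_def)

definition partial_renaming :: "nat \<Rightarrow> nat \<Rightarrow> (nat \<times> nat) set \<Rightarrow> bool" where
  "partial_renaming k n Z \<longleftrightarrow> k \<le> n \<and>
    (\<forall>p\<in>Z. (fst p < k \<longrightarrow> snd p < n) \<and>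
      (\<forall>q\<in>Z. (fst p = fst q \<longrightarrow> snd p = snd q) \<and>
        (fst p < k \<and> fst q < k \<and> snd p = snd q \<longrightarrow> fst p = fst q)))"

lemma extend_injection:
  fixes f :: "nat \<Rightarrow> nat"
  assumes "inj_on f (V \<inter> {..<k})" "f ` (V \<inter> {..<k}) \<subseteq> {..<n}" "k \<le> n"
  shows "\<exists>\<rho>. inj_on \<rho> {..<k} \<and> \<rho> ` {..<k} \<subseteq> {..<n} \<and> (\<forall>x\<in>V. \<rho> x = f x)"
proof -
  let ?A = "{..<k} - V" and ?B = "{..<n} - f ` (V \<inter> {..<k})"
  have "?A = {..<k} - (V \<inter> {..<k})" by blast
  then have "card ?A = k - card (V \<inter> {..<k})" by (simp add: card_Diff_subset)
  also have "\<dots> \<le> n - card (f ` (V \<inter> {..<k}))" using assms(1,3) by (simp add: card_image)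
  also have "\<dots> = card ?B" using assms(2) by (simp add: card_Diff_subset)
  finally have "\<exists>g. inj_on g ?A \<and> g ` ?A \<subseteq> ?B" by (subst inj_on_iff_card_le) simp_all
  then obtain g where g: "inj_on g ?A" "g ` ?A \<subseteq> ?B" by blast
  define \<rho> where "\<rho> x = (if x \<in> V then f x else g x)" for x
  have "inj_on \<rho> (V \<inter> {..<k})" using assms(1) by (auto simp: \<rho>_def inj_on_def)
  moreover have "inj_on \<rho> ?A" using g(1) by (auto simp: \<rho>_def inj_on_def)
  moreover have image: "\<rho> ` (V \<inter> {..<k}) = f ` (V \<inter> {..<k})" "\<rho> ` ?A = g ` ?A" by (auto simp: \<rho>_def)
  moreover have "\<rho> ` (V \<inter> {..<k}) \<inter> \<rho> ` ?A = {}" unfolding image using g(2) by blast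
  ultimately have "inj_on \<rho> ((V \<inter> {..<k}) \<union> ?A)" unfolding inj_on_Un by blast
  moreover have "(V \<inter> {..<k}) \<union> ?A = {..<k}" by blast
  moreover from this have "\<rho> ` {..<k} = f ` (V \<inter> {..<k}) \<union> g ` ?A" by (metis image_Un image)
  ultimately show ?thesis using assms(2) g(2) by (intro exI[of _ \<rho>]) (auto simp: \<rho>_def)
qed

lemma partial_renaming_if_renaming:
  assumes \<rho>: "inj_on \<rho> {..<k}" "\<rho> ` {..<k} \<subseteq> {..<n}" "\<forall>p\<in>Z. snd p = \<rho> (fst p)"
  shows "partial_renaming k n Z"
  unfolding partial_renaming_def
proof (intro conjI ballI impI)
  show "k \<le> n" using card_inj_on_le[OF \<rho>(1,2)] by simp
next
  fix p assume "p \<in> Z" "fst p < k"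
  then show "snd p < n" using \<rho>(2) \<rho>(3)[rule_format, of p] by auto
next
  fix p q assume "p \<in> Z" "q \<in> Z" "fst p = fst q"
  then show "snd p = snd q" using \<rho>(3)[rule_format, of p] \<rho>(3)[rule_format, of q] by simp
next
  fix p q assume "p \<in> Z" "q \<in> Z" "fst p < k \<and> fst q < k \<and> snd p = snd q"
  then show "fst p = fst q"
    using \<rho>(3)[rule_format, of p] \<rho>(3)[rule_format, of q] by (auto intro: inj_onD[OF \<rho>(1)])
qed

lemma renaming_if_partial_renaming:
  assumes "partial_renaming k n Z"
  shows "\<exists>\<rho>. inj_on \<rho> {..<k} \<and> \<rho> ` {..<k} \<subseteq> {..<n} \<and> (\<forall>p\<in>Z. snd p = \<rho> (fst p))"
proof -
  from assms have "k \<le> n"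
    and scope: "\<And>p. p \<in> Z \<Longrightarrow> fst p < k \<Longrightarrow> snd p < n"
    and functional: "\<And>p q. p \<in> Z \<Longrightarrow> q \<in> Z \<Longrightarrow> fst p = fst q \<Longrightarrow> snd p = snd q"
    and injective: "\<And>p q. p \<in> Z \<Longrightarrow> q \<in> Z \<Longrightarrow> fst p < k \<Longrightarrow> fst q < k \<Longrightarrow> snd p = snd q \<Longrightarrow> fst p = fst q"
    unfolding partial_renaming_def by blast+
  define f where "f x = (THE y. (x, y) \<in> Z)" for x
  have f: "f (fst p) = snd p" if "p \<in> Z" for p
    unfolding f_def
  proof (rule the_equality)
    show "(fst p, snd p) \<in> Z" using that by simp
    show "y = snd p" if "(fst p, y) \<in> Z" for y using functional[OF that \<open>p \<in> Z\<close>] by simp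
  qed
  have "inj_on f (fst ` Z \<inter> {..<k})"
  proof (rule inj_onI)
    fix x x' assume "x \<in> fst ` Z \<inter> {..<k}" "x' \<in> fst ` Z \<inter> {..<k}" "f x = f x'"
    then obtain p q where "p \<in> Z" "q \<in> Z" "x = fst p" "x' = fst q" "fst p < k" "fst q < k" by blast
    with \<open>f x = f x'\<close> injective[of p q] f show "x = x'" by simp
  qed
  moreover have "f ` (fst ` Z \<inter> {..<k}) \<subseteq> {..<n}"
  proof (rule image_subsetI)
    fix x assume "x \<in> fst ` Z \<inter> {..<k}"
    then obtain p where "p \<in> Z" "x = fst p" "fst p < k" by blast
    with f scope show "f x \<in> {..<n}" by simp
  qed
  ultimately obtain \<rho> where "inj_on \<rho> {..<k}" "\<rho> ` {..<k} \<subseteq> {..<n}" "\<forall>x\<in>fst ` Z. \<rho> x = f x"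
    using extend_injection[of f "fst ` Z" k n] \<open>k \<le> n\<close> by blast
  with f show ?thesis by (intro exI[of _ \<rho>]) simp
qed

lemma ex_renaming_iff_partial_renaming:
  "(\<exists>\<rho>. inj_on \<rho> {..<k} \<and> \<rho> ` {..<k} \<subseteq> {..<n} \<and> (\<forall>p\<in>Z. snd p = \<rho> (fst p))) \<longleftrightarrow> partial_renaming k n Z"
proof
  show "partial_renaming k n Z"
    if "\<exists>\<rho>. inj_on \<rho> {..<k} \<and> \<rho> ` {..<k} \<subseteq> {..<n} \<and> (\<forall>p\<in>Z. snd p = \<rho> (fst p))"
    using that by (elim exE conjE) (rule partial_renaming_if_renaming)
qed (rule renaming_if_partial_renaming)

lemma eq_map_iff_zip:
  "length xs = length ys \<Longrightarrow> ys = map f xs \<longleftrightarrow> (\<forall>p\<in>set (zip xs ys). snd p = f (fst p))"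
  by (induction xs ys rule: list_induct2) auto

lemma is_renaming_of_iff:
  "is_renaming_of e e' \<longleftrightarrow> skeleton_eqn e = skeleton_eqn e' \<and>
    partial_renaming (fst e') (fst e) (set (zip (fv_eqn e') (fv_eqn e)))"
proof -
  obtain n R R' k Q Q' where e: "e = (n, R, R')" "e' = (k, Q, Q')" by (cases e, cases e')
  have "is_renaming_of e e' \<longleftrightarrow> skeleton_eqn e = skeleton_eqn e' \<and>
      (\<exists>\<rho>. inj_on \<rho> {..<k} \<and> \<rho> ` {..<k} \<subseteq> {..<n} \<and> fv_eqn e = map \<rho> (fv_eqn e'))"
    using eqn_renamed_iff[of R Q _ R' Q' n k] by (auto simp: e is_renaming_of_def)
  also have "\<dots> \<longleftrightarrow> skeleton_eqn e = skeleton_eqn e' \<and>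
      (\<exists>\<rho>. inj_on \<rho> {..<k} \<and> \<rho> ` {..<k} \<subseteq> {..<n} \<and>
        (\<forall>p\<in>set (zip (fv_eqn e') (fv_eqn e)). snd p = \<rho> (fst p)))"
  proof (rule conj_cong[OF refl])
    assume "skeleton_eqn e = skeleton_eqn e'"
    then have "length (fv_eqn e') = length (fv_eqn e)" by (rule length_fv_eqn_skeleton[symmetric])
    then show "(\<exists>\<rho>. inj_on \<rho> {..<k} \<and> \<rho> ` {..<k} \<subseteq> {..<n} \<and> fv_eqn e = map \<rho> (fv_eqn e')) \<longleftrightarrow>
        (\<exists>\<rho>. inj_on \<rho> {..<k} \<and> \<rho> ` {..<k} \<subseteq> {..<n} \<and>
          (\<forall>p\<in>set (zip (fv_eqn e') (fv_eqn e)). snd p = \<rho> (fst p)))"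
      by (simp only: eq_map_iff_zip)
  qed
  finally show ?thesis by (simp add: e ex_renaming_iff_partial_renaming)
qed

text \<open>Up to the number of variables in scope, the key of an equation determines it up to renaming,
  and there are only finitely many keys over finitely many skeletons.\<close>

definition eqn_key :: "eqn \<Rightarrow> (neu \<times> neu) \<times> (nat \<times> nat) set \<times> nat set" where
  "eqn_key e = (skeleton_eqn e,
    {(i, j). i < length (fv_eqn e) \<and> j < length (fv_eqn e) \<and> fv_eqn e ! i = fv_eqn e ! j},
    {i. i < length (fv_eqn e) \<and> fv_eqn e ! i < fst e})"

lemma is_renaming_of_eqn_key:
  assumes "eqn_key e = eqn_key e'" "fst e' \<le> fst e"
  shows "is_renaming_of e e'"
proof -
  have skeleton: "skeleton_eqn e = skeleton_eqn e'" using assms(1) by (simp add: eqn_key_def)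
  then have len: "length (fv_eqn e) = length (fv_eqn e')" by (rule length_fv_eqn_skeleton)
  have coincidence: "fv_eqn e ! i = fv_eqn e ! j \<longleftrightarrow> fv_eqn e' ! i = fv_eqn e' ! j"
    if "i < length (fv_eqn e')" "j < length (fv_eqn e')" for i j
  proof -
    have "(i, j) \<in> fst (snd (eqn_key e)) \<longleftrightarrow> (i, j) \<in> fst (snd (eqn_key e'))" using assms(1) by simp
    with that len show ?thesis by (simp add: eqn_key_def)
  qed
  have scope: "fv_eqn e ! i < fst e \<longleftrightarrow> fv_eqn e' ! i < fst e'" if "i < length (fv_eqn e')" for i
  proof -
    have "i \<in> snd (snd (eqn_key e)) \<longleftrightarrow> i \<in> snd (snd (eqn_key e'))" using assms(1) by simp
    with that len show ?thesis by (simp add: eqn_key_def)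
  qed
  show ?thesis unfolding is_renaming_of_iff partial_renaming_def
    using skeleton assms(2) coincidence scope len by (auto simp: in_set_zip)
qed

definition eqn_keys :: "neu set \<Rightarrow> ((neu \<times> neu) \<times> (nat \<times> nat) set \<times> nat set) set" where
  "eqn_keys U = (SIGMA z : U \<times> U. let l = length (fv_neu (fst z) 0) + length (fv_neu (snd z) 0) in
    Pow ({..<l} \<times> {..<l}) \<times> Pow {..<l})"

lemma finite_eqn_keys: "finite U \<Longrightarrow> finite (eqn_keys U)"
  unfolding eqn_keys_def by (intro finite_SigmaI) (auto simp: Let_def)

lemma eqn_keys_mono: "U \<subseteq> V \<Longrightarrow> eqn_keys U \<subseteq> eqn_keys V"
  unfolding eqn_keys_def by auto

lemma eqn_key_in_eqn_keys: "skeleton R \<in> U \<Longrightarrow> skeleton R' \<in> U \<Longrightarrow> eqn_key (n, R, R') \<in> eqn_keys U"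
  by (auto simp: eqn_key_def eqn_keys_def Let_def skeleton_eqn_def fv_eqn_def fv_neu_ren)


subsection \<open>Skeletons of unfoldings\<close>

primrec skeletons_tm :: "tm \<Rightarrow> neu set"
  and skeletons_neu :: "neu \<Rightarrow> neu set"
  and skeletons_spine :: "spine \<Rightarrow> neu set" where
  "skeletons_tm (Neu R) = skeletons_neu R"
| "skeletons_tm (Lam M) = skeletons_tm M"
| "skeletons_neu (App H S) = insert (skeleton (App H S)) (skeletons_spine S)"
| "skeletons_spine SNil = {}"
| "skeletons_spine (SArg M S) = skeletons_tm M \<union> skeletons_spine S"
| "skeletons_spine (SPre y S) = skeletons_spine S"

lemma finite_skeletons [simp]:
  "finite (skeletons_tm M)" "finite (skeletons_neu R)" "finite (skeletons_spine S)"
  by (induction M and R and S) auto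

lemma skeletons_ren:
  "skeletons_tm (ren_tm M \<rho>) = skeletons_tm M"
  "skeletons_neu (ren_neu R \<rho>) = skeletons_neu R"
  "skeletons_spine (ren_spine S \<rho>) = skeletons_spine S"
proof (induction M and R and S arbitrary: \<rho> and \<rho> and \<rho>)
  case (App H S)
  then show ?case using skeleton_ren[of "App H S" \<rho>] by simp
qed auto

lemma skeleton_in_skeletons: "skeleton R \<in> skeletons_neu R"
  by (cases R) simp

definition unfold_neu :: "sig \<Rightarrow> neu \<Rightarrow> neu option" where
  "unfold_neu \<Sigma> R = (case R of App H S \<Rightarrow> (case H of
      Var x \<Rightarrow> None
    | Con c \<Rightarrow> None
    | Rec r \<Rightarrow> do {
        (A, M) \<leftarrow> rec_def \<Sigma> r;
        if prepattern_spine S then happ (erase A) S M else None }))"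

lemma unfold_neu_Rec_eq_Some_iff:
  "unfold_neu \<Sigma> (App (Rec r) S) = Some R \<longleftrightarrow>
    (\<exists>A M. rec_def \<Sigma> r = Some (A, M) \<and> prepattern_spine S \<and> happ (erase A) S M = Some R)"
  by (auto simp: unfold_neu_def bind_eq_Some_conv)

definition bodies :: "sig \<Rightarrow> tm set" where
  "bodies \<Sigma> = {M. \<exists>r A. RecDecl r A M \<in> set \<Sigma>}"

lemma finite_bodies [simp]: "finite (bodies \<Sigma>)"
proof (rule finite_subset)
  show "bodies \<Sigma> \<subseteq> (\<lambda>d. case d of RecDecl r A M \<Rightarrow> M | _ \<Rightarrow> undefined) ` set \<Sigma>"
    unfolding bodies_def by (auto intro: rev_image_eqI)
qed simp

lemma rec_def_in_bodies: "rec_def \<Sigma> r = Some (A, M) \<Longrightarrow> M \<in> bodies \<Sigma>"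
  by (induction \<Sigma>) (auto simp: bodies_def split: decl.splits if_splits)

definition body_skeletons :: "sig \<Rightarrow> neu set" where
  "body_skeletons \<Sigma> = (\<Union>M\<in>bodies \<Sigma>. skeletons_tm M)"

lemma finite_body_skeletons [simp]: "finite (body_skeletons \<Sigma>)"
  by (simp add: body_skeletons_def)

lemma skeletons_happ_prepattern:
  "prepattern_spine S \<Longrightarrow> happ \<tau> S M = Some R \<Longrightarrow> skeletons_neu R \<subseteq> skeletons_tm M"
proof (induction S arbitrary: \<tau> M rule: spine_induct)
  case SNil
  then show ?case by (cases \<tau>; cases M) auto
next
  case (SPre y S)
  from SPre.prems(2) obtain \<tau>1 N where "\<tau> = Arr Base \<tau>1" "M = Lam N"
    and happ: "happ \<tau>1 S (ren_tm N (inst y)) = Some R"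
    by (cases "(\<tau>, SPre y S, M)" rule: happ.cases) auto
  moreover from SPre.prems(1) have "prepattern_spine S" by simp
  ultimately show ?case using SPre.IH[OF _ happ] by (simp add: skeletons_ren)
qed simp

lemma skeletons_unfold_neu:
  assumes "unfold_neu \<Sigma> R = Some R'"
  shows "skeletons_neu R' \<subseteq> body_skeletons \<Sigma>"
proof -
  from assms obtain r S where "R = App (Rec r) S"
    by (auto simp: unfold_neu_def split: neu.splits head.splits)
  with assms obtain A M where "rec_def \<Sigma> r = Some (A, M)" "prepattern_spine S"
    "happ (erase A) S M = Some R'"
    by (auto simp: unfold_neu_Rec_eq_Some_iff)
  then have "M \<in> bodies \<Sigma>" "skeletons_neu R' \<subseteq> skeletons_tm M"
    by (simp_all add: rec_def_in_bodies skeletons_happ_prepattern)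
  then show ?thesis by (auto simp: body_skeletons_def)
qed


subsection \<open>The algorithm\<close>

definition memoised :: "eqn list \<Rightarrow> eqn \<Rightarrow> bool" where
  "memoised \<Delta> e \<longleftrightarrow> (\<exists>e'\<in>set \<Delta>. is_renaming_of e e')"

text \<open>The number of keys that are not yet memoised bounds the number of further unfoldings.  Only
  equations in a context of at most the current length count, since a context cannot be renamed
  into a shorter one.\<close>

definition pending_keys :: "sig \<Rightarrow> eqn list \<Rightarrow> nat \<Rightarrow> neu set \<Rightarrow> nat" where
  "pending_keys \<Sigma> \<Delta> n U =
    card (eqn_keys (body_skeletons \<Sigma> \<union> U) - eqn_key ` {e \<in> set \<Delta>. fst e \<le> n})"

lemma pending_keys_mono:
  assumes "n \<le> n'" "U' \<subseteq> body_skeletons \<Sigma> \<union> U" "finite U"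
  shows "pending_keys \<Sigma> \<Delta> n' U' \<le> pending_keys \<Sigma> \<Delta> n U"
  unfolding pending_keys_def
proof (rule card_mono)
  show "finite (eqn_keys (body_skeletons \<Sigma> \<union> U) - eqn_key ` {e \<in> set \<Delta>. fst e \<le> n})"
    using assms(3) by (simp add: finite_eqn_keys)
  have "eqn_keys (body_skeletons \<Sigma> \<union> U') \<subseteq> eqn_keys (body_skeletons \<Sigma> \<union> U)"
    using assms(2) by (intro eqn_keys_mono) blast
  with assms(1) show "eqn_keys (body_skeletons \<Sigma> \<union> U') - eqn_key ` {e \<in> set \<Delta>. fst e \<le> n'} \<subseteq>
      eqn_keys (body_skeletons \<Sigma> \<union> U) - eqn_key ` {e \<in> set \<Delta>. fst e \<le> n}" by auto
qed

lemma pending_keys_memoise: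
  assumes new: "\<not> memoised \<Delta> (n, R, R')" and U: "skeleton R \<in> U" "skeleton R' \<in> U" "finite U"
    and U': "U' \<subseteq> body_skeletons \<Sigma> \<union> U"
  shows "pending_keys \<Sigma> ((n, R, R') # \<Delta>) n U' < pending_keys \<Sigma> \<Delta> n U"
proof -
  have "eqn_key (n, R, R') \<notin> eqn_key ` {e \<in> set \<Delta>. fst e \<le> n}"
  proof
    assume "eqn_key (n, R, R') \<in> eqn_key ` {e \<in> set \<Delta>. fst e \<le> n}"
    then obtain e where "e \<in> set \<Delta>" "fst e \<le> n" "eqn_key (n, R, R') = eqn_key e" by blast
    with is_renaming_of_eqn_key[of "(n, R, R')" e] new show False by (auto simp: memoised_def)
  qed
  moreover have "eqn_key (n, R, R') \<in> eqn_keys (body_skeletons \<Sigma> \<union> U)"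
    using U by (intro eqn_key_in_eqn_keys) auto
  moreover have "{e \<in> set ((n, R, R') # \<Delta>). fst e \<le> n} = insert (n, R, R') {e \<in> set \<Delta>. fst e \<le> n}"
    by auto
  ultimately have "eqn_keys (body_skeletons \<Sigma> \<union> U) -
      eqn_key ` {e \<in> set ((n, R, R') # \<Delta>). fst e \<le> n} \<subset>
      eqn_keys (body_skeletons \<Sigma> \<union> U) - eqn_key ` {e \<in> set \<Delta>. fst e \<le> n}"
    by auto
  then have "pending_keys \<Sigma> ((n, R, R') # \<Delta>) n U < pending_keys \<Sigma> \<Delta> n U"
    unfolding pending_keys_def using U(3)
    by (intro psubset_card_mono) (simp_all add: finite_eqn_keys)
  moreover have "pending_keys \<Sigma> ((n, R, R') # \<Delta>) n U' \<le> pending_keys \<Sigma> ((n, R, R') # \<Delta>) n U"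
    using U' U(3) by (intro pending_keys_mono) auto
  ultimately show ?thesis by (rule order.strict_trans1[rotated])
qed

lemma pending_keys_structural:
  assumes "n \<le> n'" "U' \<subseteq> U" "finite U" "s' < s"
  shows "((pending_keys \<Sigma> \<Delta> n' U', s'), pending_keys \<Sigma> \<Delta> n U, s) \<in> less_than <*lex*> less_than"
  using pending_keys_mono[OF assms(1) le_supI2[OF assms(2)] assms(3)] assms(4)
  by (auto simp: le_less)

lemma pending_keys_unfold:
  assumes "\<not> memoised \<Delta> (n, R, R')"
    and "U' \<subseteq> body_skeletons \<Sigma> \<union> (skeletons_neu R \<union> skeletons_neu R')"
  shows "((pending_keys \<Sigma> ((n, R, R') # \<Delta>) n U', s'),
      pending_keys \<Sigma> \<Delta> n (skeletons_neu R \<union> skeletons_neu R'), s) \<in> less_than <*lex*> less_than"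
  using pending_keys_memoise[OF assms(1) _ _ _ assms(2)] skeleton_in_skeletons[of R]
    skeleton_in_skeletons[of R']
  by auto

definition head_in_scope :: "nat \<Rightarrow> head \<Rightarrow> bool" where
  "head_in_scope n H \<longleftrightarrow> (case H of Var x \<Rightarrow> x < n | Con c \<Rightarrow> True | Rec r \<Rightarrow> True)"

function (sequential)
      tm_eq_alg :: "sig \<Rightarrow> eqn list \<Rightarrow> nat \<Rightarrow> tm \<Rightarrow> tm \<Rightarrow> bool"
  and neu_eq_alg :: "sig \<Rightarrow> eqn list \<Rightarrow> nat \<Rightarrow> neu \<Rightarrow> neu \<Rightarrow> bool"
  and spine_eq_alg :: "sig \<Rightarrow> eqn list \<Rightarrow> nat \<Rightarrow> spine \<Rightarrow> spine \<Rightarrow> bool" where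
  "tm_eq_alg \<Sigma> \<Delta> n (Lam M) (Lam M') = tm_eq_alg \<Sigma> \<Delta> (Suc n) M M'"
| "tm_eq_alg \<Sigma> \<Delta> n (Neu R) (Neu R') = neu_eq_alg \<Sigma> \<Delta> n R R'"
| "tm_eq_alg \<Sigma> \<Delta> n M M' = False"
| "neu_eq_alg \<Sigma> \<Delta> n (App H S) (App H' S') =
    (if memoised \<Delta> (n, App H S, App H' S') then True
     else if rec_headed (App H S) then (case unfold_neu \<Sigma> (App H S) of
         None \<Rightarrow> False
       | Some R \<Rightarrow> neu_eq_alg \<Sigma> ((n, App H S, App H' S') # \<Delta>) n R (App H' S'))
     else if rec_headed (App H' S') then (case unfold_neu \<Sigma> (App H' S') of
         None \<Rightarrow> False
       | Some R' \<Rightarrow> neu_eq_alg \<Sigma> ((n, App H S, App H' S') # \<Delta>) n (App H S) R')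
     else if H = H' \<and> head_in_scope n H then spine_eq_alg \<Sigma> \<Delta> n S S'
     else False)"
| "spine_eq_alg \<Sigma> \<Delta> n SNil SNil = True"
| "spine_eq_alg \<Sigma> \<Delta> n (SArg M S) (SArg M' S') =
    (if tm_eq_alg \<Sigma> \<Delta> n M M' then spine_eq_alg \<Sigma> \<Delta> n S S' else False)"
| "spine_eq_alg \<Sigma> \<Delta> n (SPre y S) (SPre y' S') =
    (if y = y' \<and> y < n then spine_eq_alg \<Sigma> \<Delta> n S S' else False)"
| "spine_eq_alg \<Sigma> \<Delta> n S S' = False"
  by pat_completeness auto
termination
proof (relation "inv_image (less_than <*lex*> less_than) (case_sum
    (\<lambda>(\<Sigma>, \<Delta>, n, M, M'). (pending_keys \<Sigma> \<Delta> n (skeletons_tm M \<union> skeletons_tm M'), size M))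
    (case_sum
      (\<lambda>(\<Sigma>, \<Delta>, n, R, R'). (pending_keys \<Sigma> \<Delta> n (skeletons_neu R \<union> skeletons_neu R'), size R))
      (\<lambda>(\<Sigma>, \<Delta>, n, S, S'). (pending_keys \<Sigma> \<Delta> n (skeletons_spine S \<union> skeletons_spine S'), size S))))")
qed (simp_all only: wf_inv_image wf_lex_prod wf_less_than in_inv_image sum.case prod.case,
    (rule pending_keys_structural pending_keys_unfold; auto dest: skeletons_unfold_neu)+)

lemma tm_eq_simps:
  "tm_eq \<Sigma> \<Delta> n (Lam M) (Lam M') \<longleftrightarrow> tm_eq \<Sigma> \<Delta> (Suc n) M M'"
  "tm_eq \<Sigma> \<Delta> n (Neu R) (Neu R') \<longleftrightarrow> neu_eq \<Sigma> \<Delta> n R R'"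
  "\<not> tm_eq \<Sigma> \<Delta> n (Lam M) (Neu R')" "\<not> tm_eq \<Sigma> \<Delta> n (Neu R) (Lam M')"
  by (subst tm_eq.simps, simp)+

lemma neu_eq_iff:
  "neu_eq \<Sigma> \<Delta> n (App H S) (App H' S') \<longleftrightarrow> memoised \<Delta> (n, App H S, App H' S') \<or>
    (if rec_headed (App H S) then
       (\<exists>R. unfold_neu \<Sigma> (App H S) = Some R \<and>
         neu_eq \<Sigma> ((n, App H S, App H' S') # \<Delta>) n R (App H' S'))
     else if rec_headed (App H' S') then
       (\<exists>R'. unfold_neu \<Sigma> (App H' S') = Some R' \<and>
         neu_eq \<Sigma> ((n, App H S, App H' S') # \<Delta>) n (App H S) R')
     else H = H' \<and> head_in_scope n H \<and> spine_eq \<Sigma> \<Delta> n S S')"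
  by (subst neu_eq.simps, cases H; cases H')
    (auto simp: memoised_def unfold_neu_Rec_eq_Some_iff head_in_scope_def)

lemma spine_eq_simps:
  "spine_eq \<Sigma> \<Delta> n SNil SNil"
  "\<not> spine_eq \<Sigma> \<Delta> n SNil (SArg M' S')" "\<not> spine_eq \<Sigma> \<Delta> n SNil (SPre y' S')"
  "\<not> spine_eq \<Sigma> \<Delta> n (SArg M S) SNil" "\<not> spine_eq \<Sigma> \<Delta> n (SArg M S) (SPre y' S')"
  "\<not> spine_eq \<Sigma> \<Delta> n (SPre y S) SNil" "\<not> spine_eq \<Sigma> \<Delta> n (SPre y S) (SArg M' S')"
  "spine_eq \<Sigma> \<Delta> n (SArg M S) (SArg M' S') \<longleftrightarrow> tm_eq \<Sigma> \<Delta> n M M' \<and> spine_eq \<Sigma> \<Delta> n S S'"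
  "spine_eq \<Sigma> \<Delta> n (SPre y S) (SPre y' S') \<longleftrightarrow> y = y' \<and> y < n \<and> spine_eq \<Sigma> \<Delta> n S S'"
  by (subst spine_eq.simps, simp; blast)+

lemma
  shows tm_eq_iff_alg: "tm_eq \<Sigma> \<Delta> n M M' \<longleftrightarrow> tm_eq_alg \<Sigma> \<Delta> n M M'"
    and neu_eq_iff_alg: "neu_eq \<Sigma>1 \<Delta>1 n1 R R' \<longleftrightarrow> neu_eq_alg \<Sigma>1 \<Delta>1 n1 R R'"
    and spine_eq_iff_alg: "spine_eq \<Sigma>2 \<Delta>2 n2 S S' \<longleftrightarrow> spine_eq_alg \<Sigma>2 \<Delta>2 n2 S S'"
proof (induction \<Sigma> \<Delta> n M M' and \<Sigma>1 \<Delta>1 n1 R R' and \<Sigma>2 \<Delta>2 n2 S S'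
    rule: tm_eq_alg_neu_eq_alg_spine_eq_alg.induct)
  case (4 \<Sigma> \<Delta> n H S H' S')
  then show ?case
    by (subst neu_eq_iff) (auto split: option.split simp del: rec_headed.simps)
qed (auto simp: tm_eq_simps spine_eq_simps)


subsection \<open>Effectiveness of the algorithm\<close>

lemma effective_unfold_neu [effective_intros]:
  "effective f \<Longrightarrow> effective g \<Longrightarrow> effective (\<lambda>e. unfold_neu (f e) (g e))"
  by (rule effective_app2) (unfold unfold_neu_def, intro effective_intros)

definition fv_op :: "(syn \<times> nat \<Rightarrow> nat list option) \<Rightarrow> syn \<times> nat \<Rightarrow> nat list option" where
  "fv_op h = (\<lambda>(z, d). case z of
      Inl M \<Rightarrow> (case M of Neu R \<Rightarrow> h (Inr (Inl R), d) | Lam M \<Rightarrow> h (Inl M, Suc d))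
    | Inr w \<Rightarrow> (case w of
          Inl R \<Rightarrow> (case R of App H S \<Rightarrow> do {
            xs \<leftarrow> h (Inr (Inr S), d);
            Some ((case H of
                Var x \<Rightarrow> if x < d then [] else [x - d] | Con c \<Rightarrow> [] | Rec r \<Rightarrow> []) @ xs) })
        | Inr S \<Rightarrow> (case S of
              SNil \<Rightarrow> Some []
            | SArg M S \<Rightarrow> do { xs \<leftarrow> h (Inl M, d); ys \<leftarrow> h (Inr (Inr S), d); Some (xs @ ys) }
            | SPre y S \<Rightarrow> do {
                ys \<leftarrow> h (Inr (Inr S), d); Some ((if y < d then [] else [y - d]) @ ys) })))"

lemma fv_op_fixpoint:
  assumes h: "\<And>z. h z = fv_op h z"
  shows "h (Inl M, d) = Some (fv_tm M d)"
    and "h (Inr (Inl R), d) = Some (fv_neu R d)"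
    and "h (Inr (Inr S), d) = Some (fv_spine S d)"
  by (induction M and R and S arbitrary: d and d and d) (subst h, simp add: fv_op_def)+

lemma effective_fv_neu [effective_intros]:
  fixes R :: "'e::godel_enum \<Rightarrow> neu"
  assumes "effective R" "effective d"
  shows "effective (\<lambda>e. fv_neu (R e) (d e))"
proof (rule effective_rec)
  show "effective_op fv_op" unfolding fv_op_def by (intro effective_intros)
  show "effective (\<lambda>e. (Inr (Inl (R e)) :: syn, d e))" by (intro effective_intros assms)
qed (rule fv_op_fixpoint)

lemma effective_partial_renaming:
  assumes "effective k" "effective n" "effective zs"
  shows "effective (\<lambda>e. partial_renaming (k e) (n e) (set (zs e)))"
  by (rule effective_app3[of "\<lambda>k n zs. partial_renaming k n (set zs)", OF _ assms])
    (unfold partial_renaming_def, intro effective_intros effective_list_all)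

lemma effective_is_renaming_of [effective_intros]:
  "effective f \<Longrightarrow> effective g \<Longrightarrow> effective (\<lambda>e. is_renaming_of (f e) (g e))"
  by (rule effective_app2)
    (unfold is_renaming_of_iff fv_eqn_def skeleton_eqn_def,
      intro effective_intros effective_partial_renaming)

lemma effective_memoised [effective_intros]:
  "effective f \<Longrightarrow> effective g \<Longrightarrow> effective (\<lambda>e. memoised (f e) (g e))"
  by (rule effective_app2) (unfold memoised_def, intro effective_intros effective_list_ex)

type_synonym eq_input = "sig \<times> eqn list \<times> nat \<times> ((tm \<times> tm) + (neu \<times> neu) + (spine \<times> spine))"

definition eq_op :: "(eq_input \<Rightarrow> bool option) \<Rightarrow> eq_input \<Rightarrow> bool option" where
  "eq_op h = (\<lambda>(\<Sigma>, \<Delta>, n, z). case z of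
      Inl (M, M') \<Rightarrow> (case M of
          Neu R \<Rightarrow> (case M' of Neu R' \<Rightarrow> h (\<Sigma>, \<Delta>, n, Inr (Inl (R, R'))) | Lam N' \<Rightarrow> Some False)
        | Lam N \<Rightarrow> (case M' of Neu R' \<Rightarrow> Some False | Lam N' \<Rightarrow> h (\<Sigma>, \<Delta>, Suc n, Inl (N, N'))))
    | Inr w \<Rightarrow> (case w of
          Inl (R, R') \<Rightarrow>
            if memoised \<Delta> (n, R, R') then Some True
            else if rec_headed R then (case unfold_neu \<Sigma> R of
                None \<Rightarrow> Some False
              | Some Q \<Rightarrow> h (\<Sigma>, (n, R, R') # \<Delta>, n, Inr (Inl (Q, R'))))
            else if rec_headed R' then (case unfold_neu \<Sigma> R' of
                None \<Rightarrow> Some False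
              | Some Q \<Rightarrow> h (\<Sigma>, (n, R, R') # \<Delta>, n, Inr (Inl (R, Q))))
            else (case R of App H S \<Rightarrow> (case R' of App H' S' \<Rightarrow>
              if H = H' \<and> head_in_scope n H then h (\<Sigma>, \<Delta>, n, Inr (Inr (S, S'))) else Some False))
        | Inr (S, S') \<Rightarrow> (case S of
              SNil \<Rightarrow> Some (S' = SNil)
            | SArg M T \<Rightarrow> (case S' of
                  SNil \<Rightarrow> Some False
                | SArg M' T' \<Rightarrow> do {
                    b \<leftarrow> h (\<Sigma>, \<Delta>, n, Inl (M, M'));
                    if b then h (\<Sigma>, \<Delta>, n, Inr (Inr (T, T'))) else Some False }
                | SPre y' T' \<Rightarrow> Some False)
            | SPre y T \<Rightarrow> (case S' of
                  SNil \<Rightarrow> Some False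
                | SArg M' T' \<Rightarrow> Some False
                | SPre y' T' \<Rightarrow> if y = y' \<and> y < n then h (\<Sigma>, \<Delta>, n, Inr (Inr (T, T')))
                    else Some False))))"

lemma eq_op_fixpoint:
  assumes h: "\<And>z. h z = eq_op h z"
  shows "h (\<Sigma>, \<Delta>, n, Inl (M, M')) = Some (tm_eq_alg \<Sigma> \<Delta> n M M')"
    and "h (\<Sigma>1, \<Delta>1, n1, Inr (Inl (R, R'))) = Some (neu_eq_alg \<Sigma>1 \<Delta>1 n1 R R')"
    and "h (\<Sigma>2, \<Delta>2, n2, Inr (Inr (S, S'))) = Some (spine_eq_alg \<Sigma>2 \<Delta>2 n2 S S')"
proof (induction \<Sigma> \<Delta> n M M' and \<Sigma>1 \<Delta>1 n1 R R' and \<Sigma>2 \<Delta>2 n2 S S'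
    rule: tm_eq_alg_neu_eq_alg_spine_eq_alg.induct)
  case (4 \<Sigma> \<Delta> n H S H' S')
  then show ?case
    by (subst h) (auto simp: eq_op_def split: option.split simp del: rec_headed.simps)
qed (subst h, simp add: eq_op_def)+

lemma effective_head_in_scope [effective_intros]:
  "effective f \<Longrightarrow> effective g \<Longrightarrow> effective (\<lambda>e. head_in_scope (f e) (g e))"
  by (rule effective_app2) (unfold head_in_scope_def, intro effective_intros)

lemma effective_spine_eq [effective_intros]:
  fixes \<Sigma> :: "'e::godel_enum \<Rightarrow> sig"
  assumes "effective \<Sigma>" "effective \<Delta>" "effective n" "effective S" "effective S'"
  shows "effective (\<lambda>e. spine_eq (\<Sigma> e) (\<Delta> e) (n e) (S e) (S' e))"
  unfolding spine_eq_iff_alg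
proof (rule effective_rec)
  show "effective_op eq_op" unfolding eq_op_def by (intro effective_intros)
  show "effective (\<lambda>e. (\<Sigma> e, \<Delta> e, n e, Inr (Inr (S e, S' e))) :: eq_input)"
    by (intro effective_intros assms)
qed (rule eq_op_fixpoint)

lemma aty_eq_iff_case:
  "aty_eq \<Sigma> \<Gamma> P P' \<longleftrightarrow> (case P of Fam a S \<Rightarrow> (case P' of Fam a' S' \<Rightarrow>
    a = a' \<and> spine_eq \<Sigma> [] (length \<Gamma>) S S'))"
  by (cases P; cases P') (auto simp: aty_eq.simps)

lemma effective_aty_eq [effective_intros]:
  assumes "effective \<Sigma>" "effective \<Gamma>" "effective P" "effective P'"
  shows "effective (\<lambda>e. aty_eq (\<Sigma> e) (\<Gamma> e) (P e) (P' e))"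
  by (rule effective_app4[OF _ assms]) (unfold aty_eq_iff_case, intro effective_intros)

lemma effective_ty_eq [effective_intros]:
  assumes "effective \<Sigma>" "effective \<Gamma>" "effective A" "effective A'"
  shows "effective (\<lambda>e. ty_eq (\<Sigma> e) (\<Gamma> e) (A e) (A' e))"
proof (rule effective_rec4[OF _ _ assms])
  let ?F = "\<lambda>h (\<Sigma>, \<Gamma>, A, A'). case A of
      Atom P \<Rightarrow> (case A' of
          Atom P' \<Rightarrow> Some (aty_eq \<Sigma> \<Gamma> P P') | Pi A2' A1' \<Rightarrow> Some False | PrePi A2' A1' \<Rightarrow> Some False)
    | Pi A2 A1 \<Rightarrow> (case A' of
          Atom P' \<Rightarrow> Some False
        | Pi A2' A1' \<Rightarrow> do {
            b \<leftarrow> h (\<Sigma>, \<Gamma>, A2, A2'); if b then h (\<Sigma>, Ord A2 # \<Gamma>, A1, A1') else Some False }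
        | PrePi A2' A1' \<Rightarrow> Some False)
    | PrePi A2 A1 \<Rightarrow> (case A' of
          Atom P' \<Rightarrow> Some False
        | Pi A2' A1' \<Rightarrow> Some False
        | PrePi A2' A1' \<Rightarrow> do {
            b \<leftarrow> h (\<Sigma>, \<Gamma>, A2, A2'); if b then h (\<Sigma>, Pre A2 # \<Gamma>, A1, A1') else Some False })"
  show "effective_op ?F" by (intro effective_intros)
  show "h (\<Sigma>, \<Gamma>, A, A') = Some (ty_eq \<Sigma> \<Gamma> A A')" if "\<And>z. h z = ?F h z" for h \<Sigma> \<Gamma> A A'
    by (induction A arbitrary: \<Gamma> A') (subst that, subst ty_eq.simps, simp split: ty.split)+
qed


section \<open>Decidability of typing\<close>

definition var_ty_option :: "ctx \<Rightarrow> nat \<Rightarrow> ty option" where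
  "var_ty_option \<Gamma> x = do { b \<leftarrow> nth_option \<Gamma> x; Some (ren_ty (binding_ty b) (\<lambda>i. i + Suc x)) }"

definition pre_ty_option :: "ctx \<Rightarrow> nat \<Rightarrow> ty option" where
  "pre_ty_option \<Gamma> x = do {
    b \<leftarrow> nth_option \<Gamma> x; (case b of Ord A \<Rightarrow> None | Pre A \<Rightarrow> Some (ren_ty A (\<lambda>i. i + Suc x))) }"

lemma var_ty_option_eq: "var_ty_option \<Gamma> x = (if x < length \<Gamma> then Some (var_ty \<Gamma> x) else None)"
  by (simp add: var_ty_option_def var_ty_def nth_option_def)

lemma pre_ty_option_eq_Some_iff:
  "pre_ty_option \<Gamma> x = Some A \<longleftrightarrow> x < length \<Gamma> \<and> (\<exists>B. \<Gamma> ! x = Pre B) \<and> A = var_ty \<Gamma> x"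
  by (auto simp: pre_ty_option_def var_ty_def nth_option_def split: binding.splits if_splits)

definition head_ty :: "sig \<Rightarrow> sig \<Rightarrow> bool \<Rightarrow> ctx \<Rightarrow> head \<Rightarrow> ty option" where
  "head_ty \<Xi> \<Sigma> \<delta> \<Gamma> H = (case H of
      Var x \<Rightarrow> var_ty_option \<Gamma> x
    | Con c \<Rightarrow> con_type \<Xi> c
    | Rec r \<Rightarrow> map_option fst (rec_def (rec_scope \<Xi> \<Sigma> \<delta>) r))"

lemma synth_neu_iff_head_ty:
  "synth_neu \<Xi> \<Sigma> \<delta> \<Gamma> (App H S) P \<longleftrightarrow> (\<exists>A. head_ty \<Xi> \<Sigma> \<delta> \<Gamma> H = Some A \<and> ty_spine \<Xi> \<Sigma> \<delta> \<Gamma> S A P)"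
  by (subst synth_neu.simps, cases H) (auto simp: head_ty_def var_ty_option_eq)


subsection \<open>Terms and spines\<close>

fun check_tm_alg :: "sig \<Rightarrow> sig \<Rightarrow> bool \<Rightarrow> ctx \<Rightarrow> tm \<Rightarrow> ty \<Rightarrow> bool"
  and ty_spine_alg :: "sig \<Rightarrow> sig \<Rightarrow> bool \<Rightarrow> ctx \<Rightarrow> spine \<Rightarrow> ty \<Rightarrow> aty option" where
  "check_tm_alg \<Xi> \<Sigma> \<delta> \<Gamma> (Lam M) (Pi A2 A1) = check_tm_alg \<Xi> \<Sigma> \<delta> (Ord A2 # \<Gamma>) M A1"
| "check_tm_alg \<Xi> \<Sigma> \<delta> \<Gamma> (Lam M) (PrePi A2 A1) = check_tm_alg \<Xi> \<Sigma> \<delta> (Pre A2 # \<Gamma>) M A1"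
| "check_tm_alg \<Xi> \<Sigma> \<delta> \<Gamma> (Neu (App H S)) (Atom P) = (case head_ty \<Xi> \<Sigma> \<delta> \<Gamma> H of
      None \<Rightarrow> False
    | Some A \<Rightarrow> (case ty_spine_alg \<Xi> \<Sigma> \<delta> \<Gamma> S A of None \<Rightarrow> False | Some P' \<Rightarrow> aty_eq \<Sigma> \<Gamma> P' P))"
| "check_tm_alg \<Xi> \<Sigma> \<delta> \<Gamma> M A = False"
| "ty_spine_alg \<Xi> \<Sigma> \<delta> \<Gamma> SNil (Atom P) = Some P"
| "ty_spine_alg \<Xi> \<Sigma> \<delta> \<Gamma> (SArg M S) (Pi A2 A1) = (if check_tm_alg \<Xi> \<Sigma> \<delta> \<Gamma> M A2
    then (case hsub_ty (erase A2) 0 M A1 of None \<Rightarrow> None | Some A1' \<Rightarrow> ty_spine_alg \<Xi> \<Sigma> \<delta> \<Gamma> S A1')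
    else None)"
| "ty_spine_alg \<Xi> \<Sigma> \<delta> \<Gamma> (SPre y S) (PrePi A2 A1) = (case pre_ty_option \<Gamma> y of
      None \<Rightarrow> None
    | Some A \<Rightarrow> if ty_eq \<Sigma> \<Gamma> A A2 then ty_spine_alg \<Xi> \<Sigma> \<delta> \<Gamma> S (ren_ty A1 (inst y)) else None)"
| "ty_spine_alg \<Xi> \<Sigma> \<delta> \<Gamma> S A = None"

lemma check_tm_simps:
  "check_tm \<Xi> \<Sigma> \<delta> \<Gamma> (Lam M) (Pi A2 A1) \<longleftrightarrow> check_tm \<Xi> \<Sigma> \<delta> (Ord A2 # \<Gamma>) M A1"
  "check_tm \<Xi> \<Sigma> \<delta> \<Gamma> (Lam M) (PrePi A2 A1) \<longleftrightarrow> check_tm \<Xi> \<Sigma> \<delta> (Pre A2 # \<Gamma>) M A1"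
  "check_tm \<Xi> \<Sigma> \<delta> \<Gamma> (Neu R) (Atom P) \<longleftrightarrow> (\<exists>P'. synth_neu \<Xi> \<Sigma> \<delta> \<Gamma> R P' \<and> aty_eq \<Sigma> \<Gamma> P' P)"
  "\<not> check_tm \<Xi> \<Sigma> \<delta> \<Gamma> (Lam M) (Atom P)"
  "\<not> check_tm \<Xi> \<Sigma> \<delta> \<Gamma> (Neu R) (Pi A2 A1)" "\<not> check_tm \<Xi> \<Sigma> \<delta> \<Gamma> (Neu R) (PrePi A2 A1)"
  by (subst check_tm.simps, simp)+

lemma ty_spine_simps:
  "ty_spine \<Xi> \<Sigma> \<delta> \<Gamma> SNil (Atom Q) P \<longleftrightarrow> P = Q"
  "\<not> ty_spine \<Xi> \<Sigma> \<delta> \<Gamma> SNil (Pi A2 A1) P" "\<not> ty_spine \<Xi> \<Sigma> \<delta> \<Gamma> SNil (PrePi A2 A1) P"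
  "ty_spine \<Xi> \<Sigma> \<delta> \<Gamma> (SArg M S) (Pi A2 A1) P \<longleftrightarrow> check_tm \<Xi> \<Sigma> \<delta> \<Gamma> M A2 \<and>
    (\<exists>A1'. hsub_ty (erase A2) 0 M A1 = Some A1' \<and> ty_spine \<Xi> \<Sigma> \<delta> \<Gamma> S A1' P)"
  "\<not> ty_spine \<Xi> \<Sigma> \<delta> \<Gamma> (SArg M S) (Atom Q) P" "\<not> ty_spine \<Xi> \<Sigma> \<delta> \<Gamma> (SArg M S) (PrePi A2 A1) P"
  "ty_spine \<Xi> \<Sigma> \<delta> \<Gamma> (SPre y S) (PrePi A2 A1) P \<longleftrightarrow> (\<exists>A. pre_ty_option \<Gamma> y = Some A \<and> ty_eq \<Sigma> \<Gamma> A A2) \<and>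
    ty_spine \<Xi> \<Sigma> \<delta> \<Gamma> S (ren_ty A1 (inst y)) P"
  "\<not> ty_spine \<Xi> \<Sigma> \<delta> \<Gamma> (SPre y S) (Atom Q) P" "\<not> ty_spine \<Xi> \<Sigma> \<delta> \<Gamma> (SPre y S) (Pi A2 A1) P"
  by (subst ty_spine.simps, simp add: pre_ty_option_eq_Some_iff, blast?)+

lemma
  shows check_tm_iff_alg: "check_tm \<Xi> \<Sigma> \<delta> \<Gamma> M A \<longleftrightarrow> check_tm_alg \<Xi> \<Sigma> \<delta> \<Gamma> M A"
    and ty_spine_iff_alg: "ty_spine \<Xi>' \<Sigma>' \<delta>' \<Gamma>' S A' P \<longleftrightarrow> ty_spine_alg \<Xi>' \<Sigma>' \<delta>' \<Gamma>' S A' = Some P"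
  by (induction \<Xi> \<Sigma> \<delta> \<Gamma> M A and \<Xi>' \<Sigma>' \<delta>' \<Gamma>' S A' arbitrary: and P
    rule: check_tm_alg_ty_spine_alg.induct)
    (auto simp: check_tm_simps ty_spine_simps synth_neu_iff_head_ty split: option.split)

definition synth_neu_alg :: "sig \<Rightarrow> sig \<Rightarrow> bool \<Rightarrow> ctx \<Rightarrow> neu \<Rightarrow> aty option" where
  "synth_neu_alg \<Xi> \<Sigma> \<delta> \<Gamma> R = (case R of App H S \<Rightarrow> do {
    A \<leftarrow> head_ty \<Xi> \<Sigma> \<delta> \<Gamma> H; ty_spine_alg \<Xi> \<Sigma> \<delta> \<Gamma> S A })"

lemma synth_neu_iff_alg: "synth_neu \<Xi> \<Sigma> \<delta> \<Gamma> R P \<longleftrightarrow> synth_neu_alg \<Xi> \<Sigma> \<delta> \<Gamma> R = Some P"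
  by (cases R)
    (simp add: synth_neu_alg_def synth_neu_iff_head_ty ty_spine_iff_alg bind_eq_Some_conv)

lemma binding_ty_eq_case: "binding_ty b = (case b of Ord A \<Rightarrow> A | Pre A \<Rightarrow> A)"
  by (cases b) simp_all

lemma effective_binding_ty [effective_intros]:
  fixes f :: "'e::godel_enum \<Rightarrow> binding"
  shows "effective f \<Longrightarrow> effective (\<lambda>e. binding_ty (f e))"
  unfolding binding_ty_eq_case by (intro effective_intros)

lemma effective_var_ty_option [effective_intros]:
  "effective f \<Longrightarrow> effective g \<Longrightarrow> effective (\<lambda>e. var_ty_option (f e) (g e))"
  by (rule effective_app2) (unfold var_ty_option_def, intro effective_intros)

lemma effective_pre_ty_option [effective_intros]:
  "effective f \<Longrightarrow> effective g \<Longrightarrow> effective (\<lambda>e. pre_ty_option (f e) (g e))"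
  by (rule effective_app2) (unfold pre_ty_option_def, intro effective_intros)

lemma effective_head_ty [effective_intros]:
  assumes "effective \<Xi>" "effective \<Sigma>" "effective \<delta>" "effective \<Gamma>" "effective H"
  shows "effective (\<lambda>e. head_ty (\<Xi> e) (\<Sigma> e) (\<delta> e) (\<Gamma> e) (H e))"
  by (rule effective_app5[OF _ assms]) (unfold head_ty_def rec_scope_def, intro effective_intros)

type_synonym check_input = "sig \<times> sig \<times> bool \<times> ctx \<times> (tm \<times> ty + spine \<times> ty)"

definition check_op ::
    "(check_input \<Rightarrow> (bool + aty option) option) \<Rightarrow> check_input \<Rightarrow> (bool + aty option) option" where
  "check_op h = (\<lambda>(\<Xi>, \<Sigma>, \<delta>, \<Gamma>, q). case q of
      Inl (M, A) \<Rightarrow> (case M of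
          Neu R \<Rightarrow> (case A of
              Atom P \<Rightarrow> (case R of App H S \<Rightarrow> (case head_ty \<Xi> \<Sigma> \<delta> \<Gamma> H of
                  None \<Rightarrow> Some (Inl False)
                | Some B \<Rightarrow> do {
                    r \<leftarrow> h (\<Xi>, \<Sigma>, \<delta>, \<Gamma>, Inr (S, B));
                    (case r of
                        Inl b \<Rightarrow> None
                      | Inr p \<Rightarrow> Some (Inl (case p of None \<Rightarrow> False | Some P' \<Rightarrow> aty_eq \<Sigma> \<Gamma> P' P))) }))
            | Pi A2 A1 \<Rightarrow> Some (Inl False)
            | PrePi A2 A1 \<Rightarrow> Some (Inl False))
        | Lam N \<Rightarrow> (case A of
              Atom P \<Rightarrow> Some (Inl False)
            | Pi A2 A1 \<Rightarrow> h (\<Xi>, \<Sigma>, \<delta>, Ord A2 # \<Gamma>, Inl (N, A1))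
            | PrePi A2 A1 \<Rightarrow> h (\<Xi>, \<Sigma>, \<delta>, Pre A2 # \<Gamma>, Inl (N, A1))))
    | Inr (S, A) \<Rightarrow> (case S of
          SNil \<Rightarrow> (case A of
              Atom P \<Rightarrow> Some (Inr (Some P))
            | Pi A2 A1 \<Rightarrow> Some (Inr None)
            | PrePi A2 A1 \<Rightarrow> Some (Inr None))
        | SArg M T \<Rightarrow> (case A of
              Atom P \<Rightarrow> Some (Inr None)
            | Pi A2 A1 \<Rightarrow> do {
                r \<leftarrow> h (\<Xi>, \<Sigma>, \<delta>, \<Gamma>, Inl (M, A2));
                (case r of
                    Inl b \<Rightarrow> if b then (case hsub_ty (erase A2) 0 M A1 of
                        None \<Rightarrow> Some (Inr None)
                      | Some A1' \<Rightarrow> h (\<Xi>, \<Sigma>, \<delta>, \<Gamma>, Inr (T, A1')))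
                    else Some (Inr None)
                  | Inr p \<Rightarrow> None) }
            | PrePi A2 A1 \<Rightarrow> Some (Inr None))
        | SPre y T \<Rightarrow> (case A of
              Atom P \<Rightarrow> Some (Inr None)
            | Pi A2 A1 \<Rightarrow> Some (Inr None)
            | PrePi A2 A1 \<Rightarrow> (case pre_ty_option \<Gamma> y of
                  None \<Rightarrow> Some (Inr None)
                | Some B \<Rightarrow> if ty_eq \<Sigma> \<Gamma> B A2 then h (\<Xi>, \<Sigma>, \<delta>, \<Gamma>, Inr (T, ren_ty A1 (inst y)))
                    else Some (Inr None)))))"

lemma effective_op_check: "effective_op check_op"
  unfolding check_op_def by (intro effective_intros)

lemma check_op_fixpoint:
  assumes h: "\<And>z. h z = check_op h z"
  shows "h (\<Xi>, \<Sigma>, \<delta>, \<Gamma>, Inl (M, A)) = Some (Inl (check_tm_alg \<Xi> \<Sigma> \<delta> \<Gamma> M A))"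
    and "h (\<Xi>', \<Sigma>', \<delta>', \<Gamma>', Inr (S, A')) = Some (Inr (ty_spine_alg \<Xi>' \<Sigma>' \<delta>' \<Gamma>' S A'))"
  by (induction \<Xi> \<Sigma> \<delta> \<Gamma> M A and \<Xi>' \<Sigma>' \<delta>' \<Gamma>' S A' rule: check_tm_alg_ty_spine_alg.induct)
    (subst h, simp add: check_op_def split: option.split neu.split)+

lemma effective_check_tm_alg [effective_intros]:
  fixes \<Xi> :: "'e::godel_enum \<Rightarrow> sig"
  assumes "effective \<Xi>" "effective \<Sigma>" "effective \<delta>" "effective \<Gamma>" "effective M" "effective A"
  shows "effective (\<lambda>e. check_tm_alg (\<Xi> e) (\<Sigma> e) (\<delta> e) (\<Gamma> e) (M e) (A e))"
proof (rule effective_rec_inj[OF effective_op_check])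
  show "effective (Inl :: bool \<Rightarrow> bool + aty option)" by (intro effective_intros)
  show "effective (\<lambda>e. (\<Xi> e, \<Sigma> e, \<delta> e, \<Gamma> e, Inl (M e, A e)) :: check_input)"
    by (intro effective_intros assms)
qed (simp, rule check_op_fixpoint)

lemma effective_ty_spine_alg [effective_intros]:
  fixes \<Xi> :: "'e::godel_enum \<Rightarrow> sig"
  assumes "effective \<Xi>" "effective \<Sigma>" "effective \<delta>" "effective \<Gamma>" "effective S" "effective A"
  shows "effective (\<lambda>e. ty_spine_alg (\<Xi> e) (\<Sigma> e) (\<delta> e) (\<Gamma> e) (S e) (A e))"
proof (rule effective_rec_inj[OF effective_op_check])
  show "effective (Inr :: aty option \<Rightarrow> bool + aty option)" by (intro effective_intros)
  show "effective (\<lambda>e. (\<Xi> e, \<Sigma> e, \<delta> e, \<Gamma> e, Inr (S e, A e)) :: check_input)"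
    by (intro effective_intros assms)
qed (simp, rule check_op_fixpoint)

lemma effective_check_tm [effective_intros]:
  fixes \<Xi> :: "'e::godel_enum \<Rightarrow> sig"
  assumes "effective \<Xi>" "effective \<Sigma>" "effective \<delta>" "effective \<Gamma>" "effective M" "effective A"
  shows "effective (\<lambda>e. check_tm (\<Xi> e) (\<Sigma> e) (\<delta> e) (\<Gamma> e) (M e) (A e))"
  unfolding check_tm_iff_alg by (intro effective_intros assms)

lemma effective_synth_neu_alg [effective_intros]:
  assumes "effective \<Xi>" "effective \<Sigma>" "effective \<delta>" "effective \<Gamma>" "effective R"
  shows "effective (\<lambda>e. synth_neu_alg (\<Xi> e) (\<Sigma> e) (\<delta> e) (\<Gamma> e) (R e))"
  by (rule effective_app5[OF _ assms]) (unfold synth_neu_alg_def, intro effective_intros)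


subsection \<open>Types, kinds and contexts\<close>

fun kind_spine_alg :: "sig \<Rightarrow> sig \<Rightarrow> bool \<Rightarrow> ctx \<Rightarrow> spine \<Rightarrow> kind \<Rightarrow> kind option" where
  "kind_spine_alg \<Xi> \<Sigma> \<delta> \<Gamma> SNil K = Some K"
| "kind_spine_alg \<Xi> \<Sigma> \<delta> \<Gamma> (SArg M S) (KPi A2 K) = (if check_tm \<Xi> \<Sigma> \<delta> \<Gamma> M A2
    then (case hsub_kind (erase A2) 0 M K of None \<Rightarrow> None | Some K1 \<Rightarrow> kind_spine_alg \<Xi> \<Sigma> \<delta> \<Gamma> S K1)
    else None)"
| "kind_spine_alg \<Xi> \<Sigma> \<delta> \<Gamma> (SPre y S) (KPrePi A2 K) = (case pre_ty_option \<Gamma> y of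
      None \<Rightarrow> None
    | Some A \<Rightarrow> if ty_eq \<Sigma> \<Gamma> A A2 then kind_spine_alg \<Xi> \<Sigma> \<delta> \<Gamma> S (ren_kind K (inst y)) else None)"
| "kind_spine_alg \<Xi> \<Sigma> \<delta> \<Gamma> S K = None"

lemma kind_spine_iff_alg: "kind_spine \<Xi> \<Sigma> \<delta> \<Gamma> S K K' \<longleftrightarrow> kind_spine_alg \<Xi> \<Sigma> \<delta> \<Gamma> S K = Some K'"
proof (induction \<Xi> \<Sigma> \<delta> \<Gamma> S K rule: kind_spine_alg.induct)
  case (2 \<Xi> \<Sigma> \<delta> \<Gamma> M S A2 K)
  then show ?case by (subst kind_spine.simps) (auto split: option.split)
next
  case (3 \<Xi> \<Sigma> \<delta> \<Gamma> y S A2 K)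
  have "kind_spine \<Xi> \<Sigma> \<delta> \<Gamma> (SPre y S) (KPrePi A2 K) K' \<longleftrightarrow>
      (\<exists>A. pre_ty_option \<Gamma> y = Some A \<and> ty_eq \<Sigma> \<Gamma> A A2) \<and>
        kind_spine \<Xi> \<Sigma> \<delta> \<Gamma> S (ren_kind K (inst y)) K'"
    by (subst kind_spine.simps) (auto simp: pre_ty_option_eq_Some_iff)
  with 3 show ?case by (auto split: option.split)
qed (subst kind_spine.simps, force)+

lemma effective_kind_spine_alg [effective_intros]:
  assumes "effective \<Xi>" "effective \<Sigma>" "effective \<delta>" "effective \<Gamma>" "effective S" "effective K"
  shows "effective (\<lambda>e. kind_spine_alg (\<Xi> e) (\<Sigma> e) (\<delta> e) (\<Gamma> e) (S e) (K e))"
proof (rule effective_rec6[OF _ _ assms])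
  let ?F = "\<lambda>h (\<Xi>, \<Sigma>, \<delta>, \<Gamma>, S, K). case S of
      SNil \<Rightarrow> Some (Some K)
    | SArg M T \<Rightarrow> (case K of
          Type \<Rightarrow> Some None
        | Cotype \<Rightarrow> Some None
        | KPi A2 K \<Rightarrow> if check_tm \<Xi> \<Sigma> \<delta> \<Gamma> M A2 then (case hsub_kind (erase A2) 0 M K of
              None \<Rightarrow> Some None | Some K1 \<Rightarrow> h (\<Xi>, \<Sigma>, \<delta>, \<Gamma>, T, K1)) else Some None
        | KPrePi A2 K \<Rightarrow> Some None)
    | SPre y T \<Rightarrow> (case K of
          Type \<Rightarrow> Some None
        | Cotype \<Rightarrow> Some None
        | KPi A2 K \<Rightarrow> Some None
        | KPrePi A2 K \<Rightarrow> (case pre_ty_option \<Gamma> y of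
              None \<Rightarrow> Some None
            | Some A \<Rightarrow> if ty_eq \<Sigma> \<Gamma> A A2 then h (\<Xi>, \<Sigma>, \<delta>, \<Gamma>, T, ren_kind K (inst y))
                else Some None))"
  show "effective_op ?F" by (intro effective_intros)
  show "h (\<Xi>, \<Sigma>, \<delta>, \<Gamma>, S, K) = Some (kind_spine_alg \<Xi> \<Sigma> \<delta> \<Gamma> S K)" if "\<And>z. h z = ?F h z"
    for h \<Xi> \<Sigma> \<delta> \<Gamma> S K
    by (induction \<Xi> \<Sigma> \<delta> \<Gamma> S K rule: kind_spine_alg.induct) (subst that, simp split: option.split)+
qed

definition synth_aty_alg :: "sig \<Rightarrow> sig \<Rightarrow> bool \<Rightarrow> ctx \<Rightarrow> aty \<Rightarrow> kind option" where
  "synth_aty_alg \<Xi> \<Sigma> \<delta> \<Gamma> P = (case P of Fam a S \<Rightarrow> do {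
    K \<leftarrow> fam_kind \<Xi> a; kind_spine_alg \<Xi> \<Sigma> \<delta> \<Gamma> S K })"

lemma synth_aty_iff_alg: "synth_aty \<Xi> \<Sigma> \<delta> \<Gamma> P K \<longleftrightarrow> synth_aty_alg \<Xi> \<Sigma> \<delta> \<Gamma> P = Some K"
  by (cases P, subst synth_aty.simps)
    (auto simp: synth_aty_alg_def kind_spine_iff_alg bind_eq_Some_conv)

lemma effective_synth_aty_alg [effective_intros]:
  assumes "effective \<Xi>" "effective \<Sigma>" "effective \<delta>" "effective \<Gamma>" "effective P"
  shows "effective (\<lambda>e. synth_aty_alg (\<Xi> e) (\<Sigma> e) (\<delta> e) (\<Gamma> e) (P e))"
  by (rule effective_app5[OF _ assms]) (unfold synth_aty_alg_def, intro effective_intros)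

lemma effective_check_ty [effective_intros]:
  assumes "effective \<Xi>" "effective \<Sigma>" "effective \<delta>" "effective \<Gamma>" "effective A"
  shows "effective (\<lambda>e. check_ty (\<Xi> e) (\<Sigma> e) (\<delta> e) (\<Gamma> e) (A e))"
proof (rule effective_rec5[OF _ _ assms])
  let ?F = "\<lambda>h (\<Xi>, \<Sigma>, \<delta>, \<Gamma>, A). case A of
      Atom P \<Rightarrow> Some (synth_aty_alg \<Xi> \<Sigma> \<delta> \<Gamma> P = Some Type \<or> synth_aty_alg \<Xi> \<Sigma> \<delta> \<Gamma> P = Some Cotype)
    | Pi A2 A1 \<Rightarrow> do {
        b \<leftarrow> h (\<Xi>, \<Sigma>, \<delta>, \<Gamma>, A2); if b then h (\<Xi>, \<Sigma>, \<delta>, Ord A2 # \<Gamma>, A1) else Some False }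
    | PrePi A2 A1 \<Rightarrow> do {
        b \<leftarrow> h (\<Xi>, \<Sigma>, \<delta>, \<Gamma>, A2); if b then h (\<Xi>, \<Sigma>, \<delta>, Pre A2 # \<Gamma>, A1) else Some False }"
  show "effective_op ?F" by (intro effective_intros)
  show "h (\<Xi>, \<Sigma>, \<delta>, \<Gamma>, A) = Some (check_ty \<Xi> \<Sigma> \<delta> \<Gamma> A)" if "\<And>z. h z = ?F h z" for h \<Xi> \<Sigma> \<delta> \<Gamma> A
    by (induction A arbitrary: \<Gamma>)
      (subst that, subst check_ty.simps, auto simp: synth_aty_iff_alg)+
qed

lemma effective_check_kind [effective_intros]:
  assumes "effective \<Xi>" "effective \<Sigma>" "effective \<delta>" "effective \<Gamma>" "effective K"
  shows "effective (\<lambda>e. check_kind (\<Xi> e) (\<Sigma> e) (\<delta> e) (\<Gamma> e) (K e))"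
proof (rule effective_rec5[OF _ _ assms])
  let ?F = "\<lambda>h (\<Xi>, \<Sigma>, \<delta>, \<Gamma>, K). case K of
      Type \<Rightarrow> Some True
    | Cotype \<Rightarrow> Some True
    | KPi A K \<Rightarrow> if check_ty \<Xi> \<Sigma> \<delta> \<Gamma> A then h (\<Xi>, \<Sigma>, \<delta>, Ord A # \<Gamma>, K) else Some False
    | KPrePi A K \<Rightarrow> if check_ty \<Xi> \<Sigma> \<delta> \<Gamma> A then h (\<Xi>, \<Sigma>, \<delta>, Pre A # \<Gamma>, K) else Some False"
  show "effective_op ?F" by (intro effective_intros)
  show "h (\<Xi>, \<Sigma>, \<delta>, \<Gamma>, K) = Some (check_kind \<Xi> \<Sigma> \<delta> \<Gamma> K)" if "\<And>z. h z = ?F h z" for h \<Xi> \<Sigma> \<delta> \<Gamma> K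
    by (induction K arbitrary: \<Gamma>) (subst that, subst check_kind.simps, simp)+
qed

lemma ctx_ok_Cons: "ctx_ok \<Xi> \<Sigma> \<delta> (b # \<Gamma>) \<longleftrightarrow> check_ty \<Xi> \<Sigma> \<delta> \<Gamma> (binding_ty b) \<and> ctx_ok \<Xi> \<Sigma> \<delta> \<Gamma>"
  by (subst ctx_ok.simps) (cases b; auto)

lemma effective_ctx_ok [effective_intros]:
  assumes "effective \<Xi>" "effective \<Sigma>" "effective \<delta>" "effective \<Gamma>"
  shows "effective (\<lambda>e. ctx_ok (\<Xi> e) (\<Sigma> e) (\<delta> e) (\<Gamma> e))"
proof (rule effective_rec4[OF _ _ assms])
  let ?F = "\<lambda>h (\<Xi>, \<Sigma>, \<delta>, \<Gamma>). case \<Gamma> of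
      [] \<Rightarrow> Some True
    | b # \<Gamma> \<Rightarrow> if check_ty \<Xi> \<Sigma> \<delta> \<Gamma> (binding_ty b) then h (\<Xi>, \<Sigma>, \<delta>, \<Gamma>) else Some False"
  show "effective_op ?F" by (intro effective_intros)
  show "h (\<Xi>, \<Sigma>, \<delta>, \<Gamma>) = Some (ctx_ok \<Xi> \<Sigma> \<delta> \<Gamma>)" if "\<And>z. h z = ?F h z" for h \<Xi> \<Sigma> \<delta> \<Gamma>
    by (induction \<Gamma>) (subst that, simp add: ctx_ok_Cons ctx_ok.intros)+
qed


section \<open>Decidability of guardedness\<close>

subsection \<open>Exploring a finite set of states\<close>

abbreviation reachable :: "('a \<Rightarrow> 'a list) \<Rightarrow> 'a \<Rightarrow> 'a \<Rightarrow> bool" where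
  "reachable f \<equiv> (\<lambda>x y. y \<in> set (f x))\<^sup>*\<^sup>*"

lemma exploration_eq:
  assumes h: "\<And>V. h V = (if set (concat (map f V)) \<subseteq> set V then Some (\<forall>y\<in>set V. P y)
      else h (concat (map f V) @ V))"
    and finite: "finite {y. reachable f x y}"
    and "x \<in> set V" "set V \<subseteq> {y. reachable f x y}"
  shows "h V = Some (\<forall>y. reachable f x y \<longrightarrow> P y)"
  using assms(3,4)
proof (induction "card ({y. reachable f x y} - set V)" arbitrary: V rule: less_induct)
  case less
  let ?W = "concat (map f V)"
  show ?case
  proof (cases "set ?W \<subseteq> set V")
    case closed: True
    have "y \<in> set V" if "reachable f x y" for y
      using that by induction (use less.prems(1) closed in auto)
    with less.prems(2) have "set V = {y. reachable f x y}" by blast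
    with closed show ?thesis by (subst h) simp
  next
    case False
    have "set (?W @ V) \<subseteq> {y. reachable f x y}"
      using less.prems(2) by (auto intro: rtranclp.rtrancl_into_rtrancl)
    moreover from this False have
      "card ({y. reachable f x y} - set (?W @ V)) < card ({y. reachable f x y} - set V)"
      by (intro psubset_card_mono finite_Diff finite) auto
    ultimately have "h (?W @ V) = Some (\<forall>y. reachable f x y \<longrightarrow> P y)"
      using less.prems(1) by (intro less.hyps) auto
    with False show ?thesis by (subst h) (simp only: if_False)
  qed
qed

lemma effective_all_reachable:
  fixes f :: "'e::godel_enum \<Rightarrow> 'a::godel_enum \<Rightarrow> 'a list"
  assumes f: "effective (\<lambda>p. f (fst p) (snd p))" and P: "effective (\<lambda>p. P (fst p) (snd p))"
    and x: "effective x" and finite: "\<And>e. finite {y. reachable (f e) (x e) y}"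
  shows "effective (\<lambda>e. \<forall>y. reachable (f e) (x e) y \<longrightarrow> P e y)"
proof (rule effective_rec)
  let ?F = "\<lambda>h (e, V). if \<forall>y\<in>set (concat (map (f e) V)). y \<in> set V then Some (\<forall>y\<in>set V. P e y)
    else h (e, concat (map (f e) V) @ V)"
  show "effective_op ?F"
    by (intro effective_intros effective_list_all effective_concat_map
        effective_app2[OF f[folded split_beta]] effective_app2[OF P[folded split_beta]])
  show "effective (\<lambda>e. (e, [x e]))" by (intro effective_intros x)
  show "h (e, [x e]) = Some (\<forall>y. reachable (f e) (x e) y \<longrightarrow> P e y)" if "\<And>z. h z = ?F h z" for h e
  proof (rule exploration_eq[where h = "\<lambda>V. h (e, V)", OF _ finite])
    show "h (e, V) = (if set (concat (map (f e) V)) \<subseteq> set V then Some (\<forall>y\<in>set V. P e y)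
        else h (e, concat (map (f e) V) @ V))" for V
      by (subst that) (simp only: prod.case subset_iff Ball_def)
  qed simp_all
qed


subsection \<open>Paths to a recursion constant\<close>

definition path_successors :: "sig \<Rightarrow> nat \<Rightarrow> syn \<Rightarrow> syn list" where
  "path_successors \<Sigma> r q = (case q of
      Inl M \<Rightarrow> (case M of Neu R \<Rightarrow> [Inr (Inl R)] | Lam N \<Rightarrow> [Inl N])
    | Inr q \<Rightarrow> (case q of
          Inl R \<Rightarrow> (case R of App H S \<Rightarrow> Inr (Inr S) # (case H of
              Var x \<Rightarrow> []
            | Con c \<Rightarrow> []
            | Rec r' \<Rightarrow> if r' = r then []
              else (case rec_def \<Sigma> r' of None \<Rightarrow> [] | Some d \<Rightarrow> [Inl (snd d)])))
        | Inr S \<Rightarrow> (case S of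
              SNil \<Rightarrow> []
            | SArg M T \<Rightarrow> [Inl M, Inr (Inr T)]
            | SPre y T \<Rightarrow> [Inr (Inr T)])))"

definition head_at :: "syn \<Rightarrow> head option" where
  "head_at q = (case q of
      Inl M \<Rightarrow> None
    | Inr q \<Rightarrow> (case q of Inl R \<Rightarrow> (case R of App H S \<Rightarrow> Some H) | Inr S \<Rightarrow> None))"

definition con_at :: "syn \<Rightarrow> nat option" where
  "con_at q = (case head_at q of
      None \<Rightarrow> None
    | Some H \<Rightarrow> (case H of Var x \<Rightarrow> None | Con c \<Rightarrow> Some c | Rec r \<Rightarrow> None))"

inductive rec_path :: "sig \<Rightarrow> nat \<Rightarrow> syn \<Rightarrow> nat list \<Rightarrow> bool" for \<Sigma> r where
  rec_path_end: "head_at q = Some (Rec r) \<Longrightarrow> rec_path \<Sigma> r q []"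
| rec_path_con: "con_at q = Some c \<Longrightarrow> q' \<in> set (path_successors \<Sigma> r q) \<Longrightarrow> rec_path \<Sigma> r q' cs \<Longrightarrow>
    rec_path \<Sigma> r q (c # cs)"
| rec_path_step: "con_at q = None \<Longrightarrow> q' \<in> set (path_successors \<Sigma> r q) \<Longrightarrow> rec_path \<Sigma> r q' cs \<Longrightarrow>
    rec_path \<Sigma> r q cs"

lemma rec_path_if_path:
  "path_tm \<Sigma> r M cs \<Longrightarrow> rec_path \<Sigma> r (Inl M) cs"
  "path_neu \<Sigma> r R cs \<Longrightarrow> rec_path \<Sigma> r (Inr (Inl R)) cs"
  "path_spine \<Sigma> r S cs \<Longrightarrow> rec_path \<Sigma> r (Inr (Inr S)) cs"
  by (induction rule: path_tm_path_neu_path_spine.inducts)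
    (auto simp: head_at_def con_at_def path_successors_def intro: rec_path.intros)

lemma path_if_rec_path:
  "rec_path \<Sigma> r q cs \<Longrightarrow>
    (case q of Inl M \<Rightarrow> path_tm \<Sigma> r M cs | Inr (Inl R) \<Rightarrow> path_neu \<Sigma> r R cs
      | Inr (Inr S) \<Rightarrow> path_spine \<Sigma> r S cs)"
proof (induction rule: rec_path.induct)
  case (rec_path_end q)
  then show ?case
    by (auto simp: head_at_def split: sum.splits neu.splits
      intro: path_tm_path_neu_path_spine.intros)
next
  case (rec_path_con q c q' cs)
  then show ?case
    by (auto simp: head_at_def con_at_def path_successors_def
      split: sum.splits neu.splits head.splits
        intro: path_tm_path_neu_path_spine.intros)
next
  case (rec_path_step q q' cs)
  then show ?case
    by (auto simp: head_at_def con_at_def path_successors_def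
        split: sum.splits tm.splits neu.splits spine.splits head.splits option.splits if_splits
        intro: path_tm_path_neu_path_spine.intros)
qed

lemma path_tm_iff_rec_path: "path_tm \<Sigma> r M cs \<longleftrightarrow> rec_path \<Sigma> r (Inl M) cs"
  using rec_path_if_path(1) path_if_rec_path[of \<Sigma> r "Inl M" cs] by auto


subsection \<open>The search space\<close>

text \<open>Only the set of constructors on a path matters; keeping the list of constructors passed so
  far free of repetitions makes the search space finite.\<close>

definition search_successors :: "sig \<Rightarrow> nat \<Rightarrow> syn \<times> nat list \<Rightarrow> (syn \<times> nat list) list" where
  "search_successors \<Sigma> r z =
    map (\<lambda>q. (q, case con_at (fst z) of None \<Rightarrow> snd z | Some c \<Rightarrow> List.insert c (snd z)))
      (path_successors \<Sigma> r (fst z))"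

lemma reachable_if_rec_path:
  "rec_path \<Sigma> r q cs \<Longrightarrow> \<exists>z. reachable (search_successors \<Sigma> r) (q, ds) z \<and>
    head_at (fst z) = Some (Rec r) \<and> set (snd z) = set ds \<union> set cs"
proof (induction arbitrary: ds rule: rec_path.induct)
  case (rec_path_end q)
  then show ?case by (intro exI[of _ "(q, ds)"]) simp
next
  case (rec_path_con q c q' cs)
  from rec_path_con.IH[of "List.insert c ds"] obtain z where
    "reachable (search_successors \<Sigma> r) (q', List.insert c ds) z"
    "head_at (fst z) = Some (Rec r)" "set (snd z) = set ds \<union> set (c # cs)" by auto
  moreover have "(q', List.insert c ds) \<in> set (search_successors \<Sigma> r (q, ds))"
    using rec_path_con.hyps by (simp add: search_successors_def)
  ultimately show ?case by (blast intro: converse_rtranclp_into_rtranclp)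
next
  case (rec_path_step q q' cs)
  then have "(q', ds) \<in> set (search_successors \<Sigma> r (q, ds))" by (simp add: search_successors_def)
  with rec_path_step.IH[of ds] show ?case by (blast intro: converse_rtranclp_into_rtranclp)
qed

lemma rec_path_if_reachable:
  "reachable (search_successors \<Sigma> r) y z \<Longrightarrow> head_at (fst z) = Some (Rec r) \<Longrightarrow>
    \<exists>cs. rec_path \<Sigma> r (fst y) cs \<and> set (snd z) = set (snd y) \<union> set cs"
proof (induction rule: converse_rtranclp_induct)
  case base
  then show ?case by (intro exI[of _ "[]"]) (simp add: rec_path_end)
next
  case (step x y)
  then obtain cs where cs: "rec_path \<Sigma> r (fst y) cs" "set (snd z) = set (snd y) \<union> set cs" by blast
  have y: "fst y \<in> set (path_successors \<Sigma> r (fst x))"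
    "snd y = (case con_at (fst x) of None \<Rightarrow> snd x | Some c \<Rightarrow> List.insert c (snd x))"
    using step.hyps(1) by (auto simp: search_successors_def)
  show ?case
  proof (cases "con_at (fst x)")
    case None
    with cs(2) y(2) rec_path_step[OF None y(1) cs(1)] show ?thesis by auto
  next
    case (Some c)
    with cs(2) y(2) rec_path_con[OF Some y(1) cs(1)] show ?thesis
      by (intro exI[of _ "c # cs"]) simp
  qed
qed

definition guarding :: "sig \<Rightarrow> nat list \<Rightarrow> bool" where
  "guarding \<Sigma> cs \<longleftrightarrow> (\<exists>c\<in>set cs. coinductive_con \<Sigma> c \<and>
     (\<exists>p. con_prio \<Sigma> c = Some p \<and> (\<forall>c'\<in>set cs. \<exists>p'. con_prio \<Sigma> c' = Some p' \<and> p' \<le> p)))"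

lemma guarding_cong: "set cs = set ds \<Longrightarrow> guarding \<Sigma> cs \<longleftrightarrow> guarding \<Sigma> ds"
  by (simp add: guarding_def)

lemma guarded_iff_reachable:
  "guarded \<Sigma> r M \<longleftrightarrow> (\<forall>z. reachable (search_successors \<Sigma> r) (Inl M, []) z \<longrightarrow>
    head_at (fst z) = Some (Rec r) \<longrightarrow> guarding \<Sigma> (snd z))"
proof -
  have "guarded \<Sigma> r M \<longleftrightarrow> (\<forall>cs. rec_path \<Sigma> r (Inl M) cs \<longrightarrow> guarding \<Sigma> cs)"
    unfolding guarded_def guarding_def path_tm_iff_rec_path ..
  also have "\<dots> \<longleftrightarrow> (\<forall>z. reachable (search_successors \<Sigma> r) (Inl M, []) z \<longrightarrow>
      head_at (fst z) = Some (Rec r) \<longrightarrow> guarding \<Sigma> (snd z))"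
  proof (intro iffI allI impI)
    fix z assume guarding: "\<forall>cs. rec_path \<Sigma> r (Inl M) cs \<longrightarrow> guarding \<Sigma> cs"
      and z: "reachable (search_successors \<Sigma> r) (Inl M, []) z" "head_at (fst z) = Some (Rec r)"
    from rec_path_if_reachable[OF z] obtain cs where
      "rec_path \<Sigma> r (Inl M) cs" "set (snd z) = set cs" by auto
    with guarding guarding_cong show "guarding \<Sigma> (snd z)" by blast
  next
    fix cs assume guarding: "\<forall>z. reachable (search_successors \<Sigma> r) (Inl M, []) z \<longrightarrow>
        head_at (fst z) = Some (Rec r) \<longrightarrow> guarding \<Sigma> (snd z)"
      and "rec_path \<Sigma> r (Inl M) cs"
    from reachable_if_rec_path[OF this(2), of "[]"] obtain z where
      "reachable (search_successors \<Sigma> r) (Inl M, []) z" "head_at (fst z) = Some (Rec r)"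
      "set (snd z) = set cs" by auto
    with guarding guarding_cong show "guarding \<Sigma> cs" by blast
  qed
  finally show ?thesis .
qed

primrec subterms_tm :: "tm \<Rightarrow> syn set"
  and subterms_neu :: "neu \<Rightarrow> syn set"
  and subterms_spine :: "spine \<Rightarrow> syn set" where
  "subterms_tm (Neu R) = insert (Inl (Neu R)) (subterms_neu R)"
| "subterms_tm (Lam M) = insert (Inl (Lam M)) (subterms_tm M)"
| "subterms_neu (App H S) = insert (Inr (Inl (App H S))) (subterms_spine S)"
| "subterms_spine SNil = {Inr (Inr SNil)}"
| "subterms_spine (SArg M S) = insert (Inr (Inr (SArg M S))) (subterms_tm M \<union> subterms_spine S)"
| "subterms_spine (SPre y S) = insert (Inr (Inr (SPre y S))) (subterms_spine S)"

lemma finite_subterms [simp]: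
  "finite (subterms_tm M)" "finite (subterms_neu R)" "finite (subterms_spine S)"
  by (induction M and R and S) auto

lemma subterms_refl [simp]:
  "Inl M \<in> subterms_tm M" "Inr (Inl R) \<in> subterms_neu R" "Inr (Inr S) \<in> subterms_spine S"
  by (cases M, simp_all) (cases R, simp_all, cases S, simp_all)

definition body_subterms :: "sig \<Rightarrow> syn set" where
  "body_subterms \<Sigma> = (\<Union>M\<in>bodies \<Sigma>. subterms_tm M)"

lemma finite_body_subterms [simp]: "finite (body_subterms \<Sigma>)"
  by (simp add: body_subterms_def)

lemma rec_def_in_body_subterms: "rec_def \<Sigma> r = Some (A, M) \<Longrightarrow> Inl M \<in> body_subterms \<Sigma>"
  using rec_def_in_bodies subterms_refl(1) unfolding body_subterms_def by blast

lemma path_successors_subterms: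
  "q \<in> subterms_tm M \<Longrightarrow> set (path_successors \<Sigma> r q) \<subseteq> subterms_tm M \<union> body_subterms \<Sigma>"
  "q \<in> subterms_neu R \<Longrightarrow> set (path_successors \<Sigma> r q) \<subseteq> subterms_neu R \<union> body_subterms \<Sigma>"
  "q \<in> subterms_spine S \<Longrightarrow> set (path_successors \<Sigma> r q) \<subseteq> subterms_spine S \<union> body_subterms \<Sigma>"
proof (induction M and R and S)
  case (App H S)
  from App.prems consider (root) "q = Inr (Inl (App H S))" | (below) "q \<in> subterms_spine S" by auto
  then show ?case
  proof cases
    case root
    then show ?thesis
      by (cases H)
        (auto simp: path_successors_def split: option.split dest: rec_def_in_body_subterms[OF sym])
  qed (use App.IH in auto)
qed (auto simp: path_successors_def)

lemma path_successors_body_subterms: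
  assumes "q \<in> body_subterms \<Sigma>"
  shows "set (path_successors \<Sigma> r q) \<subseteq> body_subterms \<Sigma>"
proof -
  from assms obtain M where "q \<in> subterms_tm M" "subterms_tm M \<subseteq> body_subterms \<Sigma>"
    unfolding body_subterms_def by blast
  with path_successors_subterms(1)[of q M \<Sigma> r] show ?thesis by blast
qed

lemma finite_search_space: "finite {z. reachable (search_successors \<Sigma> r) (Inl M, []) z}"
proof -
  define U where "U = subterms_tm M \<union> body_subterms \<Sigma>"
  define C where "C = Some -` (con_at ` U)"
  have U_closed: "set (path_successors \<Sigma> r q) \<subseteq> U" if "q \<in> U" for q
    using that path_successors_subterms(1)[of q M \<Sigma> r] path_successors_body_subterms[of q \<Sigma> r]
    unfolding U_def by blast
  have con_in_C: "c \<in> C" if "q \<in> U" "con_at q = Some c" for q c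
    using that unfolding C_def by (auto intro: rev_image_eqI)
  have "fst z \<in> U \<and> distinct (snd z) \<and> set (snd z) \<subseteq> C"
    if "reachable (search_successors \<Sigma> r) (Inl M, []) z" for z
    using that
  proof induction
    case base
    show ?case by (simp add: U_def)
  next
    case (step y z)
    then have "fst z \<in> set (path_successors \<Sigma> r (fst y))"
      "snd z = (case con_at (fst y) of None \<Rightarrow> snd y | Some c \<Rightarrow> List.insert c (snd y))"
      by (auto simp: search_successors_def)
    with step.IH U_closed con_in_C show ?case by (auto split: option.split)
  qed
  then have "{z. reachable (search_successors \<Sigma> r) (Inl M, []) z} \<subseteq>
      U \<times> {cs. set cs \<subseteq> C \<and> distinct cs}"
    by (simp add: subset_iff mem_Times_iff)
  moreover have "finite (U \<times> {cs. set cs \<subseteq> C \<and> distinct cs})"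
    by (intro finite_SigmaI finite_subset_distinct) (simp_all add: U_def C_def finite_vimageI)
  ultimately show ?thesis by (rule finite_subset)
qed


subsection \<open>The decision procedure\<close>

lemma effective_head_at [effective_intros]: "effective q \<Longrightarrow> effective (\<lambda>e. head_at (q e))"
  by (erule effective_compose[rotated]) (unfold head_at_def, intro effective_intros)

lemma effective_con_at [effective_intros]: "effective q \<Longrightarrow> effective (\<lambda>e. con_at (q e))"
  by (erule effective_compose[rotated]) (unfold con_at_def, intro effective_intros)

lemma effective_path_successors [effective_intros]:
  assumes "effective \<Sigma>" "effective r" "effective q"
  shows "effective (\<lambda>e. path_successors (\<Sigma> e) (r e) (q e))"
  by (rule effective_app3[OF _ assms]) (unfold path_successors_def, intro effective_intros)

lemma effective_search_successors [effective_intros]: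
  assumes "effective \<Sigma>" "effective r" "effective z"
  shows "effective (\<lambda>e. search_successors (\<Sigma> e) (r e) (z e))"
  by (rule effective_app3[OF _ assms])
    (unfold search_successors_def, intro effective_intros effective_map)

lemma effective_con_prio [effective_intros]:
  "effective \<Sigma> \<Longrightarrow> effective c \<Longrightarrow> effective (\<lambda>e. con_prio (\<Sigma> e) (c e))"
  by (rule effective_app2) (unfold con_prio_def, intro effective_intros)

lemma coinductive_con_eq_case:
  "coinductive_con \<Sigma> c \<longleftrightarrow> (case con_type \<Sigma> c of
      None \<Rightarrow> False
    | Some A \<Rightarrow> (case fam_kind \<Sigma> (target A) of None \<Rightarrow> False | Some K \<Rightarrow> cotype_kind K))"
  by (auto simp: coinductive_con_def split: option.split)

lemma effective_coinductive_con [effective_intros]: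
  "effective \<Sigma> \<Longrightarrow> effective c \<Longrightarrow> effective (\<lambda>e. coinductive_con (\<Sigma> e) (c e))"
  by (rule effective_app2) (unfold coinductive_con_eq_case, intro effective_intros)

lemma guarding_eq_case:
  "guarding \<Sigma> cs \<longleftrightarrow> (\<exists>c\<in>set cs. coinductive_con \<Sigma> c \<and> (case con_prio \<Sigma> c of
      None \<Rightarrow> False
    | Some p \<Rightarrow> (\<forall>c'\<in>set cs. case con_prio \<Sigma> c' of None \<Rightarrow> False | Some p' \<Rightarrow> p' \<le> p)))"
proof -
  have "(\<exists>p. m = Some p \<and> Q p) \<longleftrightarrow> (case m of None \<Rightarrow> False | Some p \<Rightarrow> Q p)"
    for m :: "nat option" and Q
    by (cases m) auto
  then show ?thesis unfolding guarding_def by simp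
qed

lemma effective_guarding [effective_intros]:
  "effective \<Sigma> \<Longrightarrow> effective cs \<Longrightarrow> effective (\<lambda>e. guarding (\<Sigma> e) (cs e))"
  by (rule effective_app2)
    (unfold guarding_eq_case, intro effective_intros effective_list_ex effective_list_all)

lemma effective_guarded [effective_intros]:
  assumes "effective \<Sigma>" "effective r" "effective M"
  shows "effective (\<lambda>e. guarded (\<Sigma> e) (r e) (M e))"
  by (rule effective_app3[OF _ assms])
    (unfold split_beta guarded_iff_reachable,
      intro effective_all_reachable effective_intros finite_search_space)


section \<open>Decidability of type checking\<close>

definition decl_ok :: "sig \<Rightarrow> sig \<Rightarrow> decl \<Rightarrow> bool" where
  "decl_ok \<Sigma> \<Xi> d \<longleftrightarrow> (case d of
      FamDecl a K \<Rightarrow> fam_kind \<Xi> a = None \<and> check_kind \<Xi> \<Sigma> False [] K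
    | ConDecl c A \<Rightarrow> con_type \<Xi> c = None \<and> check_ty \<Xi> \<Sigma> False [] A
    | RecDecl r A M \<Rightarrow> rec_def \<Xi> r = None \<and> check_ty \<Xi> \<Sigma> False [] A \<and> prepattern_ty A \<and>
        contractive M \<and> guarded \<Sigma> r M \<and> check_tm \<Xi> \<Sigma> True [] M A)"

lemma sig_ok_Cons: "sig_ok \<Sigma> (d # \<Xi>) \<longleftrightarrow> sig_ok \<Sigma> \<Xi> \<and> decl_ok \<Sigma> \<Xi> d"
  by (subst sig_ok.simps) (cases d; auto simp: decl_ok_def)

lemma effective_decl_ok [effective_intros]:
  assumes "effective \<Sigma>" "effective \<Xi>" "effective d"
  shows "effective (\<lambda>e. decl_ok (\<Sigma> e) (\<Xi> e) (d e))"
  by (rule effective_app3[OF _ assms]) (unfold decl_ok_def, intro effective_intros)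

lemma effective_sig_ok [effective_intros]:
  assumes "effective \<Sigma>" "effective \<Xi>"
  shows "effective (\<lambda>e. sig_ok (\<Sigma> e) (\<Xi> e))"
proof (rule effective_rec2[OF _ _ assms])
  let ?F = "\<lambda>h (\<Sigma>, \<Xi>). case \<Xi> of
      [] \<Rightarrow> Some True
    | d # \<Xi> \<Rightarrow> if decl_ok \<Sigma> \<Xi> d then h (\<Sigma>, \<Xi>) else Some False"
  show "effective_op ?F" by (intro effective_intros)
  show "h (\<Sigma>, \<Xi>) = Some (sig_ok \<Sigma> \<Xi>)" if "\<And>z. h z = ?F h z" for h \<Sigma> \<Xi>
    by (induction \<Xi>) (subst that, simp add: sig_ok_Cons sig_ok.intros)+
qed

lemma decidable_synthI:
  fixes g :: "'a::godel \<Rightarrow> 'b::godel_enum option"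
  assumes "effective g" "\<And>x y. J x y \<longleftrightarrow> g x = Some y"
  shows "decidable_synth J"
  unfolding decidable_synth_def using effective_imp_computable[OF assms(1)] assms(2) by blast

theorem theorem5:
  shows "decidable (\<lambda>\<Sigma>. sig_valid \<Sigma>)
    \<and> decidable (\<lambda>(\<Sigma>, \<Xi>). sig_ok \<Sigma> \<Xi>)
    \<and> decidable (\<lambda>(\<Xi>, \<Sigma>, \<delta>, \<Gamma>). ctx_ok \<Xi> \<Sigma> \<delta> \<Gamma>)
    \<and> decidable (\<lambda>(\<Xi>, \<Sigma>, \<delta>, \<Gamma>, K). check_kind \<Xi> \<Sigma> \<delta> \<Gamma> K)
    \<and> decidable (\<lambda>(\<Xi>, \<Sigma>, \<delta>, \<Gamma>, A). check_ty \<Xi> \<Sigma> \<delta> \<Gamma> A)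
    \<and> decidable (\<lambda>(\<Xi>, \<Sigma>, \<delta>, \<Gamma>, M, A). check_tm \<Xi> \<Sigma> \<delta> \<Gamma> M A)
    \<and> decidable (\<lambda>(\<Sigma>, \<Gamma>, A1, A2). ty_eq \<Sigma> \<Gamma> A1 A2)
    \<and> decidable (\<lambda>(\<Sigma>, \<Gamma>, P1, P2). aty_eq \<Sigma> \<Gamma> P1 P2)
    \<and> decidable_synth (\<lambda>(\<Xi>, \<Sigma>, \<delta>, \<Gamma>, P) K. synth_aty \<Xi> \<Sigma> \<delta> \<Gamma> P K)
    \<and> decidable_synth (\<lambda>(\<Xi>, \<Sigma>, \<delta>, \<Gamma>, S, K) K'. kind_spine \<Xi> \<Sigma> \<delta> \<Gamma> S K K')
    \<and> decidable_synth (\<lambda>(\<Xi>, \<Sigma>, \<delta>, \<Gamma>, R) P. synth_neu \<Xi> \<Sigma> \<delta> \<Gamma> R P)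
    \<and> decidable_synth (\<lambda>(\<Xi>, \<Sigma>, \<delta>, \<Gamma>, S, A) P. ty_spine \<Xi> \<Sigma> \<delta> \<Gamma> S A P)"
proof (intro conjI)
  show "decidable (\<lambda>\<Sigma>. sig_valid \<Sigma>)"
    "decidable (\<lambda>(\<Sigma>, \<Xi>). sig_ok \<Sigma> \<Xi>)"
    "decidable (\<lambda>(\<Xi>, \<Sigma>, \<delta>, \<Gamma>). ctx_ok \<Xi> \<Sigma> \<delta> \<Gamma>)"
    "decidable (\<lambda>(\<Xi>, \<Sigma>, \<delta>, \<Gamma>, K). check_kind \<Xi> \<Sigma> \<delta> \<Gamma> K)"
    "decidable (\<lambda>(\<Xi>, \<Sigma>, \<delta>, \<Gamma>, A). check_ty \<Xi> \<Sigma> \<delta> \<Gamma> A)"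
    "decidable (\<lambda>(\<Xi>, \<Sigma>, \<delta>, \<Gamma>, M, A). check_tm \<Xi> \<Sigma> \<delta> \<Gamma> M A)"
    "decidable (\<lambda>(\<Sigma>, \<Gamma>, A1, A2). ty_eq \<Sigma> \<Gamma> A1 A2)"
    "decidable (\<lambda>(\<Sigma>, \<Gamma>, P1, P2). aty_eq \<Sigma> \<Gamma> P1 P2)"
    unfolding sig_valid_def by (rule effective_imp_decidable, intro effective_intros)+
  show "decidable_synth (\<lambda>(\<Xi>, \<Sigma>, \<delta>, \<Gamma>, P) K. synth_aty \<Xi> \<Sigma> \<delta> \<Gamma> P K)"
    by (rule decidable_synthI[of "\<lambda>(\<Xi>, \<Sigma>, \<delta>, \<Gamma>, P). synth_aty_alg \<Xi> \<Sigma> \<delta> \<Gamma> P"])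
      (intro effective_intros, simp add: synth_aty_iff_alg split_beta)
  show "decidable_synth (\<lambda>(\<Xi>, \<Sigma>, \<delta>, \<Gamma>, S, K) K'. kind_spine \<Xi> \<Sigma> \<delta> \<Gamma> S K K')"
    by (rule decidable_synthI[of "\<lambda>(\<Xi>, \<Sigma>, \<delta>, \<Gamma>, S, K). kind_spine_alg \<Xi> \<Sigma> \<delta> \<Gamma> S K"])
      (intro effective_intros, simp add: kind_spine_iff_alg split_beta)
  show "decidable_synth (\<lambda>(\<Xi>, \<Sigma>, \<delta>, \<Gamma>, R) P. synth_neu \<Xi> \<Sigma> \<delta> \<Gamma> R P)"
    by (rule decidable_synthI[of "\<lambda>(\<Xi>, \<Sigma>, \<delta>, \<Gamma>, R). synth_neu_alg \<Xi> \<Sigma> \<delta> \<Gamma> R"])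
      (intro effective_intros, simp add: synth_neu_iff_alg split_beta)
  show "decidable_synth (\<lambda>(\<Xi>, \<Sigma>, \<delta>, \<Gamma>, S, A) P. ty_spine \<Xi> \<Sigma> \<delta> \<Gamma> S A P)"
    by (rule decidable_synthI[of "\<lambda>(\<Xi>, \<Sigma>, \<delta>, \<Gamma>, S, A). ty_spine_alg \<Xi> \<Sigma> \<delta> \<Gamma> S A"])
      (intro effective_intros, simp add: ty_spine_iff_alg split_beta)
qed

end
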